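(* Let $r \in (0,1)$. Let $X_1, X_2, \dots$ be i.i.d. centered log-concave random vectors in $\mathbb{R}^d$, and let $Z_n = \frac{X_1 + \cdots + X_n}{\sqrt{n}}$. Then $h_r(Z_n) < +\infty$ for all $n \geq 1$, and $$\lim_{n\to\infty} h_r(Z_n) = h_r(Z),$$ where $Z$ is a Gaussian random vector with mean $0$ and the same covariance matrix as $X_1$.
   Context: For a random vector $X$ in $\mathbb{R}^d$ with density $f$ with respect to Lebesgue measure and $r \in (0,1)\cup(1,\infty)$, the $r$-R\'enyi entropy is $h_r(X) = \frac{1}{1-r}\log \int_{\mathbb{R}^d} f(x)^r\,dx$. A random vector in $\mathbb{R}^d$ is log-concave if it has a density $f$ with respect to Lebesgue measure satisfying $f((1-\lambda)x+\lambda y)\geq f(x)^{1-\lambda}f(y)^{\lambda}$ for all $x,y\in\mathbb{R}^d$ with $f(x)f(y)>0$ and all $\lambda\in(0,1)$. *)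

theory Defs
  imports "HOL-Probability.Probability"
begin

definition ln_ennreal :: "ennreal \<Rightarrow> ereal" where
  "ln_ennreal x =
     (if x = 0 then -\<infinity> else if x = \<infinity> then \<infinity> else ereal (ln (enn2real x)))"

definition has_lborel_density :: "'a measure \<Rightarrow> ('a \<Rightarrow> real ^ 'd) \<Rightarrow> bool" where
  "has_lborel_density M X \<longleftrightarrow> (\<exists>f. distributed M lborel X f)"

(* The density is taken to be the Radon-Nikodym derivative of the law; it is unique up to null sets,
   so the integral does not depend on the choice. Extended values keep a divergent integral
   visible. The value is meaningful only under has_lborel_density M X. *)
definition renyi_entropy :: "real \<Rightarrow> 'a measure \<Rightarrow> ('a \<Rightarrow> real ^ 'd) \<Rightarrow> ereal" where
  "renyi_entropy r M X =
     ereal (1 / (1 - r)) *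
     ln_ennreal (\<integral>\<^sup>+ x. ennreal (enn2real (RN_deriv lborel (distr M lborel X) x) powr r) \<partial>lborel)"

definition log_concave_vector :: "'a measure \<Rightarrow> ('a \<Rightarrow> real ^ 'd) \<Rightarrow> bool" where
  "log_concave_vector M X \<longleftrightarrow>
     (\<exists>f :: real ^ 'd \<Rightarrow> real.
        (\<forall>x. 0 \<le> f x) \<and> distributed M lborel X (\<lambda>x. ennreal (f x)) \<and>
        (\<forall>x y. \<forall>t\<in>{0<..<1::real}. f x * f y > 0 \<longrightarrow>
           f ((1 - t) *\<^sub>R x + t *\<^sub>R y) \<ge> f x powr (1 - t) * f y powr t))"

(* Integrability is explicit because the Bochner integral of a non-integrable function is 0. *)
definition centered_vector :: "'a measure \<Rightarrow> ('a \<Rightarrow> real ^ 'd) \<Rightarrow> bool" where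
  "centered_vector M X \<longleftrightarrow> integrable M X \<and> (\<integral>\<omega>. X \<omega> \<partial>M) = 0"

definition covariance_matrix :: "'a measure \<Rightarrow> ('a \<Rightarrow> real ^ 'd) \<Rightarrow> real ^ 'd ^ 'd" where
  "covariance_matrix M X =
     (\<chi> i j. \<integral>\<omega>. (X \<omega> $ i - (\<integral>\<eta>. X \<eta> $ i \<partial>M)) * (X \<omega> $ j - (\<integral>\<eta>. X \<eta> $ j \<partial>M)) \<partial>M)"

definition gaussian_density :: "real ^ 'd \<Rightarrow> real ^ 'd ^ 'd \<Rightarrow> real ^ 'd \<Rightarrow> real" where
  "gaussian_density m S x =
     exp (- ((x - m) \<bullet> (matrix_inv S *v (x - m))) / 2) / sqrt ((2 * pi) ^ CARD('d) * det S)"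

(* Only non-degenerate Gaussian laws. Nothing is lost when the covariance matrix is that of a
   square-integrable vector with a Lebesgue density: such a matrix is positive definite. *)
definition gaussian_vector :: "'a measure \<Rightarrow> ('a \<Rightarrow> real ^ 'd) \<Rightarrow> bool" where
  "gaussian_vector M Z \<longleftrightarrow>
     (\<exists>m S. transpose S = S \<and> (\<forall>x. x \<noteq> 0 \<longrightarrow> x \<bullet> (S *v x) > 0) \<and>
        distributed M lborel Z (\<lambda>x. ennreal (gaussian_density m S x)))"

definition normalized_sum :: "(nat \<Rightarrow> 'a \<Rightarrow> real ^ 'd) \<Rightarrow> nat \<Rightarrow> 'a \<Rightarrow> real ^ 'd" where
  "normalized_sum X n \<omega> = (1 / sqrt (real n)) *\<^sub>R (\<Sum>i = 1..n. X i \<omega>)"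

end

theory Submission
  imports Defs
begin

text \<open>
  The proof combines a local limit theorem with uniform control of tails.

  A log-concave probability density is bounded and decays exponentially
  (\<open>log_concave_exponential_bound\<close>). A summand therefore has an exponential
  moment, and since it is centred, the exponential moments of the normalized sums are bounded uniformly in \<open>n\<close> (\<open>exp_moment_normalized_sum\<close>). As
  \<open>y powr r \<le> exp (- a * r * norm x) + y * exp (a * norm x)\<close> for all \<open>y \<ge> 0\<close>, an exponential moment makes
  the \<open>r\<close>-th power of a density integrable, which gives finiteness of the entropies.

  For the convergence, let \<open>p n\<close> be the density of the \<open>n\<close>-th normalized sum and \<open>q\<close> the Gaussian
  density. Both characteristic functions are integrable for \<open>n \<ge> 2\<close>, so Fourier inversion bounds
  \<open>\<bar>p n - q\<bar>\<close> almost everywhere by a multiple \<open>\<epsilon> n\<close> of the \<open>L\<^sup>1\<close> distance of the characteristic functions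
  (\<open>density_diff_le_charf_diff\<close>). That distance tends to \<open>0\<close> (\<open>charf_power_L1_limit\<close>): pointwise convergence
  is the usual second-order expansion, and domination rests on three facts about the characteristic
  function \<open>\<psi>\<close> of a summand. It is square integrable, because the density is bounded; being also
  Lipschitz, because the first moment is finite, it is at most \<open>1 / 2\<close> in modulus outside some ball; and the inequality
  \<open>1 - norm (\<psi> (2 * u)) \<le> 4 * (1 - norm (\<psi> u))\<close> propagates this to a Gaussian bound inside the ball.

  Finally \<open>\<bar>p n powr r - q powr r\<bar> \<le> D powr r\<close> with \<open>D = \<bar>p n - q\<bar> \<le> \<epsilon> n\<close>, and
  \<open>D powr r \<le> (\<epsilon> n) powr (r / 2) * D powr (r / 2)\<close>, where the integral of \<open>D powr (r / 2)\<close> is bounded by the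
  exponential moments (\<open>powr_integral_tendsto\<close>).

  The characteristic function of the Gaussian law comes from the same expansion: the law is
  stable under \<open>(Z + Z') / sqrt 2\<close>, so its characteristic function is the limit that the expansion
  produces along the powers of \<open>2\<close> (\<open>charf_gaussian\<close>). Since that limit involves second
  moments only, the assumption on the covariance matrices identifies it with the limit for the
  normalized sums.
\<close>

section \<open>Product integrals and the Gaussian kernel\<close>

lemma
  fixes g :: "'a::euclidean_space \<Rightarrow> real \<Rightarrow> 'b::{real_normed_field,banach,second_countable_topology}"
  assumes int: "\<And>b. b \<in> Basis \<Longrightarrow> integrable lborel (g b)"
  shows integrable_lborel_prod: "integrable lborel (\<lambda>x::'a. \<Prod>b\<in>Basis. g b (x \<bullet> b))"
    and integral_lborel_prod: "(\<integral>x. (\<Prod>b\<in>Basis. g b (x \<bullet> b)) \<partial>(lborel :: 'a measure)) = (\<Prod>b\<in>Basis. \<integral>s. g b s \<partial>lborel)"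
proof -
  interpret product_sigma_finite "\<lambda>b::'a. lborel :: real measure" ..
  have [measurable]: "g b \<in> borel_measurable borel" if "b \<in> Basis" for b
    using borel_measurable_integrable[OF int[OF that]] by simp
  have coord: "(\<Sum>b\<in>Basis. h b *\<^sub>R b) \<bullet> c = h c" if "c \<in> Basis" for h :: "'a \<Rightarrow> real" and c
    using that by simp
  have eq: "(lborel :: 'a measure) =
      distr (\<Pi>\<^sub>M b\<in>Basis. lborel) borel (\<lambda>h. \<Sum>b\<in>Basis. h b *\<^sub>R b)"
    by (subst lborel_def) (simp add: lborel_eq_real)
  have meas: "(\<lambda>x::'a. \<Prod>b\<in>Basis. g b (x \<bullet> b)) \<in> borel_measurable borel"
    by measurable
  have meas2: "(\<lambda>h. \<Sum>b\<in>Basis. h b *\<^sub>R b) \<in> measurable (\<Pi>\<^sub>M b\<in>Basis. lborel) (borel :: 'a measure)"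
    by measurable
  show "integrable lborel (\<lambda>x::'a. \<Prod>b\<in>Basis. g b (x \<bullet> b))"
    unfolding eq
    apply (subst integrable_distr_eq[OF meas2 meas])
    using product_integrable_prod[of Basis g] int by (simp add: coord cong: prod.cong)
  show "(\<integral>x. (\<Prod>b\<in>Basis. g b (x \<bullet> b)) \<partial>(lborel :: 'a measure)) = (\<Prod>b\<in>Basis. \<integral>s. g b s \<partial>lborel)"
    apply (subst eq)
    apply (subst integral_distr[OF meas2 meas])
    using product_integral_prod[of Basis g] int by (simp add: coord cong: prod.cong)
qed

lemma integrable_exp_abs:
  assumes "0 < (a::real)"
  shows "integrable lborel (\<lambda>s::real. exp (- a * \<bar>s\<bar>))"
proof -
  have 1: "integrable lborel (\<lambda>s. indicator {0<..} s * exp (- (s * a)))"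
    using integrable_I0i_exp_mscale[OF assms] by (simp add: set_integrable_def)
  have 2: "integrable lborel (\<lambda>s. indicator {0<..} (-s) * exp (- (- s * a)))"
    using lborel_integrable_real_affine[OF 1, of "-1" 0] by simp
  show ?thesis
  proof (rule Bochner_Integration.integrable_bound)
    show "integrable lborel (\<lambda>s. indicator {0<..} s * exp (- (s * a)) +
      indicator {0<..} (-s) * exp (- (- s * a)))"
      using 1 2 by (rule Bochner_Integration.integrable_add)
    show "AE s in lborel. norm (exp (- a * \<bar>s\<bar>)) \<le>
       norm (indicator {0<..} s * exp (- (s * a)) + indicator {0<..} (-s) * exp (- (- s * a)))"
      using AE_lborel_singleton[of "0::real"]
      by eventually_elim (auto simp: indicator_def mult.commute)
  qed simp
qed

text \<open>
  The norm is at least the mean of the absolute coordinates, so a product of one-dimensional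
  two-sided exponentials is a majorant.
\<close>

lemma integrable_exp_norm:
  assumes "0 < (a::real)"
  shows "integrable lborel (\<lambda>x::'a::euclidean_space. exp (- a * norm x))"
proof (rule Bochner_Integration.integrable_bound)
  let ?a = "a / DIM('a)"
  show "integrable lborel (\<lambda>x::'a. \<Prod>b\<in>Basis. exp (- ?a * \<bar>x \<bullet> b\<bar>))"
    using integrable_lborel_prod[of "\<lambda>_ s. exp (- ?a * \<bar>s\<bar>)"] integrable_exp_abs[of ?a] assms by simp
  show "AE x::'a in lborel. norm (exp (- a * norm x)) \<le> norm (\<Prod>b\<in>Basis. exp (- ?a * \<bar>x \<bullet> b\<bar>))"
  proof (rule AE_I2)
    fix x :: 'a
    have "(\<Sum>b\<in>Basis. \<bar>x \<bullet> b\<bar>) \<le> (\<Sum>b\<in>(Basis::'a set). norm x)"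
      by (intro sum_mono Basis_le_norm)
    then have "?a * (\<Sum>b\<in>Basis. \<bar>x \<bullet> b\<bar>) \<le> ?a * (DIM('a) * norm x)"
      using assms by (intro mult_left_mono) auto
    then have "?a * (\<Sum>b\<in>Basis. \<bar>x \<bullet> b\<bar>) \<le> a * norm x" by simp
    then show "norm (exp (- a * norm x)) \<le> norm (\<Prod>b\<in>Basis. exp (- ?a * \<bar>x \<bullet> b\<bar>))"
      by (simp add: exp_sum[symmetric] sum_distrib_left sum_negf abs_prod)
  qed
qed simp

lemma integrable_exp_norm_square:
  assumes "0 < (c::real)"
  shows "integrable lborel (\<lambda>x::'a::euclidean_space. exp (- c * (norm x)\<^sup>2))"
proof (rule Bochner_Integration.integrable_bound)
  show "integrable lborel (\<lambda>x::'a. exp c * exp (- (2 * c) * norm x))"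
    using integrable_exp_norm[of "2 * c"] assms by (intro integrable_mult_right) auto
  show "AE x::'a in lborel. norm (exp (- c * (norm x)\<^sup>2)) \<le> norm (exp c * exp (- (2 * c) * norm x))"
  proof (rule AE_I2)
    fix x :: 'a
    have "0 \<le> c * (norm x - 1)\<^sup>2" using assms by simp
    then show "norm (exp (- c * (norm x)\<^sup>2)) \<le> norm (exp c * exp (- (2 * c) * norm x))"
      by (simp add: exp_add[symmetric] power2_diff algebra_simps)
  qed
qed simp

text \<open>
  The centred normal density with covariance \<open>\<sigma>\<^sup>2\<close> times the identity. The product form
  reduces every fact about it to the one-dimensional normal density.
\<close>

definition gauss_kernel :: "real \<Rightarrow> 'a::euclidean_space \<Rightarrow> real" where
  "gauss_kernel \<sigma> z = (\<Prod>b\<in>Basis. normal_density 0 \<sigma> (z \<bullet> b))"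

lemma norm_square_eq_sum: "(norm (x::'a::euclidean_space))\<^sup>2 = (\<Sum>b\<in>Basis. (x \<bullet> b)\<^sup>2)"
  unfolding power2_norm_eq_inner by (subst euclidean_inner) (simp add: power2_eq_square)

lemma gauss_kernel_nonneg [simp]: "0 \<le> gauss_kernel \<sigma> z"
  by (simp add: gauss_kernel_def prod_nonneg)

lemma gauss_kernel_measurable [measurable]: "gauss_kernel \<sigma> \<in> borel_measurable borel"
  unfolding gauss_kernel_def by measurable

lemma gauss_kernel_scale:
  assumes "0 < \<sigma>"
  shows "gauss_kernel \<sigma> (\<sigma> *\<^sub>R (w :: 'a::euclidean_space)) * \<sigma> ^ DIM('a) = gauss_kernel 1 w"
proof -
  have "normal_density 0 \<sigma> (\<sigma> * s) * \<sigma> = normal_density 0 1 s" for s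
    using assms by (simp add: normal_density_def power_mult_distrib real_sqrt_mult field_simps)
  then show ?thesis
    by (simp add: gauss_kernel_def prod_constant[symmetric] prod.distrib[symmetric]
        del: prod_constant)
qed

lemma gauss_kernel_integral:
  assumes "0 < \<sigma>"
  shows "integrable lborel (gauss_kernel \<sigma> :: 'a::euclidean_space \<Rightarrow> real)"
    and "(\<integral>z. gauss_kernel \<sigma> (z::'a) \<partial>lborel) = 1"
proof -
  have 1: "integrable lborel (normal_density 0 \<sigma>)" "(\<integral>x. normal_density 0 \<sigma> x \<partial>lborel) = 1"
    using assms by auto
  show "integrable lborel (gauss_kernel \<sigma> :: 'a \<Rightarrow> real)"
    unfolding gauss_kernel_def using integrable_lborel_prod[of "\<lambda>_. normal_density 0 \<sigma>"] 1 by simp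
  show "(\<integral>z. gauss_kernel \<sigma> (z::'a) \<partial>lborel) = 1"
    unfolding gauss_kernel_def using integral_lborel_prod[of "\<lambda>_. normal_density 0 \<sigma>"] 1 by simp
qed

text \<open>
  The standard normal density is, up to a constant, its own Fourier transform; rescaling by \<open>\<sigma>\<close>
  expresses every centred normal density as a Fourier integral. General Fourier inversion below is
  derived from this single computed instance.
\<close>

lemma fourier_gauss_real:
  assumes "0 < \<sigma>"
  shows "integrable lborel (\<lambda>s::real. complex_of_real (exp (- (\<sigma>\<^sup>2 * s\<^sup>2 / 2))) * iexp (- (s * z)))"
    and "(CLBINT s. complex_of_real (exp (- (\<sigma>\<^sup>2 * s\<^sup>2 / 2))) * iexp (- (s * z))) = of_real (2 * pi * normal_density 0 \<sigma> z)"
proof -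
  have 0: "integrable lborel (\<lambda>s. complex_of_real (std_normal_density s) * iexp (v * s))" for v :: real
    by (rule Bochner_Integration.integrable_bound[of _ "\<lambda>s. std_normal_density s"])
       (auto simp: norm_mult)
  have 1: "(CLBINT s. std_normal_density s * iexp (v * s)) = exp (- (v\<^sup>2) / 2)" for v :: real
  proof -
    have "char std_normal_distribution v = (CLBINT s. std_normal_density s * iexp (v * s))"
      unfolding char_def by (subst integral_density) (auto simp: scaleR_conv_of_real)
    then show ?thesis by (simp add: char_std_normal_distribution)
  qed
  have eq: "complex_of_real (exp (- (\<sigma>\<^sup>2 * s\<^sup>2 / 2))) * iexp (- (s * z)) =
      complex_of_real (sqrt (2 * pi)) *
      (std_normal_density (0 + \<sigma> * s) * iexp (- z / \<sigma> * (0 + \<sigma> * s)))" for s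
    using assms by (simp add: std_normal_density_def power_mult_distrib mult.commute)
  have 2: "integrable lborel (\<lambda>s. complex_of_real (std_normal_density (0 + \<sigma> * s)) * iexp (- z / \<sigma> * (0 + \<sigma> * s)))"
    using lborel_integrable_real_affine[OF 0, of \<sigma> 0 "- z / \<sigma>"] assms by simp
  show "integrable lborel (\<lambda>s::real. complex_of_real (exp (- (\<sigma>\<^sup>2 * s\<^sup>2 / 2))) * iexp (- (s * z)))"
    unfolding eq using 2 by (rule integrable_mult_right)
  have "(CLBINT s. std_normal_density s * iexp (- z / \<sigma> * s)) =
     \<sigma> *\<^sub>R (CLBINT s. std_normal_density (0 + \<sigma> * s) * iexp (- z / \<sigma> * (0 + \<sigma> * s)))"
    using lborel_integral_real_affine[of \<sigma> "\<lambda>s. complex_of_real (std_normal_density s) * iexp (- z / \<sigma> * s)" 0] assms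
    by simp
  then have 3: "(CLBINT s. std_normal_density (0 + \<sigma> * s) * iexp (- z / \<sigma> * (0 + \<sigma> * s)))
    = exp (- ((z / \<sigma>)\<^sup>2) / 2) / \<sigma>"
    using assms 1[of "- z / \<sigma>"] by (simp add: scaleR_conv_of_real field_simps)
  have "(CLBINT s. complex_of_real (exp (- (\<sigma>\<^sup>2 * s\<^sup>2 / 2))) * iexp (- (s * z))) =
      complex_of_real (sqrt (2 * pi)) * (exp (- ((z / \<sigma>)\<^sup>2) / 2) / \<sigma>)"
    unfolding eq 3[symmetric] by (rule integral_mult_right_zero)
  also have "\<dots> = complex_of_real (sqrt (2 * pi) * (exp (- ((z / \<sigma>)\<^sup>2) / 2) / \<sigma>))" by simp
  also have "sqrt (2 * pi) * (exp (- ((z / \<sigma>)\<^sup>2) / 2) / \<sigma>) = 2 * pi * normal_density 0 \<sigma> z"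
  proof -
    have "2 * pi = sqrt (2 * pi) * sqrt (2 * pi)" by simp
    then show ?thesis
      using assms by (simp add: normal_density_def real_sqrt_mult field_simps)
  qed
  finally show "(CLBINT s. complex_of_real (exp (- (\<sigma>\<^sup>2 * s\<^sup>2 / 2))) * iexp (- (s * z))) = of_real (2 * pi * normal_density 0 \<sigma> z)" .
qed

lemma fourier_gauss:
  assumes "0 < \<sigma>"
  shows "(CLINT t|lborel. complex_of_real (exp (- (\<sigma>\<^sup>2 * (norm t)\<^sup>2 / 2))) * iexp (- (t \<bullet> z))) =
    of_real ((2 * pi) ^ DIM('a) * gauss_kernel \<sigma> (z::'a::euclidean_space))"
proof -
  have eq: "complex_of_real (exp (- (\<sigma>\<^sup>2 * (norm t)\<^sup>2 / 2))) * iexp (- (t \<bullet> z)) =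
    (\<Prod>b\<in>Basis. complex_of_real (exp (- (\<sigma>\<^sup>2 * (t \<bullet> b)\<^sup>2 / 2))) * iexp (- ((t \<bullet> b) * (z \<bullet> b))))" for t :: 'a
  proof -
    have "t \<bullet> z = (\<Sum>b\<in>Basis. (t \<bullet> b) * (z \<bullet> b))" by (rule euclidean_inner)
    then show ?thesis
      by (simp add: prod.distrib exp_sum[symmetric] norm_square_eq_sum sum_distrib_left
         sum_negf sum_divide_distrib flip: of_real_prod)
  qed
  show ?thesis
    unfolding eq
    by (subst integral_lborel_prod)
       (simp_all only: fourier_gauss_real[OF assms], simp add: gauss_kernel_def prod.distrib)
qed

lemma lborel_affine_substitution:
  fixes f :: "'a::euclidean_space \<Rightarrow> 'b::{banach,second_countable_topology}"
  assumes [measurable]: "f \<in> borel_measurable borel" and c: "c \<noteq> 0"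
  shows "integrable lborel (\<lambda>x. f (t + c *\<^sub>R x)) \<longleftrightarrow> integrable lborel f"
    and "(\<integral>x. f x \<partial>lborel) = \<bar>c\<bar> ^ DIM('a) *\<^sub>R (\<integral>x. f (t + c *\<^sub>R x) \<partial>lborel)"
proof -
  have eq: "(lborel :: 'a measure) = density (distr lborel borel (\<lambda>x. t + c *\<^sub>R x)) (\<lambda>_. ennreal (\<bar>c\<bar> ^ DIM('a)))"
    using lborel_affine[OF c, of t] by (simp add: ennreal_power)
  show "integrable lborel (\<lambda>x. f (t + c *\<^sub>R x)) \<longleftrightarrow> integrable lborel f"
    apply (subst (2) eq)
    apply (subst integrable_density)
    using c integrable_scaleR_right[of "inverse (\<bar>c\<bar> ^ DIM('a))" lborel "\<lambda>x. \<bar>c\<bar> ^ DIM('a) *\<^sub>R f (t + c *\<^sub>R x)"]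
    by (auto simp: integrable_distr_eq)
  show "(\<integral>x. f x \<partial>lborel) = \<bar>c\<bar> ^ DIM('a) *\<^sub>R (\<integral>x. f (t + c *\<^sub>R x) \<partial>lborel)"
    apply (subst eq)
    apply (subst integral_density)
    using c by (simp_all add: integral_distr)
qed

section \<open>Characteristic functions and Fourier inversion\<close>

lemma integral_of_prob_density:
  fixes f :: "'a::euclidean_space \<Rightarrow> real"
  assumes "prob_space (density lborel f)" and [measurable]: "f \<in> borel_measurable borel" and nonneg: "\<And>x. 0 \<le> f x"
  shows "integrable lborel f" "(\<integral>x. f x \<partial>lborel) = 1"
proof -
  interpret prob_space "density lborel f" by fact
  have "(\<integral>\<^sup>+x. ennreal (f x) \<partial>lborel) = emeasure (density lborel f) (space (density lborel f))"
    by (subst emeasure_density) (auto intro!: nn_integral_cong)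
  then have nn: "(\<integral>\<^sup>+x. ennreal (f x) \<partial>lborel) = ennreal 1" using emeasure_space_1 by simp
  then show int: "integrable lborel f" by (intro integrableI_nonneg) (auto simp: nonneg)
  show "(\<integral>x. f x \<partial>lborel) = 1"
    using nn nonneg by (subst (asm) nn_integral_eq_integral[OF int]) (auto simp del: ennreal_1)
qed

definition charf :: "'a::euclidean_space measure \<Rightarrow> 'a \<Rightarrow> complex" where
  "charf \<mu> t = (CLINT x|\<mu>. iexp (t \<bullet> x))"

lemma charf_measurable [measurable]:
  assumes "prob_space \<mu>" and [measurable_cong]: "sets \<mu> = sets borel"
  shows "charf \<mu> \<in> borel_measurable borel"
proof -
  interpret prob_space \<mu> by fact
  show ?thesis unfolding charf_def by measurable
qed

lemma norm_charf_le_1: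
  assumes "prob_space \<mu>"
  shows "norm (charf \<mu> t) \<le> 1"
proof -
  interpret prob_space \<mu> by fact
  have "norm (charf \<mu> t) \<le> (\<integral>x. norm (iexp (t \<bullet> x)) \<partial>\<mu>)"
    unfolding charf_def by (rule integral_norm_bound)
  also have "\<dots> \<le> 1" by (simp add: prob_space)
  finally show ?thesis .
qed

text \<open>
  Writing the kernel as a Fourier integral and exchanging the integrations gives the inversion
  formula for the law smoothed by an independent Gaussian of size \<open>\<sigma>\<close>. The Gaussian factor
  makes the double integral absolutely convergent for every law.
\<close>

lemma smoothed_density_eq_fourier:
  fixes \<mu> :: "'a::euclidean_space measure"
  assumes "prob_space \<mu>" and sets [measurable_cong]: "sets \<mu> = sets borel" and \<sigma>: "0 < \<sigma>"
  shows "(CLINT t|lborel. complex_of_real (exp (- (\<sigma>\<^sup>2 * (norm t)\<^sup>2 / 2))) * (iexp (- (t \<bullet> x)) * charf \<mu> t)) =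
    of_real ((2 * pi) ^ DIM('a) * (\<integral>y. gauss_kernel \<sigma> (x - y) \<partial>\<mu>))"
proof -
  interpret \<mu>: prob_space \<mu> by fact
  interpret P: pair_sigma_finite lborel \<mu> ..
  let ?K = "\<lambda>t::'a. complex_of_real (exp (- (\<sigma>\<^sup>2 * (norm t)\<^sup>2 / 2)))"
  let ?F = "\<lambda>t y. ?K t * iexp (- (t \<bullet> (x - y)))"
  have int_K: "integrable lborel (\<lambda>t::'a. exp (- (\<sigma>\<^sup>2 * (norm t)\<^sup>2 / 2)))"
    using integrable_exp_norm_square[of "\<sigma>\<^sup>2 / 2"] \<sigma> by simp
  have int: "integrable (lborel \<Otimes>\<^sub>M \<mu>) (case_prod ?F)"
  proof (rule P.Fubini_integrable)
    show "case_prod ?F \<in> borel_measurable (lborel \<Otimes>\<^sub>M \<mu>)" by measurable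
    show "integrable lborel (\<lambda>t. \<integral>y. norm (case_prod ?F (t, y)) \<partial>\<mu>)"
      using int_K by (simp add: norm_mult \<mu>.prob_space)
    show "AE t in lborel. integrable \<mu> (\<lambda>y. case_prod ?F (t, y))"
      by (intro AE_I2 \<mu>.integrable_const_bound[where B=1]) (auto simp: norm_mult)
  qed
  have "(CLINT t|lborel. ?K t * (iexp (- (t \<bullet> x)) * charf \<mu> t)) = (CLINT t|lborel. CLINT y|\<mu>. ?F t y)"
    by (simp add: charf_def integral_mult_right_zero[symmetric] exp_add[symmetric] inner_diff_right algebra_simps
        del: integral_mult_right_zero)
  also have "\<dots> = (CLINT y|\<mu>. CLINT t|lborel. ?F t y)"
    using P.Fubini_integral[OF int] by simp
  also have "\<dots> = (CLINT y|\<mu>. of_real ((2 * pi) ^ DIM('a) * gauss_kernel \<sigma> (x - y)))"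
    by (simp only: fourier_gauss[OF \<sigma>])
  also have "\<dots> = of_real ((2 * pi) ^ DIM('a) * (\<integral>y. gauss_kernel \<sigma> (x - y) \<partial>\<mu>))"
    by (simp only: integral_complex_of_real integral_mult_right_zero)
  finally show ?thesis .
qed

text \<open>
  The mass that the smoothed law gives to a box, seen as an average over the standard Gaussian
  noise. This form shows what happens when \<open>\<sigma>\<close> tends to \<open>0\<close>: the inner integral tends to the
  indicator of the box away from its boundary.
\<close>

lemma integral_smoothed_density_box:
  fixes \<mu> :: "'a::euclidean_space measure" and l u :: 'a
  assumes "prob_space \<mu>" and sets [measurable_cong]: "sets \<mu> = sets borel" and \<sigma>: "0 < \<sigma>"
  shows "(\<integral>x. indicator (box l u) x * (\<integral>y. gauss_kernel \<sigma> (x - y) \<partial>\<mu>) \<partial>lborel) =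
    (\<integral>y. (\<integral>w. gauss_kernel 1 w * indicator (box l u) (y + \<sigma> *\<^sub>R w) \<partial>lborel) \<partial>\<mu>)"
proof -
  interpret \<mu>: prob_space \<mu> by fact
  interpret P: pair_sigma_finite \<mu> "lborel :: 'a measure" ..
  let ?B = "box l u"
  let ?F = "\<lambda>y x. indicator ?B x * gauss_kernel \<sigma> (x - y) :: real"
  have subst: "(\<integral>x. ?F y x \<partial>lborel) = (\<integral>w. gauss_kernel 1 w * indicator ?B (y + \<sigma> *\<^sub>R w) \<partial>lborel)" for y
  proof -
    have "(\<integral>x. ?F y x \<partial>lborel) = \<sigma> ^ DIM('a) *\<^sub>R (\<integral>w. indicator ?B (y + \<sigma> *\<^sub>R w) * gauss_kernel \<sigma> (\<sigma> *\<^sub>R w) \<partial>lborel)"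
      using \<sigma> by (subst lborel_affine_substitution(2)[where c=\<sigma> and t=y]) auto
    also have "\<dots> = (\<integral>w. gauss_kernel 1 w * indicator ?B (y + \<sigma> *\<^sub>R w) \<partial>lborel)"
      unfolding gauss_kernel_scale[OF \<sigma>, symmetric]
      by (simp add: integral_mult_right_zero[symmetric] mult_ac del: integral_mult_right_zero)
    finally show ?thesis .
  qed
  have int_shift: "integrable lborel (\<lambda>x. gauss_kernel \<sigma> (x - y))"
       "(\<integral>x. gauss_kernel \<sigma> (x - y) \<partial>lborel) = 1" for y :: 'a
    using lborel_affine_substitution[of "gauss_kernel \<sigma> :: 'a \<Rightarrow> real" 1 "- y"] gauss_kernel_integral[OF \<sigma>, where 'a='a]
    by simp_all
  have int_F: "integrable lborel (?F y)" for y
    by (rule Bochner_Integration.integrable_bound[OF int_shift(1)[of y]]) (auto simp: indicator_def)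
  have int: "integrable (\<mu> \<Otimes>\<^sub>M lborel) (case_prod ?F)"
  proof (rule P.Fubini_integrable)
    show "case_prod ?F \<in> borel_measurable (\<mu> \<Otimes>\<^sub>M lborel)" by measurable
    show "integrable \<mu> (\<lambda>y. \<integral>x. norm (case_prod ?F (y, x)) \<partial>lborel)"
    proof (rule \<mu>.integrable_const_bound[where B=1], rule AE_I2)
      fix y
      have "(\<integral>x. ?F y x \<partial>lborel) \<le> (\<integral>x. gauss_kernel \<sigma> (x - y) \<partial>lborel)"
        by (intro integral_mono int_F int_shift) (auto simp: indicator_def)
      then show "norm (\<integral>x. norm (case_prod ?F (y, x)) \<partial>lborel) \<le> 1"
        by (simp add: int_shift integral_nonneg_AE)
    qed measurable
    show "AE y in \<mu>. integrable lborel (\<lambda>x. case_prod ?F (y, x))"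
      using int_F by simp
  qed
  have "(\<integral>x. indicator ?B x * (\<integral>y. gauss_kernel \<sigma> (x - y) \<partial>\<mu>) \<partial>lborel) = (\<integral>x. (\<integral>y. ?F y x \<partial>\<mu>) \<partial>lborel)"
    by simp
  also have "\<dots> = (\<integral>y. (\<integral>x. ?F y x \<partial>lborel) \<partial>\<mu>)"
    using P.Fubini_integral[OF int] by simp
  finally show ?thesis by (simp only: subst)
qed

definition inverse_fourier :: "('a::euclidean_space \<Rightarrow> complex) \<Rightarrow> 'a \<Rightarrow> real" where
  "inverse_fourier \<psi> x = Re (CLINT t|lborel. iexp (- (t \<bullet> x)) * \<psi> t) / (2 * pi) ^ DIM('a)"

lemma inverse_fourier_measurable [measurable]:
  assumes [measurable]: "\<psi> \<in> borel_measurable borel"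
  shows "inverse_fourier \<psi> \<in> borel_measurable borel"
  unfolding inverse_fourier_def by measurable

lemma abs_inverse_fourier_le:
  fixes \<psi> :: "'a::euclidean_space \<Rightarrow> complex"
  shows "\<bar>inverse_fourier \<psi> x\<bar> \<le> (\<integral>t. norm (\<psi> t) \<partial>lborel) / (2 * pi) ^ DIM('a)"
proof -
  have "\<bar>Re (CLINT t|lborel. iexp (- (t \<bullet> x)) * \<psi> t)\<bar> \<le> norm (CLINT t|lborel. iexp (- (t \<bullet> x)) * \<psi> t)"
    by (rule abs_Re_le_cmod)
  also have "\<dots> \<le> (\<integral>t. norm (iexp (- (t \<bullet> x)) * \<psi> t) \<partial>lborel)"
    by (rule integral_norm_bound)
  also have "\<dots> = (\<integral>t. norm (\<psi> t) \<partial>lborel)" by (simp add: norm_mult)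
  finally show ?thesis by (simp add: inverse_fourier_def abs_divide power_abs divide_right_mono)
qed

lemma inverse_fourier_diff:
  assumes "integrable lborel \<psi>\<^sub>1" "integrable lborel \<psi>\<^sub>2"
  shows "inverse_fourier \<psi>\<^sub>1 x - inverse_fourier \<psi>\<^sub>2 x = inverse_fourier (\<lambda>t. \<psi>\<^sub>1 t - \<psi>\<^sub>2 t) x"
proof -
  have "integrable lborel (\<lambda>t. iexp (- (t \<bullet> x)) * \<psi> t)" if "integrable lborel \<psi>" for \<psi>
    using that by (rule Bochner_Integration.integrable_bound)
      (use borel_measurable_integrable[OF that] in \<open>auto simp: norm_mult\<close>)
  then show ?thesis
    using assms by (simp add: inverse_fourier_def right_diff_distrib diff_divide_distrib)
qed

text \<open>
  Let \<open>\<sigma>\<close> tend to \<open>0\<close> in the two expressions for the smoothed mass of a box. On the Fourier side the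
  integrable characteristic function dominates; on the other side the noise disappears, provided that
  the boundary of the box carries no mass.
\<close>

lemma measure_box_eq_inverse_fourier:
  fixes \<mu> :: "'a::euclidean_space measure" and l u :: 'a
  assumes \<mu>: "prob_space \<mu>" and sets [measurable_cong]: "sets \<mu> = sets borel"
    and int: "integrable lborel (charf \<mu>)"
    and fr: "frontier (box l u) \<in> null_sets \<mu>"
  shows "measure \<mu> (box l u) = (\<integral>x. indicator (box l u) x * inverse_fourier (charf \<mu>) x \<partial>lborel)"
proof -
  interpret \<mu>: prob_space \<mu> by fact
  note [measurable] = charf_measurable[OF \<mu> sets]
  let ?B = "box l u"
  define s where "s k = 1 / Suc k" for k
  have s: "0 < s k" for k by (simp add: s_def)
  have s0: "s \<longlonglongrightarrow> 0" unfolding s_def using LIMSEQ_Suc[OF lim_1_over_n] by simp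
  define C where "C = (\<integral>t. norm (charf \<mu> t) \<partial>lborel) / (2 * pi) ^ DIM('a)"
  define q where "q k x = (\<integral>y. gauss_kernel (s k) (x - y) \<partial>\<mu>)" for k x
  have q_eq: "q k = inverse_fourier (\<lambda>t. complex_of_real (exp (- ((s k)\<^sup>2 * (norm t)\<^sup>2 / 2))) * charf \<mu> t)" for k
    using smoothed_density_eq_fourier[OF \<mu> sets s[of k]]
    by (simp add: fun_eq_iff inverse_fourier_def q_def mult.left_commute)
  have q_bound: "\<bar>q k x\<bar> \<le> C" for k x
  proof -
    have "\<bar>q k x\<bar> \<le> (\<integral>t. norm (complex_of_real (exp (- ((s k)\<^sup>2 * (norm t)\<^sup>2 / 2))) * charf \<mu> t) \<partial>lborel) / (2 * pi) ^ DIM('a)"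
      unfolding q_eq by (rule abs_inverse_fourier_le)
    also have "\<dots> \<le> C" unfolding C_def
      by (intro divide_right_mono integral_mono' integrable_norm int)
         (auto simp: norm_mult mult_left_le_one_le)
    finally show ?thesis .
  qed
  have q_lim: "(\<lambda>k. q k x) \<longlonglongrightarrow> inverse_fourier (charf \<mu>) x" for x
  proof -
    have "(\<lambda>k. CLINT t|lborel. iexp (- (t \<bullet> x)) * (complex_of_real (exp (- ((s k)\<^sup>2 * (norm t)\<^sup>2 / 2))) * charf \<mu> t))
       \<longlonglongrightarrow> (CLINT t|lborel. iexp (- (t \<bullet> x)) * charf \<mu> t)"
    proof (rule integral_dominated_convergence[where w="\<lambda>t. norm (charf \<mu> t)"])
      show "AE t in lborel. (\<lambda>k. iexp (- (t \<bullet> x)) * (complex_of_real (exp (- ((s k)\<^sup>2 * (norm t)\<^sup>2 / 2))) * charf \<mu> t))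
          \<longlonglongrightarrow> iexp (- (t \<bullet> x)) * charf \<mu> t"
      proof (rule AE_I2)
        fix t :: 'a
        have "(\<lambda>k. exp (- ((s k)\<^sup>2 * (norm t)\<^sup>2 / 2))) \<longlonglongrightarrow> exp (- (0\<^sup>2 * (norm t)\<^sup>2 / 2))"
          by (intro tendsto_intros s0) auto
        then have "(\<lambda>k. iexp (- (t \<bullet> x)) * (complex_of_real (exp (- ((s k)\<^sup>2 * (norm t)\<^sup>2 / 2))) * charf \<mu> t))
          \<longlonglongrightarrow> iexp (- (t \<bullet> x)) * (complex_of_real 1 * charf \<mu> t)"
          by (intro tendsto_mult tendsto_const tendsto_of_real) simp
        then show "(\<lambda>k. iexp (- (t \<bullet> x)) * (complex_of_real (exp (- ((s k)\<^sup>2 * (norm t)\<^sup>2 / 2))) * charf \<mu> t))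
          \<longlonglongrightarrow> iexp (- (t \<bullet> x)) * charf \<mu> t" by simp
      qed
    qed (use int in \<open>auto simp: norm_mult mult_left_le_one_le\<close>)
    then show ?thesis
      unfolding q_eq inverse_fourier_def by (intro tendsto_divide tendsto_Re tendsto_const) auto
  qed
  have [measurable]: "q k \<in> borel_measurable borel" for k unfolding q_eq by measurable
  have int_B: "integrable lborel (\<lambda>x. C * indicator ?B x)"
    by (intro integrable_mult_right) (use emeasure_lborel_box_finite[of l u] in \<open>simp add: integrable_indicator_iff\<close>)
  have lim1: "(\<lambda>k. \<integral>x. indicator ?B x * q k x \<partial>lborel) \<longlonglongrightarrow> (\<integral>x. indicator ?B x * inverse_fourier (charf \<mu>) x \<partial>lborel)"
    by (rule integral_dominated_convergence[OF _ _ int_B])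
       (auto intro!: tendsto_mult q_lim simp: indicator_def q_bound)
  have ind_lim: "(\<lambda>k. indicator ?B (y + s k *\<^sub>R w)) \<longlonglongrightarrow> (indicator ?B y :: real)" if "y \<notin> frontier ?B" for y w
  proof -
    have lim: "(\<lambda>k. y + s k *\<^sub>R w) \<longlonglongrightarrow> y + 0 *\<^sub>R w" by (intro tendsto_intros s0)
    have "isCont (indicator ?B :: 'a \<Rightarrow> real) y"
      using that by (simp add: isCont_indicator)
    then show ?thesis using isCont_tendsto_compose[of y "indicator ?B :: 'a \<Rightarrow> real"] lim by simp
  qed
  have gk: "integrable lborel (gauss_kernel 1 :: 'a \<Rightarrow> real)" "(\<integral>w. gauss_kernel 1 (w::'a) \<partial>lborel) = 1"
    using gauss_kernel_integral[of 1] by auto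
  have inner_lim: "(\<lambda>k. \<integral>w. gauss_kernel 1 w * indicator ?B (y + s k *\<^sub>R w) \<partial>lborel) \<longlonglongrightarrow> indicator ?B y"
    if "y \<notin> frontier ?B" for y
  proof -
    have "(\<lambda>k. \<integral>w. gauss_kernel 1 w * indicator ?B (y + s k *\<^sub>R w) \<partial>lborel) \<longlonglongrightarrow> (\<integral>w. gauss_kernel 1 (w::'a) * indicator ?B y \<partial>lborel)"
      by (rule integral_dominated_convergence[where w="gauss_kernel 1"])
         (auto intro!: AE_I2 tendsto_mult ind_lim that gk mult_left_le simp: abs_mult)
    then show ?thesis by (simp add: gk)
  qed
  have "(\<lambda>k. \<integral>y. (\<integral>w. gauss_kernel 1 w * indicator ?B (y + s k *\<^sub>R w) \<partial>lborel) \<partial>\<mu>) \<longlonglongrightarrow> (\<integral>y. indicator ?B y \<partial>\<mu>)"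
  proof (rule integral_dominated_convergence[where w="\<lambda>_. 1"])
    show "AE y in \<mu>. (\<lambda>k. \<integral>w. gauss_kernel 1 w * indicator ?B (y + s k *\<^sub>R w) \<partial>lborel) \<longlonglongrightarrow> indicator ?B y"
      using AE_not_in[OF fr] by eventually_elim (rule inner_lim)
    show "AE y in \<mu>. norm (\<integral>w. gauss_kernel 1 w * indicator ?B (y + s k *\<^sub>R w) \<partial>lborel) \<le> 1" for k
    proof (rule AE_I2)
      fix y
      have "(\<integral>w. gauss_kernel 1 w * indicator ?B (y + s k *\<^sub>R w) \<partial>lborel) \<le> (\<integral>w. gauss_kernel 1 (w::'a) \<partial>lborel)"
        by (intro integral_mono' gk) (auto simp: indicator_def)
      then show "norm (\<integral>w. gauss_kernel 1 w * indicator ?B (y + s k *\<^sub>R w) \<partial>lborel) \<le> 1"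
        using gk by (simp add: integral_nonneg_AE)
    qed
  qed measurable
  moreover have "(\<integral>y. indicator ?B y \<partial>\<mu>) = measure \<mu> ?B"
    by (subst Bochner_Integration.integral_indicator) (simp_all add: sets)
  ultimately have "(\<lambda>k. \<integral>x. indicator ?B x * q k x \<partial>lborel) \<longlonglongrightarrow> measure \<mu> ?B"
    unfolding q_def integral_smoothed_density_box[OF \<mu> sets s] by simp
  then show ?thesis using LIMSEQ_unique lim1 by blast
qed

text \<open>
  Boxes generate the Borel sets, but the inverse transform is not known to be nonnegative, so it
  does not directly define a measure. It is bounded, so adding a constant \<open>C\<close> to both functions
  turns the equality on boxes into an equality of two measures.
\<close>

theorem density_eq_inverse_fourier:
  fixes f :: "'a::euclidean_space \<Rightarrow> real"
  assumes \<mu>_def: "\<mu> = density lborel (\<lambda>x. ennreal (f x))" and \<mu>: "prob_space \<mu>"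
    and [measurable]: "f \<in> borel_measurable borel" and nonneg: "\<And>x. 0 \<le> f x"
    and int: "integrable lborel (charf \<mu>)"
  shows "AE x in lborel. f x = inverse_fourier (charf \<mu>) x"
proof -
  interpret prob_space \<mu> by fact
  have sets [measurable_cong]: "sets \<mu> = sets borel" by (simp add: \<mu>_def)
  note [measurable] = charf_measurable[OF \<mu> sets]
  define C where "C = (\<integral>t. norm (charf \<mu> t) \<partial>lborel) / (2 * pi) ^ DIM('a)"
  let ?q = "inverse_fourier (charf \<mu>)"
  have C: "0 \<le> ?q x + C" "\<bar>?q x\<bar> \<le> C" for x
    using abs_inverse_fourier_le[of "charf \<mu>" x] by (simp_all add: C_def)
  have C0: "0 \<le> C" using C(2)[of 0] by linarith
  have eq_box: "emeasure (density lborel (\<lambda>x. ennreal (f x + C))) (box l u) =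
     emeasure (density lborel (\<lambda>x. ennreal (?q x + C))) (box l u)"
    and fin_box: "emeasure (density lborel (\<lambda>x. ennreal (f x + C))) (box l u) < \<infinity>" for l u
  proof -
    let ?B = "box l u"
    have fr: "frontier ?B \<in> null_sets \<mu>"
    proof -
      have "negligible (frontier ?B)" by (rule negligible_convex_frontier) simp
      then have "frontier ?B \<in> null_sets lborel"
        by (simp add: negligible_iff_null_sets null_sets_completion_iff)
      then show ?thesis
        using AE_not_in[of "frontier ?B" lborel] unfolding \<mu>_def
        by (subst null_sets_density_iff) auto
    qed
    have int_C: "integrable lborel (\<lambda>x. indicator ?B x * C)"
      by (intro integrable_mult_left) (use emeasure_lborel_box_finite[of l u] in \<open>simp add: integrable_indicator_iff\<close>)
    have int_q: "integrable lborel (\<lambda>x. indicator ?B x * ?q x)"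
      by (rule Bochner_Integration.integrable_bound[OF int_C]) (use C C0 in \<open>auto simp: indicator_def\<close>)
    have "(\<integral>\<^sup>+x. ennreal (indicator ?B x * f x) \<partial>lborel) = emeasure \<mu> ?B"
      unfolding \<mu>_def by (subst emeasure_density) (auto intro!: nn_integral_cong simp: indicator_def)
    then have f_box: "(\<integral>\<^sup>+x. ennreal (indicator ?B x * f x) \<partial>lborel) = ennreal (measure \<mu> ?B)"
      by (simp add: emeasure_eq_measure)
    then have int_f: "integrable lborel (\<lambda>x. indicator ?B x * f x)"
      using nonneg by (intro integrableI_nonneg) auto
    have "ennreal (\<integral>x. indicator ?B x * f x \<partial>lborel) = ennreal (measure \<mu> ?B)"
      using f_box nonneg by (subst nn_integral_eq_integral[symmetric, OF int_f]) auto
    then have "(\<integral>x. indicator ?B x * f x \<partial>lborel) = measure \<mu> ?B"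
      using nonneg by (subst (asm) ennreal_inj) (auto intro!: integral_nonneg_AE)
    then have eq: "(\<integral>x. indicator ?B x * f x \<partial>lborel) = (\<integral>x. indicator ?B x * ?q x \<partial>lborel)"
      using measure_box_eq_inverse_fourier[OF \<mu> sets int fr] by simp
    have em: "emeasure (density lborel (\<lambda>x. ennreal (h x + C))) ?B =
       ennreal ((\<integral>x. indicator ?B x * h x \<partial>lborel) + (\<integral>x. indicator ?B x * C \<partial>lborel))"
      if [measurable]: "h \<in> borel_measurable borel" and "\<And>x. 0 \<le> h x + C" and i: "integrable lborel (\<lambda>x. indicator ?B x * h x)" for h
    proof -
      have "emeasure (density lborel (\<lambda>x. ennreal (h x + C))) ?B =
         (\<integral>\<^sup>+x. ennreal (indicator ?B x * h x + indicator ?B x * C) \<partial>lborel)"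
        by (subst emeasure_density) (auto intro!: nn_integral_cong simp: indicator_def)
      also have "\<dots> = ennreal (\<integral>x. indicator ?B x * h x + indicator ?B x * C \<partial>lborel)"
        using that by (intro nn_integral_eq_integral Bochner_Integration.integrable_add i int_C) (auto simp: indicator_def)
      finally show ?thesis using i int_C by (simp only: Bochner_Integration.integral_add)
    qed
    have 1: "emeasure (density lborel (\<lambda>x. ennreal (f x + C))) (box l u) = ennreal ((\<integral>x. indicator ?B x * f x \<partial>lborel) + (\<integral>x. indicator ?B x * C \<partial>lborel))"
      using nonneg C0 by (intro em int_f) auto
    have 2: "emeasure (density lborel (\<lambda>x. ennreal (?q x + C))) (box l u) = ennreal ((\<integral>x. indicator ?B x * ?q x \<partial>lborel) + (\<integral>x. indicator ?B x * C \<partial>lborel))"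
      using C by (intro em int_q) auto
    show "emeasure (density lborel (\<lambda>x. ennreal (f x + C))) ?B =
     emeasure (density lborel (\<lambda>x. ennreal (?q x + C))) ?B"
     "emeasure (density lborel (\<lambda>x. ennreal (f x + C))) (box l u) < \<infinity>"
      using 1 2 eq by simp_all
  qed
  have "density lborel (\<lambda>x. ennreal (f x + C)) = density lborel (\<lambda>x. ennreal (?q x + C))"
  proof (rule measure_eqI_generator_eq)
    let ?E = "range (\<lambda>(a, b). box a b::'a set)"
    show "Int_stable ?E"
      by (auto simp: Int_stable_def box_Int_box)
    show "?E \<subseteq> Pow UNIV" "sets (density lborel (\<lambda>x. ennreal (f x + C))) = sigma_sets UNIV ?E"
       "sets (density lborel (\<lambda>x. ennreal (?q x + C))) = sigma_sets UNIV ?E"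
      by (simp_all add: borel_eq_box)
    let ?A = "\<lambda>n::nat. box (- (real n *\<^sub>R One)) (real n *\<^sub>R One) :: 'a set"
    show "range ?A \<subseteq> ?E" "(\<Union>i. ?A i) = UNIV"
      unfolding UN_box_eq_UNIV by auto
    show "emeasure (density lborel (\<lambda>x. ennreal (f x + C))) (?A i) \<noteq> \<infinity>" for i
      using fin_box[of "- (real i *\<^sub>R One)" "real i *\<^sub>R One"] by simp
    show "emeasure (density lborel (\<lambda>x. ennreal (f x + C))) X = emeasure (density lborel (\<lambda>x. ennreal (?q x + C))) X"
      if "X \<in> ?E" for X using that eq_box by auto
  qed
  then have "AE x in lborel. ennreal (f x + C) = ennreal (?q x + C)"
    by (intro sigma_finite_measure.density_unique[OF sigma_finite_lborel]) auto
  then show ?thesis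
  proof eventually_elim
    case (elim x)
    have "f x + C = ?q x + C"
      using elim nonneg[of x] C(1)[of x] C0 by (subst (asm) ennreal_inj) auto
    then show ?case by simp
  qed
qed

text \<open>
  This is how convergence of characteristic functions in \<open>L\<^sup>1\<close> becomes uniform convergence of
  densities, which is the form of the local limit theorem used below.
\<close>

lemma density_diff_le_charf_diff:
  fixes f g :: "'a::euclidean_space \<Rightarrow> real"
  assumes "prob_space (density lborel f)" "prob_space (density lborel g)"
    and "f \<in> borel_measurable borel" "g \<in> borel_measurable borel" "\<And>x. 0 \<le> f x" "\<And>x. 0 \<le> g x"
    and int: "integrable lborel (charf (density lborel f))" "integrable lborel (charf (density lborel g))"
  shows "AE x in lborel. \<bar>f x - g x\<bar> \<le>
     (\<integral>t. norm (charf (density lborel f) t - charf (density lborel g) t) \<partial>lborel) / (2 * pi) ^ DIM('a)"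
proof -
  note f = density_eq_inverse_fourier[OF refl assms(1,3,5) int(1)]
  note g = density_eq_inverse_fourier[OF refl assms(2,4,6) int(2)]
  show ?thesis
    using f g
  proof eventually_elim
    case (elim x)
    then have "\<bar>f x - g x\<bar> = \<bar>inverse_fourier (\<lambda>t. charf (density lborel f) t - charf (density lborel g) t) x\<bar>"
      by (simp only: inverse_fourier_diff[OF int])
    also note abs_inverse_fourier_le
    finally show ?case .
  qed
qed

section \<open>Decay of the characteristic function of a bounded density\<close>

text \<open>
  The inequality half of Plancherel's theorem. With a Gaussian damping factor, the squared
  modulus integrates to the average of the smoothed density against the law itself; a density bounded
  by \<open>A\<close> stays bounded by \<open>A\<close> after smoothing, so the bound does not depend on the damping, which is then
  removed by Fatou's lemma.
\<close>

lemma charf_square_integrable: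
  fixes f :: "'a::euclidean_space \<Rightarrow> real"
  assumes \<mu>_def: "\<mu> = density lborel (\<lambda>x. ennreal (f x))" and \<mu>: "prob_space \<mu>"
    and [measurable]: "f \<in> borel_measurable borel" and nonneg: "\<And>x. 0 \<le> f x" and bound: "\<And>x. f x \<le> A"
  shows "integrable lborel (\<lambda>t. (norm (charf \<mu> t))\<^sup>2)"
proof -
  interpret \<mu>: prob_space \<mu> by fact
  have sets [measurable_cong]: "sets \<mu> = sets borel" by (simp add: \<mu>_def)
  note [measurable] = charf_measurable[OF \<mu> sets]
  interpret P: pair_sigma_finite lborel \<mu> ..
  let ?K = "\<lambda>\<sigma> t::'a. exp (- (\<sigma>\<^sup>2 * (norm t)\<^sup>2 / 2))"
  have int_K: "integrable lborel (?K \<sigma>)" if "0 < \<sigma>" for \<sigma>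
    using integrable_exp_norm_square[of "\<sigma>\<^sup>2 / 2"] that by simp
  have psi1: "norm (charf \<mu> t) \<le> 1" for t by (rule norm_charf_le_1[OF \<mu>])
  have int_KS: "integrable lborel (\<lambda>t. ?K \<sigma> t * (norm (charf \<mu> t))\<^sup>2)" if "0 < \<sigma>" for \<sigma>
    using psi1 by (intro Bochner_Integration.integrable_bound[OF int_K[OF that]])
       (auto simp: mult_left_le power_le_one)
  have smooth_le: "(\<integral>z. gauss_kernel \<sigma> (y - z) \<partial>\<mu>) \<le> A" if \<sigma>: "0 < \<sigma>" for \<sigma> y
  proof -
    have g: "integrable lborel (\<lambda>z. gauss_kernel \<sigma> (y - z))" "(\<integral>z. gauss_kernel \<sigma> (y - z) \<partial>lborel) = 1"
      using lborel_affine_substitution[of "gauss_kernel \<sigma> :: 'a \<Rightarrow> real" "-1" y] gauss_kernel_integral[OF \<sigma>, where 'a='a]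
      by simp_all
    have "(\<integral>z. gauss_kernel \<sigma> (y - z) \<partial>\<mu>) = (\<integral>z. f z * gauss_kernel \<sigma> (y - z) \<partial>lborel)"
      unfolding \<mu>_def using nonneg by (subst integral_density) auto
    also have "\<dots> \<le> (\<integral>z. A * gauss_kernel \<sigma> (y - z) \<partial>lborel)"
      using bound nonneg g order_trans[OF nonneg bound] by (intro integral_mono') (auto intro!: mult_right_mono)
    finally show ?thesis by (simp add: g)
  qed
  have main: "(\<integral>t. ?K \<sigma> t * (norm (charf \<mu> t))\<^sup>2 \<partial>lborel) \<le> (2 * pi) ^ DIM('a) * A" if \<sigma>: "0 < \<sigma>" for \<sigma>
  proof -
    let ?F = "\<lambda>t y. complex_of_real (?K \<sigma> t) * (iexp (- (t \<bullet> y)) * charf \<mu> t)"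
    have F_norm: "norm (?F t y) \<le> ?K \<sigma> t" for t y
      using psi1[of t] by (simp add: norm_mult mult_left_le)
    have int: "integrable (lborel \<Otimes>\<^sub>M \<mu>) (case_prod ?F)"
    proof (rule P.Fubini_integrable)
      show "case_prod ?F \<in> borel_measurable (lborel \<Otimes>\<^sub>M \<mu>)" by measurable
      show "integrable lborel (\<lambda>t. \<integral>y. norm (case_prod ?F (t, y)) \<partial>\<mu>)"
        by (rule Bochner_Integration.integrable_bound[OF int_K[OF \<sigma>]])
           (use psi1 in \<open>auto simp: norm_mult mult_left_le \<mu>.prob_space\<close>)
      show "AE t in lborel. integrable \<mu> (\<lambda>y. case_prod ?F (t, y))"
      proof (intro AE_I2)
        fix t
        show "integrable \<mu> (\<lambda>y. case_prod ?F (t, y))"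
          by (rule \<mu>.integrable_const_bound[where B="?K \<sigma> t"]) (use F_norm in auto)
      qed
    qed
    have cnj: "cnj (charf \<mu> t) = (CLINT y|\<mu>. iexp (- (t \<bullet> y)))" for t
    proof -
      have "(CLINT y|\<mu>. iexp (- (t \<bullet> y))) = (CLINT y|\<mu>. cnj (iexp (t \<bullet> y)))"
        by (intro Bochner_Integration.integral_cong refl) (simp add: complex_eq_iff Re_exp Im_exp)
      then show ?thesis by (simp add: charf_def)
    qed
    have inner: "(CLINT y|\<mu>. ?F t y) = of_real (?K \<sigma> t * (norm (charf \<mu> t))\<^sup>2)" for t
    proof -
      have "(CLINT y|\<mu>. ?F t y) = of_real (?K \<sigma> t) * ((CLINT y|\<mu>. iexp (- (t \<bullet> y))) * charf \<mu> t)"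
        by (simp only: integral_mult_right_zero integral_mult_left_zero)
      also have "\<dots> = of_real (?K \<sigma> t * (norm (charf \<mu> t))\<^sup>2)"
        by (simp only: cnj[symmetric] of_real_mult complex_norm_square mult.commute)
      finally show ?thesis .
    qed
    have "of_real (\<integral>t. ?K \<sigma> t * (norm (charf \<mu> t))\<^sup>2 \<partial>lborel) = (CLINT t|lborel. CLINT y|\<mu>. ?F t y)"
      by (simp only: inner integral_complex_of_real)
    also have "\<dots> = (CLINT y|\<mu>. CLINT t|lborel. ?F t y)"
      using P.Fubini_integral[OF int] by simp
    also have "\<dots> = of_real (\<integral>y. (2 * pi) ^ DIM('a) * (\<integral>z. gauss_kernel \<sigma> (y - z) \<partial>\<mu>) \<partial>\<mu>)"
      by (simp only: smoothed_density_eq_fourier[OF \<mu> sets \<sigma>] integral_complex_of_real)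
    finally have "(\<integral>t. ?K \<sigma> t * (norm (charf \<mu> t))\<^sup>2 \<partial>lborel) = (\<integral>y. (2 * pi) ^ DIM('a) * (\<integral>z. gauss_kernel \<sigma> (y - z) \<partial>\<mu>) \<partial>\<mu>)"
      by (simp only: of_real_eq_iff)
    also have "\<dots> \<le> (\<integral>y. (2 * pi) ^ DIM('a) * A \<partial>\<mu>)"
      using order_trans[OF nonneg bound]
      by (intro integral_mono' mult_left_mono smooth_le \<sigma>) auto
    finally show ?thesis by (simp add: \<mu>.prob_space)
  qed
  define s where "s k = 1 / Suc k" for k
  have s: "0 < s k" for k by (simp add: s_def)
  have s0: "s \<longlonglongrightarrow> 0" unfolding s_def using LIMSEQ_Suc[OF lim_1_over_n] by simp
  have "(\<integral>\<^sup>+t. ennreal ((norm (charf \<mu> t))\<^sup>2) \<partial>lborel) =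
      (\<integral>\<^sup>+t. liminf (\<lambda>k. ennreal (?K (s k) t * (norm (charf \<mu> t))\<^sup>2)) \<partial>lborel)"
  proof (intro nn_integral_cong)
    fix t :: 'a
    have "(\<lambda>k. ?K (s k) t * (norm (charf \<mu> t))\<^sup>2) \<longlonglongrightarrow> exp (- (0\<^sup>2 * (norm t)\<^sup>2 / 2)) * (norm (charf \<mu> t))\<^sup>2"
      by (intro tendsto_intros s0) auto
    then have "(\<lambda>k. ennreal (?K (s k) t * (norm (charf \<mu> t))\<^sup>2)) \<longlonglongrightarrow> ennreal ((norm (charf \<mu> t))\<^sup>2)"
      by (intro tendsto_ennrealI) simp
    then show "ennreal ((norm (charf \<mu> t))\<^sup>2) = liminf (\<lambda>k. ennreal (?K (s k) t * (norm (charf \<mu> t))\<^sup>2))"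
      using lim_imp_Liminf[OF trivial_limit_sequentially] by metis
  qed
  also have "\<dots> \<le> liminf (\<lambda>k. \<integral>\<^sup>+t. ennreal (?K (s k) t * (norm (charf \<mu> t))\<^sup>2) \<partial>lborel)"
    by (rule nn_integral_liminf) measurable
  also have "\<dots> \<le> ennreal ((2 * pi) ^ DIM('a) * A)"
  proof (intro Liminf_le always_eventually allI)
    fix k
    show "(\<integral>\<^sup>+t. ennreal (?K (s k) t * (norm (charf \<mu> t))\<^sup>2) \<partial>lborel) \<le> ennreal ((2 * pi) ^ DIM('a) * A)"
      using main[OF s[of k]] int_KS[OF s[of k]] by (subst nn_integral_eq_integral) (auto intro!: ennreal_leI)
  qed simp
  finally show ?thesis
    by (intro integrableI_nonneg) (auto simp: less_top[symmetric] top_unique)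
qed

text \<open>
  All balls of radius \<open>\<rho>\<close> have the same volume, and the integral of \<open>g\<close> far from the origin is
  small. The lemma serves twice: for the squared characteristic function, and for log-concave
  densities.
\<close>

lemma exists_small_value_in_far_balls:
  fixes g :: "'a::euclidean_space \<Rightarrow> real"
  assumes int: "integrable lborel g" and nonneg: "\<And>x. 0 \<le> g x" and "0 < \<epsilon>" "0 < \<rho>"
  shows "\<exists>R>0. \<forall>x. R \<le> norm x \<longrightarrow> (\<exists>y\<in>ball x \<rho>. g y < \<epsilon>)"
proof -
  have [measurable]: "g \<in> borel_measurable borel" using int by auto
  define V where "V = unit_ball_vol (real DIM('a)) * \<rho> ^ DIM('a)"
  have V: "0 < V" using \<open>0 < \<rho>\<close> by (simp add: V_def)
  let ?I = "\<lambda>n x. indicator {x. real n \<le> norm x} x * g x"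
  have "(\<lambda>n. \<integral>x. ?I n x \<partial>lborel) \<longlonglongrightarrow> (\<integral>x. 0 \<partial>(lborel :: 'a measure))"
  proof (rule integral_dominated_convergence[where w=g])
    show "AE x in lborel. (\<lambda>n. ?I n x) \<longlonglongrightarrow> 0"
    proof (rule AE_I2)
      fix x :: 'a
      have "eventually (\<lambda>n. ?I n x = 0) sequentially"
        using eventually_gt_at_top[of "nat \<lceil>norm x\<rceil>"]
        by eventually_elim (auto simp: indicator_def, linarith)
      then show "(\<lambda>n. ?I n x) \<longlonglongrightarrow> 0" by (rule tendsto_eventually)
    qed
  qed (use int nonneg in \<open>auto simp: indicator_def\<close>)
  then have "eventually (\<lambda>n. (\<integral>x. ?I n x \<partial>lborel) < \<epsilon> * V) sequentially"
    using V \<open>0 < \<epsilon>\<close> by (intro order_tendstoD) auto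
  then obtain n where n: "(\<integral>x. ?I n x \<partial>lborel) < \<epsilon> * V"
    by (meson eventually_sequentially order_refl)
  have "\<exists>y\<in>ball x \<rho>. g y < \<epsilon>" if x: "real n + \<rho> \<le> norm x" for x
  proof (rule ccontr)
    assume "\<not> (\<exists>y\<in>ball x \<rho>. g y < \<epsilon>)"
    then have ge: "y \<in> ball x \<rho> \<Longrightarrow> \<epsilon> \<le> g y" for y by force
    have far: "real n \<le> norm y" if "y \<in> ball x \<rho>" for y
      using that x norm_triangle_ineq2[of x "x - y"] by (simp add: dist_norm)
    have "\<epsilon> * V = (\<integral>y. \<epsilon> * indicator (ball x \<rho>) y \<partial>lborel)"
      using content_ball[of \<rho> x] \<open>0 < \<rho>\<close> by (simp add: V_def)
    also have "\<dots> \<le> (\<integral>y. ?I n y \<partial>lborel)"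
    proof (rule integral_mono_AE)
      show "integrable lborel (\<lambda>y. \<epsilon> * indicator (ball x \<rho>) y)"
        by (intro integrable_mult_right) (use emeasure_bounded_finite[of "ball x \<rho>"] in \<open>simp add: integrable_indicator_iff less_top[symmetric]\<close>)
      show "integrable lborel (?I n)"
        by (rule Bochner_Integration.integrable_bound[OF int]) (auto simp: indicator_def)
      show "AE y in lborel. \<epsilon> * indicator (ball x \<rho>) y \<le> ?I n y"
        using ge far nonneg by (intro AE_I2) (auto simp: indicator_def)
    qed
    finally show False using n by simp
  qed
  then show ?thesis using \<open>0 < \<rho>\<close> by (intro exI[of _ "real n + \<rho>"]) auto
qed

lemma charf_lipschitz:
  fixes \<mu> :: "'a::euclidean_space measure"
  assumes \<mu>: "prob_space \<mu>" and sets [measurable_cong]: "sets \<mu> = sets borel"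
    and int: "integrable \<mu> (\<lambda>x. norm x)"
  shows "norm (charf \<mu> s - charf \<mu> t) \<le> norm (s - t) * (\<integral>x. norm x \<partial>\<mu>)"
proof -
  interpret prob_space \<mu> by fact
  have i: "integrable \<mu> (\<lambda>x. iexp (s \<bullet> x))" for s
    by (rule integrable_const_bound[where B=1]) auto
  have le: "norm (iexp a - iexp b) \<le> \<bar>a - b\<bar>" for a b
  proof -
    have "iexp a - iexp b = iexp b * (iexp (a - b) - 1)"
      by (simp add: right_diff_distrib mult_exp_exp)
    moreover have "norm (iexp (a - b) - 1) \<le> \<bar>a - b\<bar>"
      using iexp_approx1[of "a - b" 0] by simp
    ultimately show ?thesis by (simp add: norm_mult)
  qed
  have "norm (charf \<mu> s - charf \<mu> t) = norm (CLINT x|\<mu>. iexp (s \<bullet> x) - iexp (t \<bullet> x))"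
    unfolding charf_def by (subst Bochner_Integration.integral_diff[OF i i]) simp
  also have "\<dots> \<le> (\<integral>x. norm (iexp (s \<bullet> x) - iexp (t \<bullet> x)) \<partial>\<mu>)"
    by (rule integral_norm_bound)
  also have "\<dots> \<le> (\<integral>x. norm (s - t) * norm x \<partial>\<mu>)"
  proof (rule integral_mono_AE)
    show "integrable \<mu> (\<lambda>x. norm (iexp (s \<bullet> x) - iexp (t \<bullet> x)))"
      by (intro integrable_norm Bochner_Integration.integrable_diff i)
    show "AE x in \<mu>. norm (iexp (s \<bullet> x) - iexp (t \<bullet> x)) \<le> norm (s - t) * norm x"
    proof (rule AE_I2)
      fix x
      have "\<bar>s \<bullet> x - t \<bullet> x\<bar> \<le> norm (s - t) * norm x"
        by (metis Cauchy_Schwarz_ineq2 inner_diff_left)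
      then show "norm (iexp (s \<bullet> x) - iexp (t \<bullet> x)) \<le> norm (s - t) * norm x"
        using le order_trans by blast
    qed
  qed (use int in auto)
  finally show ?thesis by simp
qed

text \<open>
  A Lipschitz function that is large at a point is large on a ball of fixed radius, which square
  integrability forbids far out.
\<close>

lemma charf_half_outside_ball:
  fixes f :: "'a::euclidean_space \<Rightarrow> real"
  assumes \<mu>_def: "\<mu> = density lborel (\<lambda>x. ennreal (f x))" and \<mu>: "prob_space \<mu>"
    and [measurable]: "f \<in> borel_measurable borel" and nonneg: "\<And>x. 0 \<le> f x" and bound: "\<And>x. f x \<le> A"
    and int: "integrable \<mu> (\<lambda>x. norm x)"
  shows "\<exists>R>0. \<forall>t. R \<le> norm t \<longrightarrow> norm (charf \<mu> t) \<le> 1 / 2"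
proof -
  have sets: "sets \<mu> = sets borel" by (simp add: \<mu>_def)
  define L where "L = (\<integral>x. norm x \<partial>\<mu>)"
  have L: "0 \<le> L" by (simp add: L_def)
  \<comment> \<open>Over this distance the characteristic function changes by at most \<open>1 / 4\<close>; the summand \<open>1\<close> avoids division by zero.\<close>
  define \<rho> where "\<rho> = 1 / (4 * (L + 1))"
  have \<rho>: "0 < \<rho>" using L by (simp add: \<rho>_def)
  obtain R where R: "0 < R" "\<And>t. R \<le> norm t \<Longrightarrow> \<exists>u\<in>ball t \<rho>. (norm (charf \<mu> u))\<^sup>2 < 1 / 16"
    using exists_small_value_in_far_balls[OF charf_square_integrable[OF \<mu>_def \<mu> assms(3) nonneg bound], of "1/16" \<rho>] \<rho>
    by auto
  have "norm (charf \<mu> t) \<le> 1 / 2" if t: "R \<le> norm t" for t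
  proof -
    obtain u where u: "u \<in> ball t \<rho>" "(norm (charf \<mu> u))\<^sup>2 < 1 / 16" using R(2)[OF t] by auto
    have "(norm (charf \<mu> u))\<^sup>2 < (1 / 4)\<^sup>2" using u(2) by (simp add: power2_eq_square)
    then have 1: "norm (charf \<mu> u) < 1 / 4" by (rule power_less_imp_less_base) simp
    have "norm (charf \<mu> t - charf \<mu> u) \<le> norm (t - u) * L"
      unfolding L_def by (rule charf_lipschitz[OF \<mu> sets int])
    also have "\<dots> \<le> \<rho> * (L + 1)" using u(1) L \<rho> by (intro mult_mono) (auto simp: dist_norm)
    also have "\<dots> = 1 / 4" using L by (simp add: \<rho>_def)
    finally show ?thesis using 1 norm_triangle_ineq2[of "charf \<mu> t" "charf \<mu> u"] by linarith
  qed
  with R(1) show ?thesis by blast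
qed

text \<open>
  Rotate so that the characteristic function at \<open>u\<close> is real, and integrate the inequality
  \<open>1 - cos (2 \<theta>) \<le> 4 * (1 - cos \<theta>)\<close>. Repeated doubling carries smallness of the modulus at a distant
  point back towards the origin.
\<close>

lemma charf_doubling:
  fixes \<mu> :: "'a::euclidean_space measure"
  assumes \<mu>: "prob_space \<mu>" and sets [measurable_cong]: "sets \<mu> = sets borel"
  shows "1 - norm (charf \<mu> (2 *\<^sub>R u)) \<le> 4 * (1 - norm (charf \<mu> u))"
proof -
  interpret prob_space \<mu> by fact
  have i: "integrable \<mu> (\<lambda>x. iexp (s \<bullet> x))" for s
    by (rule integrable_const_bound[where B=1]) auto
  define \<alpha> where "\<alpha> = Arg (charf \<mu> u)"
  have cos_eq: "(\<integral>x. cos (s \<bullet> x - a) \<partial>\<mu>) = Re (iexp (- a) * charf \<mu> s)" for s a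
  proof -
    have "(\<integral>x. cos (s \<bullet> x - a) \<partial>\<mu>) = (\<integral>x. Re (iexp (- a) * iexp (s \<bullet> x)) \<partial>\<mu>)"
      by (simp add: Re_exp exp_add[symmetric])
    also have "\<dots> = Re (CLINT x|\<mu>. iexp (- a) * iexp (s \<bullet> x))"
      by (rule integral_Re) (intro integrable_mult_right i)
    finally show ?thesis by (simp add: charf_def)
  qed
  have "iexp (- \<alpha>) * charf \<mu> u = norm (charf \<mu> u)"
  proof -
    have "charf \<mu> u = norm (charf \<mu> u) * iexp \<alpha>"
      using Arg_eq[of "charf \<mu> u"] norm_charf_le_1[OF \<mu>] unfolding \<alpha>_def
      by (cases "charf \<mu> u = 0") auto
    then have "iexp (- \<alpha>) * charf \<mu> u = norm (charf \<mu> u) * (iexp (- \<alpha>) * iexp \<alpha>)"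
      by (metis mult.left_commute)
    then show ?thesis by (simp add: exp_add[symmetric])
  qed
  then have 1: "(\<integral>x. cos (u \<bullet> x - \<alpha>) \<partial>\<mu>) = norm (charf \<mu> u)"
    by (simp only: cos_eq Re_complex_of_real)
  have ic: "integrable \<mu> (\<lambda>x. cos (s \<bullet> x - a))" for s a
    by (rule integrable_const_bound[where B=1]) auto
  have "1 - norm (charf \<mu> (2 *\<^sub>R u)) \<le> 1 - Re (iexp (- (2 * \<alpha>)) * charf \<mu> (2 *\<^sub>R u))"
    using complex_Re_le_cmod[of "iexp (- (2 * \<alpha>)) * charf \<mu> (2 *\<^sub>R u)"] by (simp add: norm_mult)
  also have "\<dots> = 1 - (\<integral>x. cos ((2 *\<^sub>R u) \<bullet> x - 2 * \<alpha>) \<partial>\<mu>)"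
    by (simp only: cos_eq)
  also have "\<dots> = (\<integral>x. 1 - cos ((2 *\<^sub>R u) \<bullet> x - 2 * \<alpha>) \<partial>\<mu>)"
    by (subst Bochner_Integration.integral_diff[OF _ ic]) (auto simp: prob_space)
  also have "\<dots> \<le> (\<integral>x. 4 * (1 - cos (u \<bullet> x - \<alpha>)) \<partial>\<mu>)"
  proof (rule integral_mono)
    fix x
    have "cos ((2 *\<^sub>R u) \<bullet> x - 2 * \<alpha>) = 2 * (cos (u \<bullet> x - \<alpha>))\<^sup>2 - 1"
      using cos_double_cos[of "u \<bullet> x - \<alpha>"] by (simp add: right_diff_distrib)
    moreover have "0 \<le> (1 - cos (u \<bullet> x - \<alpha>))\<^sup>2" by simp
    ultimately show "1 - cos ((2 *\<^sub>R u) \<bullet> x - 2 * \<alpha>) \<le> 4 * (1 - cos (u \<bullet> x - \<alpha>))"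
      by (simp add: power2_eq_square algebra_simps)
  qed (intro Bochner_Integration.integrable_diff integrable_mult_right ic integrable_const)+
  also have "\<dots> = 4 * (1 - norm (charf \<mu> u))"
    by (simp only: integral_mult_right_zero Bochner_Integration.integral_diff[OF integrable_const ic] 1)
       (simp add: prob_space)
  finally show ?thesis .
qed

text \<open>
  Double \<open>t\<close> until its norm lies between \<open>R\<close> and \<open>2 * R\<close>; each doubling costs a factor \<open>4\<close>, so the gap
  \<open>1 / 2\<close> available there leaves a gap proportional to the square of the norm at \<open>t\<close>. This bounds the
  modulus away from \<open>1\<close> off the origin and gives its quadratic behaviour at the origin in one step.
\<close>

lemma gaussian_bound_of_doubling:
  fixes \<psi> :: "'a::real_normed_vector \<Rightarrow> complex"
  assumes le1: "\<And>t. norm (\<psi> t) \<le> 1"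
    and doubling: "\<And>u. 1 - norm (\<psi> (2 *\<^sub>R u)) \<le> 4 * (1 - norm (\<psi> u))"
    and R: "0 < R" "\<And>t. R \<le> norm t \<Longrightarrow> norm (\<psi> t) \<le> 1 / 2"
    and t: "norm t \<le> R"
  shows "norm (\<psi> t) \<le> exp (- (1 / (8 * R\<^sup>2)) * (norm t)\<^sup>2)"
proof (cases "t = 0")
  case True then show ?thesis using le1 by simp
next
  case False
  have iter: "1 - norm (\<psi> (2 ^ k *\<^sub>R t)) \<le> 4 ^ k * (1 - norm (\<psi> t))" for k
  proof (induction k)
    case (Suc k)
    have "1 - norm (\<psi> (2 ^ Suc k *\<^sub>R t)) \<le> 4 * (1 - norm (\<psi> (2 ^ k *\<^sub>R t)))"
      using doubling[of "2 ^ k *\<^sub>R t"] by simp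
    also have "\<dots> \<le> 4 * (4 ^ k * (1 - norm (\<psi> t)))" using Suc by simp
    finally show ?case by simp
  qed simp
  have "\<exists>k::nat. R \<le> 2 ^ k * norm t"
    using real_arch_pow[of 2 "R / norm t"] False by (auto simp: field_simps intro: less_imp_le)
  then obtain k where k: "R \<le> 2 ^ k * norm t" and least: "\<And>j. j < k \<Longrightarrow> \<not> R \<le> 2 ^ j * norm t"
    using exists_least_iff[of "\<lambda>k. R \<le> 2 ^ k * norm t"] by auto
  have le: "2 ^ k * norm t \<le> 2 * R"
  proof (cases k)
    case 0 then show ?thesis using t R by simp
  next
    case (Suc j) then show ?thesis using least[of j] by simp
  qed
  have "norm (\<psi> (2 ^ k *\<^sub>R t)) \<le> 1 / 2" using R(2)[of "2 ^ k *\<^sub>R t"] k by simp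
  then have 1: "1 / 2 \<le> 4 ^ k * (1 - norm (\<psi> t))" using iter[of k] by linarith
  have "(2 ^ k * norm t)\<^sup>2 \<le> (2 * R)\<^sup>2" using le by (intro power_mono) auto
  then have "4 ^ k * (norm t)\<^sup>2 \<le> 4 * R\<^sup>2"
    by (simp add: power_mult_distrib power_mult[symmetric] mult.commute[of k] power_mult)
  then have "(1 - norm (\<psi> t)) * (4 ^ k * (norm t)\<^sup>2) \<le> (1 - norm (\<psi> t)) * (4 * R\<^sup>2)"
    using le1[of t] by (intro mult_left_mono) auto
  moreover have "1 / 2 * (norm t)\<^sup>2 \<le> 4 ^ k * (1 - norm (\<psi> t)) * (norm t)\<^sup>2"
    using 1 by (intro mult_right_mono) auto
  ultimately have "1 / 2 * (norm t)\<^sup>2 \<le> (1 - norm (\<psi> t)) * (4 * R\<^sup>2)"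
    by (simp add: mult_ac)
  then have "1 / (8 * R\<^sup>2) * (norm t)\<^sup>2 \<le> 1 - norm (\<psi> t)"
    using R(1) by (simp add: field_simps)
  then show ?thesis using exp_ge_add_one_self[of "- (1 / (8 * R\<^sup>2)) * (norm t)\<^sup>2"] by linarith
qed

lemma power_times_geometric_tendsto_0:
  "(\<lambda>n. real n ^ d * (1 / 2) ^ n) \<longlonglongrightarrow> 0"
proof -
  have "((\<lambda>x. x ^ d / exp x) \<longlongrightarrow> (0::real)) at_top" by (rule tendsto_power_div_exp_0)
  moreover have "filterlim (\<lambda>n. ln 2 * real n) at_top sequentially"
    by (rule filterlim_tendsto_pos_mult_at_top[OF tendsto_const _ filterlim_real_sequentially]) simp
  ultimately have "(\<lambda>n. (ln 2 * real n) ^ d / exp (ln 2 * real n)) \<longlonglongrightarrow> 0"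
    by (rule filterlim_compose)
  then have "(\<lambda>n. (1 / ln 2) ^ d * ((ln 2 * real n) ^ d / exp (ln 2 * real n))) \<longlonglongrightarrow> (1 / ln 2) ^ d * 0"
    by (intro tendsto_mult tendsto_const)
  moreover have "(1 / ln 2) ^ d * ((ln 2 * real n) ^ d / exp (ln 2 * real n)) = real n ^ d * (1 / 2) ^ n" for n
  proof -
    have "exp (ln 2 * real n) = (2::real) ^ n" by (simp add: exp_of_nat2_mult)
    then show ?thesis by (simp add: power_mult_distrib power_one_over field_simps)
  qed
  ultimately show ?thesis by simp
qed

section \<open>Convergence to the Gaussian characteristic function\<close>

text \<open>
  Split at \<open>norm t = R * sqrt n\<close>. Inside, the power is dominated by a fixed Gaussian and
  dominated convergence applies. Outside, \<open>n - 2\<close> factors are at most \<open>1 / 2\<close>, while two factors are kept to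
  make the integral finite; rescaling them costs only a power of \<open>n\<close>.
\<close>

lemma charf_power_L1_limit:
  fixes \<psi> G :: "'a::euclidean_space \<Rightarrow> complex"
  assumes [measurable]: "\<psi> \<in> borel_measurable borel"
    and int: "integrable lborel (\<lambda>t. (norm (\<psi> t))\<^sup>2)" and le1: "\<And>t. norm (\<psi> t) \<le> 1"
    and c: "0 < c" and R: "0 < R"
    and near: "\<And>t. norm t \<le> R \<Longrightarrow> norm (\<psi> t) \<le> exp (- c * (norm t)\<^sup>2)"
    and far: "\<And>t. R \<le> norm t \<Longrightarrow> norm (\<psi> t) \<le> 1 / 2"
    and lim: "\<And>t. (\<lambda>n. \<psi> ((1 / sqrt (real n)) *\<^sub>R t) ^ n) \<longlonglongrightarrow> G t"
  shows "\<And>n. 2 \<le> n \<Longrightarrow> integrable lborel (\<lambda>t. \<psi> ((1 / sqrt (real n)) *\<^sub>R t) ^ n)"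
    and "integrable lborel G"
    and "(\<lambda>n. \<integral>t. norm (\<psi> ((1 / sqrt (real n)) *\<^sub>R t) ^ n - G t) \<partial>lborel) \<longlonglongrightarrow> 0"
proof -
  define h where "h n t = \<psi> ((1 / sqrt (real n)) *\<^sub>R t) ^ n" for n t
  define A where "A n t = indicator {t. norm t \<le> R * sqrt (real n)} t *\<^sub>R h n t" for n t
  have [measurable]: "h n \<in> borel_measurable borel" for n unfolding h_def by measurable
  have [measurable]: "A n \<in> borel_measurable borel" for n unfolding A_def by measurable
  have G_meas [measurable]: "G \<in> borel_measurable borel"
    by (rule borel_measurable_LIMSEQ_metric[of h]) (use lim in \<open>auto simp: h_def\<close>)
  define I where "I = (\<integral>t. (norm (\<psi> t))\<^sup>2 \<partial>lborel)"
  have scaled: "integrable lborel (\<lambda>t. (norm (\<psi> ((1 / sqrt (real n)) *\<^sub>R t)))\<^sup>2)"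
      "(\<integral>t. (norm (\<psi> ((1 / sqrt (real n)) *\<^sub>R t)))\<^sup>2 \<partial>lborel) = sqrt (real n) ^ DIM('a) * I"
    if "0 < n" for n
    using lborel_affine_substitution[of "\<lambda>t. (norm (\<psi> t))\<^sup>2" "1 / sqrt (real n)" 0] int that
    by (simp_all add: I_def power_divide field_simps)
  show int_h: "integrable lborel (\<lambda>t. \<psi> ((1 / sqrt (real n)) *\<^sub>R t) ^ n)" if "2 \<le> n" for n
  proof (rule Bochner_Integration.integrable_bound[OF scaled(1)[of n]])
    show "AE t in lborel. norm (\<psi> ((1 / sqrt (real n)) *\<^sub>R t) ^ n) \<le> norm ((norm (\<psi> ((1 / sqrt (real n)) *\<^sub>R t)))\<^sup>2)"
      using that le1 by (intro AE_I2) (simp add: norm_power power_decreasing)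
  qed (use that in auto)
  \<comment> \<open>Here \<open>A n\<close> is the part of the power inside the ball of radius \<open>R * sqrt n\<close>.\<close>
  have A_bound: "norm (A n t) \<le> exp (- c * (norm t)\<^sup>2)" if "0 < n" for n t
  proof (cases "norm t \<le> R * sqrt (real n)")
    case True
    have "norm (\<psi> ((1 / sqrt (real n)) *\<^sub>R t)) \<le> exp (- c * (norm t)\<^sup>2 / real n)"
      using near[of "(1 / sqrt (real n)) *\<^sub>R t"] True that by (simp add: field_simps)
    then have "norm (\<psi> ((1 / sqrt (real n)) *\<^sub>R t)) ^ n \<le> exp (- c * (norm t)\<^sup>2 / real n) ^ n"
      by (intro power_mono) auto
    also have "\<dots> = exp (- c * (norm t)\<^sup>2)"
      using that by (simp add: exp_of_nat_mult[symmetric])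
    finally show ?thesis using True by (simp add: A_def h_def norm_power)
  qed (simp add: A_def)
  have A_eq: "eventually (\<lambda>n. A n t = h n t) sequentially" for t
  proof -
    have "eventually (\<lambda>n. norm t / R \<le> sqrt (real n)) sequentially"
      by (rule filterlim_at_top[THEN iffD1, rule_format, OF filterlim_compose[OF sqrt_at_top filterlim_real_sequentially]])
    then show ?thesis
      by eventually_elim (use R in \<open>auto simp: A_def field_simps\<close>)
  qed
  have A_lim: "(\<lambda>n. A n t) \<longlonglongrightarrow> G t" for t
    using lim[of t] A_eq[of t] by (subst tendsto_cong[OF A_eq]) (simp add: h_def)
  have G_bound: "norm (G t) \<le> exp (- c * (norm t)\<^sup>2)" for t
    by (rule tendsto_upperbound[OF tendsto_norm[OF A_lim]])
       (auto intro!: eventually_mono[OF eventually_gt_at_top[of 0]] simp: A_bound[simplified])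
  have int_exp: "integrable lborel (\<lambda>t::'a. exp (- c * (norm t)\<^sup>2))"
    by (rule integrable_exp_norm_square[OF c])
  show int_G: "integrable lborel G"
    by (rule Bochner_Integration.integrable_bound[OF int_exp]) (use G_bound in auto)
  have int_A: "integrable lborel (A n)" if "0 < n" for n
    by (rule Bochner_Integration.integrable_bound[OF int_exp]) (use A_bound[OF that] in auto)
  have lim1: "(\<lambda>n. \<integral>t. norm (A (Suc n) t - G t) \<partial>lborel) \<longlonglongrightarrow> (\<integral>t. 0 \<partial>(lborel :: 'a measure))"
  proof (rule integral_dominated_convergence[where w="\<lambda>t. 2 * exp (- c * (norm t)\<^sup>2)"])
    show "AE t in lborel. (\<lambda>n. norm (A (Suc n) t - G t)) \<longlonglongrightarrow> 0"
      by (intro AE_I2 tendsto_norm_zero LIM_zero LIMSEQ_Suc A_lim)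
    show "AE t in lborel. norm (norm (A (Suc n) t - G t)) \<le> 2 * exp (- c * (norm t)\<^sup>2)" for n
    proof (rule AE_I2)
      fix t
      show "norm (norm (A (Suc n) t - G t)) \<le> 2 * exp (- c * (norm t)\<^sup>2)"
        using A_bound[of "Suc n" t] G_bound[of t] norm_triangle_ineq4[of "A (Suc n) t" "G t"] by simp
    qed
  qed (use int_exp in auto)
  have diff: "(\<integral>t. norm (h n t - A n t) \<partial>lborel) \<le> 4 * (real n ^ DIM('a) * (1 / 2) ^ n) * I"
    and int_diff: "integrable lborel (\<lambda>t. norm (h n t - A n t))" if n: "2 \<le> n" for n
  proof -
    have le: "norm (h n t - A n t) \<le> (1 / 2) ^ (n - 2) * (norm (\<psi> ((1 / sqrt (real n)) *\<^sub>R t)))\<^sup>2" for t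
    proof (cases "norm t \<le> R * sqrt (real n)")
      case False
      then have "norm (\<psi> ((1 / sqrt (real n)) *\<^sub>R t)) \<le> 1 / 2"
        using far[of "(1 / sqrt (real n)) *\<^sub>R t"] n by (simp add: field_simps)
      then have "norm (\<psi> ((1 / sqrt (real n)) *\<^sub>R t)) ^ (n - 2) \<le> (1 / 2) ^ (n - 2)"
        by (intro power_mono) auto
      then have "norm (\<psi> ((1 / sqrt (real n)) *\<^sub>R t)) ^ (n - 2) * (norm (\<psi> ((1 / sqrt (real n)) *\<^sub>R t)))\<^sup>2 \<le>
        (1 / 2) ^ (n - 2) * (norm (\<psi> ((1 / sqrt (real n)) *\<^sub>R t)))\<^sup>2"
        by (rule mult_right_mono) simp
      moreover have "norm (h n t) = norm (\<psi> ((1 / sqrt (real n)) *\<^sub>R t)) ^ (n - 2) * (norm (\<psi> ((1 / sqrt (real n)) *\<^sub>R t)))\<^sup>2"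
        unfolding h_def norm_power power_add[symmetric] le_add_diff_inverse2[OF n] ..
      ultimately show ?thesis using False by (simp add: A_def)
    qed (simp add: A_def)
    have i: "integrable lborel (\<lambda>t. (1 / 2) ^ (n - 2) * (norm (\<psi> ((1 / sqrt (real n)) *\<^sub>R t)))\<^sup>2)"
      using scaled(1)[of n] n by (intro integrable_mult_right) auto
    show "integrable lborel (\<lambda>t. norm (h n t - A n t))"
      by (rule Bochner_Integration.integrable_bound[OF i]) (use le in auto)
    have "(\<integral>t. norm (h n t - A n t) \<partial>lborel) \<le> (\<integral>t. (1 / 2) ^ (n - 2) * (norm (\<psi> ((1 / sqrt (real n)) *\<^sub>R t)))\<^sup>2 \<partial>lborel)"
      by (intro integral_mono' i le) auto
    also have "\<dots> = (1 / 2) ^ (n - 2) * (sqrt (real n) ^ DIM('a) * I)"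
      using scaled(2)[of n] n by (simp only: integral_mult_right_zero)
    also have "\<dots> \<le> (1 / 2) ^ (n - 2) * (real n ^ DIM('a) * I)"
    proof (intro mult_left_mono mult_right_mono power_mono)
      have "sqrt (real n) \<le> sqrt ((real n)\<^sup>2)"
        using n by (intro real_sqrt_le_mono) (simp add: power2_eq_square)
      then show "sqrt (real n) \<le> real n" by simp
    qed (auto simp: I_def)
    also have "(1 / 2 :: real) ^ (n - 2) = 4 * (1 / 2) ^ n"
    proof -
      obtain m where "n = 2 + m" using n le_Suc_ex by blast
      then show ?thesis by (simp add: power_add)
    qed
    finally show "(\<integral>t. norm (h n t - A n t) \<partial>lborel) \<le> 4 * (real n ^ DIM('a) * (1 / 2) ^ n) * I"
      by (simp add: mult_ac)
  qed
  have upper: "(\<integral>t. norm (h n t - G t) \<partial>lborel) \<le>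
     4 * (real n ^ DIM('a) * (1 / 2) ^ n) * I + (\<integral>t. norm (A n t - G t) \<partial>lborel)" if n: "2 \<le> n" for n
  proof -
    have iA: "integrable lborel (\<lambda>t. norm (A n t - G t))"
      using int_A[of n] int_G n by auto
    have "(\<integral>t. norm (h n t - G t) \<partial>lborel) \<le> (\<integral>t. norm (h n t - A n t) + norm (A n t - G t) \<partial>lborel)"
    proof (intro integral_mono' Bochner_Integration.integrable_add int_diff iA n)
      fix t show "norm (h n t - G t) \<le> norm (h n t - A n t) + norm (A n t - G t)"
        using norm_triangle_ineq[of "h n t - A n t" "A n t - G t"] by simp
    qed auto
    also have "\<dots> = (\<integral>t. norm (h n t - A n t) \<partial>lborel) + (\<integral>t. norm (A n t - G t) \<partial>lborel)"
      by (rule Bochner_Integration.integral_add[OF int_diff[OF n] iA])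
    finally show ?thesis using diff[OF n] by linarith
  qed
  have lim1': "(\<lambda>n. \<integral>t. norm (A n t - G t) \<partial>lborel) \<longlonglongrightarrow> 0"
    using lim1 by (subst filterlim_sequentially_Suc[symmetric]) simp
  have "(\<lambda>n. \<integral>t. norm (h n t - G t) \<partial>lborel) \<longlonglongrightarrow> 0"
  proof (rule tendsto_sandwich[OF _ _ tendsto_const])
    show "(\<lambda>n. 4 * (real n ^ DIM('a) * (1 / 2) ^ n) * I + (\<integral>t. norm (A n t - G t) \<partial>lborel)) \<longlonglongrightarrow> 0"
      using tendsto_add[OF tendsto_mult[OF tendsto_mult[OF tendsto_const[of 4] power_times_geometric_tendsto_0[of "DIM('a)"]] tendsto_const[of I]] lim1']
      by simp
  qed (use upper in \<open>auto intro!: eventually_mono[OF eventually_ge_at_top[of 2]]\<close>)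
  then show "(\<lambda>n. \<integral>t. norm (\<psi> ((1 / sqrt (real n)) *\<^sub>R t) ^ n - G t) \<partial>lborel) \<longlonglongrightarrow> 0"
    by (simp add: h_def)
qed

text \<open>
  The classical expansion of the characteristic function to second order, applied to the
  one-dimensional law of the inner product with \<open>t\<close>; a third moment controls the remainder.
\<close>

lemma charf_power_tendsto:
  fixes \<mu> :: "'a::euclidean_space measure"
  assumes \<mu>: "prob_space \<mu>" and sets [measurable_cong]: "sets \<mu> = sets borel"
    and int3: "integrable \<mu> (\<lambda>x. norm x ^ 3)" and mean: "(\<integral>x. t \<bullet> x \<partial>\<mu>) = 0"
  shows "(\<lambda>n. charf \<mu> ((1 / sqrt (real n)) *\<^sub>R t) ^ n) \<longlonglongrightarrow> exp (- of_real (\<integral>x. (t \<bullet> x)\<^sup>2 \<partial>\<mu>) / 2)"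
proof -
  interpret prob_space \<mu> by fact
  define V where "V = (\<integral>x. (t \<bullet> x)\<^sup>2 \<partial>\<mu>)"
  define K where "K = (\<integral>x. \<bar>t \<bullet> x\<bar> ^ 3 \<partial>\<mu>)"
  have i3: "integrable \<mu> (\<lambda>x. \<bar>t \<bullet> x\<bar> ^ 3)"
  proof (rule Bochner_Integration.integrable_bound)
    show "integrable \<mu> (\<lambda>x. norm t ^ 3 * norm x ^ 3)" using int3 by simp
    show "AE x in \<mu>. norm (\<bar>t \<bullet> x\<bar> ^ 3) \<le> norm (norm t ^ 3 * norm x ^ 3)"
      by (intro AE_I2) (simp add: power_mult_distrib[symmetric] power_mono Cauchy_Schwarz_ineq2)
  qed simp
  have cube: "1 \<le> a \<Longrightarrow> a \<le> a ^ 3" "1 \<le> a \<Longrightarrow> a\<^sup>2 \<le> a ^ 3" for a :: real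
    using power_increasing[of 1 3 a] power_increasing[of 2 3 a] by auto
  have small: "0 \<le> a \<Longrightarrow> a \<le> 1 \<Longrightarrow> a\<^sup>2 \<le> 1" for a :: real
    by (simp add: power_le_one)
  have i1: "integrable \<mu> (\<lambda>x. t \<bullet> x)" and i2: "integrable \<mu> (\<lambda>x. (t \<bullet> x)\<^sup>2)"
  proof -
    have b: "\<bar>t \<bullet> x\<bar> \<le> 1 + \<bar>t \<bullet> x\<bar> ^ 3" "\<bar>t \<bullet> x\<bar>\<^sup>2 \<le> 1 + \<bar>t \<bullet> x\<bar> ^ 3" for x
      using cube[of "\<bar>t \<bullet> x\<bar>"] small[of "\<bar>t \<bullet> x\<bar>"] zero_le_power[of "\<bar>t \<bullet> x\<bar>" 3]
      by (cases "1 \<le> \<bar>t \<bullet> x\<bar>"; linarith)+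
    have i: "integrable \<mu> (\<lambda>x. 1 + \<bar>t \<bullet> x\<bar> ^ 3)" using i3 by simp
    show "integrable \<mu> (\<lambda>x. t \<bullet> x)"
      by (rule Bochner_Integration.integrable_bound[OF i]) (use b in auto)
    show "integrable \<mu> (\<lambda>x. (t \<bullet> x)\<^sup>2)"
      by (rule Bochner_Integration.integrable_bound[OF i]) (use b in auto)
  qed
  have char_eq: "char (distr \<mu> borel (\<lambda>x. t \<bullet> x)) s = charf \<mu> (s *\<^sub>R t)" for s
    by (simp add: char_def charf_def integral_distr)
  have approx: "norm (charf \<mu> (s *\<^sub>R t) - (1 - s\<^sup>2 * V / 2)) \<le> \<bar>s\<bar> ^ 3 * K / 6" for s
  proof -
    have "norm (charf \<mu> (s *\<^sub>R t) - (1 - s\<^sup>2 * V / 2)) \<le>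
        s\<^sup>2 / 6 * (\<integral>x. min (6 * (t \<bullet> x)\<^sup>2) (\<bar>s\<bar> * \<bar>t \<bullet> x\<bar> ^ 3) \<partial>\<mu>)"
      unfolding char_eq[symmetric]
      by (rule char_approx3') (use i1 i2 mean in \<open>auto simp: V_def\<close>)
    also have "\<dots> \<le> s\<^sup>2 / 6 * (\<integral>x. \<bar>s\<bar> * \<bar>t \<bullet> x\<bar> ^ 3 \<partial>\<mu>)"
      using i3 by (intro mult_left_mono integral_mono') auto
    also have "\<dots> = \<bar>s\<bar> ^ 3 * K / 6"
      by (simp add: K_def power2_eq_square power3_eq_cube)
    finally show ?thesis .
  qed
  define w where "w n = complex_of_real (1 + (- V / 2) / real n)" for n
  have "(\<lambda>n. complex_of_real ((1 + (- V / 2) / real n) ^ n)) \<longlonglongrightarrow> of_real (exp (- V / 2))"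
    by (intro tendsto_of_real tendsto_exp_limit_sequentially)
  then have w_lim: "(\<lambda>n. w n ^ n) \<longlonglongrightarrow> exp (complex_of_real (- V / 2))"
    by (simp only: w_def of_real_power exp_of_real)
  have V0: "0 \<le> V" by (simp add: V_def)
  have w_le: "norm (w n) \<le> 1" if n: "nat \<lceil>V\<rceil> < n" for n
  proof -
    have "V < real n" using n by linarith
    then have "\<bar>1 - V / (2 * real n)\<bar> \<le> 1" using V0 by (simp add: abs_le_iff field_simps)
    moreover have "w n = complex_of_real (1 - V / (2 * real n))"
      by (simp add: w_def)
    ultimately show ?thesis by (simp only: norm_of_real)
  qed
  have step: "norm (charf \<mu> ((1 / sqrt (real n)) *\<^sub>R t) ^ n - w n ^ n) \<le> K / 6 * (1 / sqrt (real n))"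
    if n: "nat \<lceil>V\<rceil> < n" for n
  proof -
    have n0: "0 < n" using n by simp
    have "norm (charf \<mu> ((1 / sqrt (real n)) *\<^sub>R t) ^ n - w n ^ n) \<le>
        real n * norm (charf \<mu> ((1 / sqrt (real n)) *\<^sub>R t) - w n)"
      by (intro norm_power_diff norm_charf_le_1[OF \<mu>] w_le n)
    also have "\<dots> \<le> real n * (\<bar>1 / sqrt (real n)\<bar> ^ 3 * K / 6)"
    proof (rule mult_left_mono)
      have "w n = complex_of_real (1 - (1 / sqrt (real n))\<^sup>2 * V / 2)"
        using n0 by (simp add: w_def power_divide field_simps)
      then show "norm (charf \<mu> ((1 / sqrt (real n)) *\<^sub>R t) - w n) \<le> \<bar>1 / sqrt (real n)\<bar> ^ 3 * K / 6"
        using approx[of "1 / sqrt (real n)"] by (simp only:)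
    qed simp
    also have "\<dots> = K / 6 * (1 / sqrt (real n))"
      using n0 by (simp add: power3_eq_cube field_simps)
    finally show ?thesis .
  qed
  have "(\<lambda>n. charf \<mu> ((1 / sqrt (real n)) *\<^sub>R t) ^ n - w n ^ n) \<longlonglongrightarrow> 0"
  proof (rule tendsto_norm_zero_cancel, rule tendsto_sandwich[OF _ _ tendsto_const])
    have "(\<lambda>n. 1 / sqrt (real n)) \<longlonglongrightarrow> 0"
      by (rule tendsto_divide_0[OF tendsto_const filterlim_at_top_imp_at_infinity[OF filterlim_compose[OF sqrt_at_top filterlim_real_sequentially]]])
    from tendsto_mult[OF tendsto_const[of "K / 6"] this]
    show "(\<lambda>n. K / 6 * (1 / sqrt (real n))) \<longlonglongrightarrow> 0" by simp
    show "eventually (\<lambda>n. norm (charf \<mu> ((1 / sqrt (real n)) *\<^sub>R t) ^ n - w n ^ n) \<le> K / 6 * (1 / sqrt (real n))) sequentially"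
      using eventually_gt_at_top[of "nat \<lceil>V\<rceil>"] by eventually_elim (rule step)
  qed auto
  from tendsto_add[OF this w_lim] show ?thesis by (simp add: V_def)
qed

text \<open>
  The law of \<open>(Z + Z') / sqrt 2\<close>, for independent copies \<open>Z\<close> and \<open>Z'\<close> of a centred Gaussian vector,
  is again that of \<open>Z\<close>. In terms of densities, the parallelogram law lets the exponent
  \<open>Q x + Q (sqrt 2 * u - x)\<close> be rewritten as \<open>Q u + Q (sqrt 2 * x - u)\<close>, and the second summand
  integrates out.
\<close>

lemma charf_gaussian_stable:
  fixes Q :: "'a::euclidean_space \<Rightarrow> real"
  assumes \<nu>_def: "\<nu> = density lborel (\<lambda>x. ennreal (c * exp (- Q x / 2)))" and \<nu>: "prob_space \<nu>"
    and [measurable]: "Q \<in> borel_measurable borel" and c: "0 \<le> c"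
    and parallelogram: "\<And>a b. Q (a + b) + Q (a - b) = 2 * Q a + 2 * Q b"
    and scale: "\<And>k a. Q (k *\<^sub>R a) = k\<^sup>2 * Q a"
  shows "(charf \<nu> ((1 / sqrt 2) *\<^sub>R t))\<^sup>2 = charf \<nu> t"
proof -
  define \<phi> where "\<phi> x = c * exp (- Q x / 2)" for x
  have [measurable]: "\<phi> \<in> borel_measurable borel" unfolding \<phi>_def by measurable
  have nonneg: "0 \<le> \<phi> x" for x using c by (simp add: \<phi>_def)
  interpret \<nu>: prob_space \<nu> by fact
  have int: "integrable lborel \<phi>" and int1: "(\<integral>x. \<phi> x \<partial>lborel) = 1"
    using integral_of_prob_density[of \<phi>] \<nu> nonneg by (simp_all add: \<nu>_def \<phi>_def)
  have charf_eq: "charf \<nu> s = (CLINT x|lborel. \<phi> x * iexp (s \<bullet> x))" for s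
    unfolding charf_def \<nu>_def using c by (subst integral_density) (auto simp: \<phi>_def scaleR_conv_of_real)
  define \<kappa> where "\<kappa> = sqrt 2 ^ DIM('a)"
  have \<kappa>: "0 < \<kappa>" by (simp add: \<kappa>_def)
  \<comment> \<open>The constant \<open>\<kappa>\<close> is the Jacobian of the substitution \<open>y = sqrt 2 * u - x\<close>; it cancels in the end.\<close>
  have shift: "integrable lborel (\<lambda>u. \<phi> (sqrt 2 *\<^sub>R u - x))" "(\<integral>u. \<phi> (sqrt 2 *\<^sub>R u - x) \<partial>lborel) = 1 / \<kappa>" for x :: 'a
    using lborel_affine_substitution[of \<phi> "sqrt 2" "- x"] int int1 \<kappa>
    by (simp_all add: \<kappa>_def field_simps)
  have swap: "\<phi> x * \<phi> (sqrt 2 *\<^sub>R u - x) = \<phi> u * \<phi> (sqrt 2 *\<^sub>R x - u)" for x u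
  proof -
    define a where "a = (1 / sqrt 2) *\<^sub>R u"
    define v where "v = x - a"
    have x: "x = a + v" and u: "u = sqrt 2 *\<^sub>R a" by (simp_all add: a_def v_def)
    have "sqrt 2 *\<^sub>R u = a + a" by (simp add: u scaleR_2)
    then have 1: "sqrt 2 *\<^sub>R u - x = a - v" by (simp add: x)
    have 2: "sqrt 2 *\<^sub>R x - u = sqrt 2 *\<^sub>R v" by (simp add: x u scaleR_add_right)
    have "Q x + Q (sqrt 2 *\<^sub>R u - x) = Q u + Q (sqrt 2 *\<^sub>R x - u)"
      unfolding 1 2 unfolding x u using parallelogram[of a v] by (simp add: scale)
    then show ?thesis
      by (simp add: \<phi>_def exp_add[symmetric] add_divide_distrib[symmetric] minus_add_distrib[symmetric] del: minus_add_distrib)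
  qed
  let ?F = "\<lambda>x u. complex_of_real (\<phi> x) * (complex_of_real (\<phi> (sqrt 2 *\<^sub>R u - x)) * iexp (t \<bullet> u))"
  have intF: "integrable (lborel \<Otimes>\<^sub>M lborel) (case_prod ?F)"
  proof (rule lborel_pair.Fubini_integrable)
    show "case_prod ?F \<in> borel_measurable (lborel \<Otimes>\<^sub>M lborel)" by measurable
    show "integrable lborel (\<lambda>x. \<integral>u. norm (case_prod ?F (x, u)) \<partial>lborel)"
      using int shift by (simp add: norm_mult nonneg)
    show "AE x in lborel. integrable lborel (\<lambda>u. case_prod ?F (x, u))"
    proof (rule AE_I2)
      fix x
      have "integrable lborel (\<lambda>u. complex_of_real (\<phi> (sqrt 2 *\<^sub>R u - x)) * iexp (t \<bullet> u))"
        by (rule Bochner_Integration.integrable_bound[OF shift(1)[of x]]) (auto simp: norm_mult)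
      then show "integrable lborel (\<lambda>u. case_prod ?F (x, u))" by simp
    qed
  qed
  have inner: "charf \<nu> ((1 / sqrt 2) *\<^sub>R t) * (\<phi> x * iexp (((1 / sqrt 2) *\<^sub>R t) \<bullet> x)) = \<kappa> *\<^sub>R (CLINT u|lborel. ?F x u)" for x
  proof -
    have "charf \<nu> ((1 / sqrt 2) *\<^sub>R t) =
       \<kappa> *\<^sub>R (CLINT u|lborel. \<phi> (sqrt 2 *\<^sub>R u - x) * iexp (((1 / sqrt 2) *\<^sub>R t) \<bullet> (sqrt 2 *\<^sub>R u - x)))"
      unfolding charf_eq \<kappa>_def
      using lborel_affine_substitution(2)[of "\<lambda>y. complex_of_real (\<phi> y) * iexp (((1 / sqrt 2) *\<^sub>R t) \<bullet> y)" "sqrt 2" "- x"]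
      by simp
    then have "charf \<nu> ((1 / sqrt 2) *\<^sub>R t) * (\<phi> x * iexp (((1 / sqrt 2) *\<^sub>R t) \<bullet> x)) =
       \<kappa> *\<^sub>R (CLINT u|lborel. \<phi> (sqrt 2 *\<^sub>R u - x) * iexp (((1 / sqrt 2) *\<^sub>R t) \<bullet> (sqrt 2 *\<^sub>R u - x)) * (\<phi> x * iexp (((1 / sqrt 2) *\<^sub>R t) \<bullet> x)))"
      by (simp only: integral_mult_left_zero mult_scaleR_left)
    also have "(\<lambda>u. \<phi> (sqrt 2 *\<^sub>R u - x) * iexp (((1 / sqrt 2) *\<^sub>R t) \<bullet> (sqrt 2 *\<^sub>R u - x)) * (\<phi> x * iexp (((1 / sqrt 2) *\<^sub>R t) \<bullet> x))) = ?F x"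
    proof
      fix u
      have E: "iexp (((1 / sqrt 2) *\<^sub>R t) \<bullet> (sqrt 2 *\<^sub>R u - x)) * iexp (((1 / sqrt 2) *\<^sub>R t) \<bullet> x) = iexp (t \<bullet> u)"
        by (simp add: mult_exp_exp inner_diff_right right_diff_distrib)
      have "\<phi> (sqrt 2 *\<^sub>R u - x) * iexp (((1 / sqrt 2) *\<^sub>R t) \<bullet> (sqrt 2 *\<^sub>R u - x)) * (\<phi> x * iexp (((1 / sqrt 2) *\<^sub>R t) \<bullet> x)) =
          complex_of_real (\<phi> x) * (complex_of_real (\<phi> (sqrt 2 *\<^sub>R u - x)) *
            (iexp (((1 / sqrt 2) *\<^sub>R t) \<bullet> (sqrt 2 *\<^sub>R u - x)) * iexp (((1 / sqrt 2) *\<^sub>R t) \<bullet> x)))"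
        by (simp only: mult_ac)
      then show "\<phi> (sqrt 2 *\<^sub>R u - x) * iexp (((1 / sqrt 2) *\<^sub>R t) \<bullet> (sqrt 2 *\<^sub>R u - x)) * (\<phi> x * iexp (((1 / sqrt 2) *\<^sub>R t) \<bullet> x)) = ?F x u"
        by (simp only: E)
    qed
    finally show ?thesis .
  qed
  have "(charf \<nu> ((1 / sqrt 2) *\<^sub>R t))\<^sup>2 =
     (CLINT x|lborel. charf \<nu> ((1 / sqrt 2) *\<^sub>R t) * (\<phi> x * iexp (((1 / sqrt 2) *\<^sub>R t) \<bullet> x)))"
    by (simp only: integral_mult_right_zero charf_eq[symmetric] power2_eq_square)
  also have "\<dots> = \<kappa> *\<^sub>R (CLINT x|lborel. CLINT u|lborel. ?F x u)"
    by (simp only: inner integral_scaleR_right)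
  also have "\<dots> = \<kappa> *\<^sub>R (CLINT u|lborel. CLINT x|lborel. ?F x u)"
    using lborel_pair.Fubini_integral[OF intF] by simp
  also have "(\<lambda>u. CLINT x|lborel. ?F x u) = (\<lambda>u. (1 / \<kappa>) *\<^sub>R (\<phi> u * iexp (t \<bullet> u)))"
  proof
    fix u
    have "(CLINT x|lborel. ?F x u) = (CLINT x|lborel. complex_of_real (\<phi> (sqrt 2 *\<^sub>R x - u)) * (\<phi> u * iexp (t \<bullet> u)))"
    proof (rule Bochner_Integration.integral_cong[OF refl])
      fix x
      have "complex_of_real (\<phi> x) * complex_of_real (\<phi> (sqrt 2 *\<^sub>R u - x)) =
         complex_of_real (\<phi> u) * complex_of_real (\<phi> (sqrt 2 *\<^sub>R x - u))"
        by (simp only: of_real_mult[symmetric] swap)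
      then have "?F x u = complex_of_real (\<phi> u) * complex_of_real (\<phi> (sqrt 2 *\<^sub>R x - u)) * iexp (t \<bullet> u)"
        by (simp only: mult.assoc[symmetric])
      then show "?F x u = complex_of_real (\<phi> (sqrt 2 *\<^sub>R x - u)) * (\<phi> u * iexp (t \<bullet> u))"
        by (simp only: mult_ac)
    qed
    also have "\<dots> = of_real (1 / \<kappa>) * (\<phi> u * iexp (t \<bullet> u))"
      by (simp only: integral_mult_left_zero integral_complex_of_real shift)
    finally show "(CLINT x|lborel. ?F x u) = (1 / \<kappa>) *\<^sub>R (\<phi> u * iexp (t \<bullet> u))"
      by (simp add: scaleR_conv_of_real)
  qed
  also have "\<kappa> *\<^sub>R (CLINT u|lborel. (1 / \<kappa>) *\<^sub>R (\<phi> u * iexp (t \<bullet> u))) = charf \<nu> t"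
    using \<kappa> by (simp only: integral_scaleR_right charf_eq) simp
  finally show ?thesis .
qed

text \<open>
  By stability the characteristic function equals its own \<open>2^k\<close>-th power at argument
  \<open>t / sqrt (2^k)\<close>, and these powers converge to the Gaussian exponential of the second moment. The
  covariance thus enters through the law itself, not through \<open>Q\<close>.
\<close>

lemma charf_gaussian:
  fixes Q :: "'a::euclidean_space \<Rightarrow> real"
  assumes \<nu>_def: "\<nu> = density lborel (\<lambda>x. ennreal (c * exp (- Q x / 2)))" and \<nu>: "prob_space \<nu>"
    and Q: "Q \<in> borel_measurable borel" "0 \<le> c"
      "\<And>a b. Q (a + b) + Q (a - b) = 2 * Q a + 2 * Q b" "\<And>k a. Q (k *\<^sub>R a) = k\<^sup>2 * Q a"
    and int3: "integrable \<nu> (\<lambda>x. norm x ^ 3)" and mean: "(\<integral>x. t \<bullet> x \<partial>\<nu>) = 0"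
  shows "charf \<nu> t = exp (- of_real (\<integral>x. (t \<bullet> x)\<^sup>2 \<partial>\<nu>) / 2)"
proof -
  have sets: "sets \<nu> = sets borel" by (simp add: \<nu>_def)
  have iter: "charf \<nu> ((1 / sqrt (real (2 ^ k))) *\<^sub>R t) ^ (2 ^ k) = charf \<nu> t" for k
  proof (induction k)
    case (Suc k)
    have "charf \<nu> ((1 / sqrt (real (2 ^ Suc k))) *\<^sub>R t) ^ (2 ^ Suc k) =
      ((charf \<nu> ((1 / sqrt 2) *\<^sub>R ((1 / sqrt (real (2 ^ k))) *\<^sub>R t)))\<^sup>2) ^ (2 ^ k)"
      by (simp add: power_mult[symmetric] real_sqrt_mult)
    also have "\<dots> = charf \<nu> t"
      by (simp only: charf_gaussian_stable[OF \<nu>_def \<nu> Q] Suc)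
    finally show ?case .
  qed simp
  have "strict_mono (\<lambda>k. 2 ^ k :: nat)" by (rule strict_monoI) simp
  from LIMSEQ_subseq_LIMSEQ[OF charf_power_tendsto[OF \<nu> sets int3 mean] this]
  have "(\<lambda>k. charf \<nu> ((1 / sqrt (real (2 ^ k))) *\<^sub>R t) ^ (2 ^ k)) \<longlonglongrightarrow> exp (- of_real (\<integral>x. (t \<bullet> x)\<^sup>2 \<partial>\<nu>) / 2)"
    by (simp add: o_def)
  then show ?thesis unfolding iter using LIMSEQ_unique tendsto_const by blast
qed

section \<open>Log-concave densities decay exponentially\<close>

definition log_concave :: "('a::real_vector \<Rightarrow> real) \<Rightarrow> bool" where
  "log_concave f \<longleftrightarrow> (\<forall>x y. \<forall>t\<in>{0<..<1::real}. f x * f y > 0 \<longrightarrow>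
     f ((1 - t) *\<^sub>R x + t *\<^sub>R y) \<ge> f x powr (1 - t) * f y powr t)"

lemma log_concaveD:
  assumes "log_concave f" "0 < f x" "0 < f y" "0 < t" "t < 1"
  shows "f x powr (1 - t) * f y powr t \<le> f ((1 - t) *\<^sub>R x + t *\<^sub>R y)"
  using assms unfolding log_concave_def by auto

lemma log_concave_convex_superlevel:
  fixes f :: "'a::real_vector \<Rightarrow> real"
  assumes "log_concave f" "0 < c"
  shows "convex {x. c \<le> f x}"
proof (rule convexI)
  fix x y and u v :: real
  assume xy: "x \<in> {x. c \<le> f x}" "y \<in> {x. c \<le> f x}" and uv: "0 \<le> u" "0 \<le> v" "u + v = 1"
  show "u *\<^sub>R x + v *\<^sub>R y \<in> {x. c \<le> f x}"
  proof (cases "v = 0 \<or> v = 1")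
    case True with xy uv show ?thesis by auto
  next
    case False
    then have v: "0 < v" "v < 1" and u: "u = 1 - v" using uv by auto
    have "c = c powr (1 - v) * c powr v" using assms(2) by (simp add: powr_add[symmetric])
    also have "\<dots> \<le> f x powr (1 - v) * f y powr v"
      using xy v assms(2) by (intro mult_mono powr_mono2) auto
    also have "\<dots> \<le> f ((1 - v) *\<^sub>R x + v *\<^sub>R y)"
      using xy v assms by (intro log_concaveD) auto
    finally show ?thesis by (simp add: u)
  qed
qed

text \<open>
  Some superlevel set is not negligible, and a convex set that is not negligible has interior
  points.
\<close>

lemma log_concave_superlevel_ball:
  fixes f :: "'a::euclidean_space \<Rightarrow> real"
  assumes lc: "log_concave f" and [measurable]: "f \<in> borel_measurable borel"
    and nonneg: "\<And>x. 0 \<le> f x" and pos: "(\<integral>x. f x \<partial>lborel) \<noteq> 0"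
  shows "\<exists>c x\<^sub>0 \<rho>. 0 < c \<and> 0 < \<rho> \<and> (\<forall>y\<in>ball x\<^sub>0 \<rho>. c \<le> f y)"
proof -
  have "\<exists>k. {x. 1 / Suc k \<le> f x} \<notin> null_sets lborel"
  proof (rule ccontr)
    assume "\<not> ?thesis"
    then have "AE x in lborel. \<not> 1 / Suc k \<le> f x" for k
      using AE_not_in[of "{x. 1 / Suc k \<le> f x}" lborel] by auto
    then have "AE x in lborel. \<forall>k. \<not> 1 / Suc k \<le> f x" by (subst AE_all_countable) auto
    then have "AE x in lborel. f x = 0"
    proof eventually_elim
      case (elim x)
      show ?case
      proof (rule ccontr)
        assume "f x \<noteq> 0"
        then have "0 < f x" using nonneg[of x] by simp
        then obtain k where "inverse (real (Suc k)) < f x" using reals_Archimedean by blast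
        with elim show False by (auto simp: inverse_eq_divide dest: less_imp_le)
      qed
    qed
    then have "(\<integral>x. f x \<partial>lborel) = 0" by (simp add: integral_eq_zero_AE)
    with pos show False by simp
  qed
  then obtain k where k: "{x. 1 / Suc k \<le> f x} \<notin> null_sets lborel" by blast
  define S where "S = {x. 1 / Suc k \<le> f x}"
  have "S \<in> sets lborel" unfolding S_def by measurable
  with k have "\<not> negligible S"
    by (simp add: S_def negligible_iff_null_sets null_sets_completion_iff)
  moreover have "convex S" unfolding S_def by (rule log_concave_convex_superlevel[OF lc]) simp
  ultimately have "interior S \<noteq> {}" using negligible_convex_interior by blast
  then obtain x\<^sub>0 where "x\<^sub>0 \<in> interior S" by blast
  then obtain \<rho> where "0 < \<rho>" "ball x\<^sub>0 \<rho> \<subseteq> S" by (auto simp: mem_interior)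
  then show ?thesis
    by (intro exI[of _ "1 / Suc k"] exI[of _ x\<^sub>0] exI[of _ \<rho>]) (auto simp: S_def)
qed

text \<open>
  Fix a ball on which \<open>f \<ge> c\<close>. Halfway between a point \<open>x\<close> and this ball lies a ball of half the
  radius on which \<open>f\<close> is at least the geometric mean of \<open>f x\<close> and \<open>c\<close>. Integrability of \<open>f\<close> then bounds \<open>f x\<close>
  everywhere, and forces \<open>f x \<le> c / e\<close> once \<open>x\<close> is far away. Log-concavity along the ray from the centre
  turns this single drop by a factor \<open>e\<close> into exponential decay.
\<close>

theorem log_concave_exponential_bound:
  fixes f :: "'a::euclidean_space \<Rightarrow> real"
  assumes lc: "log_concave f" and [measurable]: "f \<in> borel_measurable borel"
    and nonneg: "\<And>x. 0 \<le> f x" and int: "integrable lborel f" and pos: "(\<integral>x. f x \<partial>lborel) \<noteq> 0"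
  obtains A B where "0 < B" "\<And>x. f x \<le> A * exp (- B * norm x)"
proof -
  obtain c x\<^sub>0 \<rho> where c: "0 < c" and \<rho>: "0 < \<rho>" and ball: "\<And>y. y \<in> ball x\<^sub>0 \<rho> \<Longrightarrow> c \<le> f y"
    using log_concave_superlevel_ball[OF lc assms(2) nonneg pos] by blast
  define mid where "mid x = (1 / 2) *\<^sub>R (x + x\<^sub>0)" for x
  have midpoint: "sqrt (f x * c) \<le> f z" if x: "0 < f x" and z: "z \<in> ball (mid x) (\<rho> / 2)" for x z
  proof -
    define y where "y = 2 *\<^sub>R z - x"
    have "x\<^sub>0 - y = 2 *\<^sub>R (mid x - z)" by (simp add: mid_def y_def algebra_simps scaleR_2)
    then have "y \<in> ball x\<^sub>0 \<rho>" using z by (simp add: dist_norm)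
    then have y: "c \<le> f y" by (rule ball)
    have "sqrt (f x * c) \<le> sqrt (f x * f y)" using x y by simp
    also have "\<dots> = f x powr (1 - 1 / 2) * f y powr (1 / 2)"
      using x y c by (simp add: real_sqrt_mult powr_half_sqrt)
    also have "\<dots> \<le> f ((1 - 1 / 2) *\<^sub>R x + (1 / 2) *\<^sub>R y)"
      using x y c by (intro log_concaveD[OF lc]) auto
    also have "(1 - 1 / 2) *\<^sub>R x + (1 / 2) *\<^sub>R y = z"
      by (simp add: y_def scaleR_diff_right)
    finally show ?thesis .
  qed
  define I where "I = (\<integral>x. f x \<partial>lborel)"
  define V where "V = unit_ball_vol (real DIM('a)) * (\<rho> / 2) ^ DIM('a)"
  have V: "0 < V" using \<rho> by (simp add: V_def)
  have bounded: "f x \<le> (I / V)\<^sup>2 / c" for x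
  proof (cases "0 < f x")
    case False
    then have "f x = 0" using nonneg[of x] by simp
    then show ?thesis using c by simp
  next
    case True
    have "sqrt (f x * c) * V = (\<integral>z. sqrt (f x * c) * indicator (ball (mid x) (\<rho> / 2)) z \<partial>lborel)"
      using content_ball[of "\<rho> / 2" "mid x"] \<rho> by (simp add: V_def)
    also have "\<dots> \<le> I"
      unfolding I_def
    proof (rule integral_mono'[OF int])
      fix z show "sqrt (f x * c) * indicator (ball (mid x) (\<rho> / 2)) z \<le> f z"
        using midpoint[OF True, of z] nonneg[of z] by (simp add: indicator_def del: mem_ball)
    qed (use nonneg in auto)
    finally have "sqrt (f x * c) \<le> I / V" using V by (simp add: field_simps)
    then have "(sqrt (f x * c))\<^sup>2 \<le> (I / V)\<^sup>2" using True c by (intro power_mono) auto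
    then show ?thesis using True c V by (simp add: field_simps)
  qed
  obtain R\<^sub>0 where R\<^sub>0: "0 < R\<^sub>0" "\<And>x. R\<^sub>0 \<le> norm x \<Longrightarrow> \<exists>z\<in>ball x (\<rho> / 2). f z < c * exp (- 1 / 2)"
    using exists_small_value_in_far_balls[OF int nonneg, of "c * exp (- 1 / 2)" "\<rho> / 2"] c \<rho> by auto
  define R where "R = 2 * R\<^sub>0 + 2 * norm x\<^sub>0"
  have R: "0 < R" using R\<^sub>0(1) by (simp add: R_def add_pos_nonneg)
  \<comment> \<open>A value \<open>f x\<close> above \<open>c / e\<close> would make \<open>f\<close> at least \<open>c * exp (- 1 / 2)\<close> on the whole midpoint ball.\<close>
  have far: "f x \<le> c * exp (- 1)" if "R \<le> norm (x - x\<^sub>0)" for x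
  proof (cases "0 < f x")
    case False
    then have "f x = 0" using nonneg[of x] by simp
    then show ?thesis using c by simp
  next
    case True
    have "norm (x - x\<^sub>0) \<le> norm (x + x\<^sub>0) + 2 * norm x\<^sub>0"
      using norm_triangle_ineq4[of "x + x\<^sub>0" "x\<^sub>0 + x\<^sub>0"] norm_triangle_ineq[of x\<^sub>0 x\<^sub>0] by simp
    then have "R\<^sub>0 \<le> norm (mid x)" using that by (simp add: mid_def R_def)
    then obtain z where z: "z \<in> ball (mid x) (\<rho> / 2)" "f z < c * exp (- 1 / 2)" using R\<^sub>0(2) by blast
    have "sqrt (f x * c) \<le> c * exp (- 1 / 2)" using midpoint[OF True z(1)] z(2) by linarith
    then have "(sqrt (f x * c))\<^sup>2 \<le> (c * exp (- 1 / 2))\<^sup>2" using True c by (intro power_mono) auto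
    then have "f x * c \<le> c * exp (- 1) * c"
      using True c by (simp add: power2_eq_square exp_add[symmetric] mult_ac)
    then show ?thesis using c by (simp add: mult.commute)
  qed
  have decay: "f x \<le> c * exp (- norm (x - x\<^sub>0) / R)" if x: "R \<le> norm (x - x\<^sub>0)" for x
  proof (cases "0 < f x")
    case False
    then have "f x = 0" using nonneg[of x] by simp
    then show ?thesis using c by simp
  next
    case True
    show ?thesis
    proof (cases "norm (x - x\<^sub>0) = R")
      case True then show ?thesis using far[OF x] R by simp
    next
      case False
      define s where "s = R / norm (x - x\<^sub>0)"
      have nz: "0 < norm (x - x\<^sub>0)" using x R by linarith
      have s: "0 < s" "s < 1" using False x R nz by (auto simp: s_def)
      define y where "y = (1 - s) *\<^sub>R x\<^sub>0 + s *\<^sub>R x"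
      have "y - x\<^sub>0 = s *\<^sub>R (x - x\<^sub>0)" by (simp add: y_def algebra_simps)
      then have "norm (y - x\<^sub>0) = R" using s nz R by (simp add: s_def)
      then have fy: "f y \<le> c * exp (- 1)" by (intro far) simp
      have c0: "c \<le> f x\<^sub>0" using ball \<rho> by simp
      have "c powr (1 - s) * f x powr s \<le> f x\<^sub>0 powr (1 - s) * f x powr s"
        using c c0 s by (intro mult_right_mono powr_mono2) auto
      also have "\<dots> \<le> f y" unfolding y_def
        using c c0 True s by (intro log_concaveD[OF lc]) auto
      also note fy
      finally have le: "c powr (1 - s) * f x powr s \<le> c * exp (- 1)" .
      have "ln (c powr (1 - s) * f x powr s) \<le> ln (c * exp (- 1))"
        using le c True by (subst ln_le_cancel_iff) auto
      then have "(1 - s) * ln c + s * ln (f x) \<le> ln c - 1"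
        using c True by (simp add: ln_mult ln_powr)
      then have "s * ln (f x) \<le> s * (ln c - 1 / s)" using s by (simp add: algebra_simps)
      then have "ln (f x) \<le> ln c - 1 / s" using s by simp
      then have "exp (ln (f x)) \<le> exp (ln c - 1 / s)" by simp
      then show ?thesis using True c by (simp add: exp_diff s_def exp_minus field_simps)
    qed
  qed
  define A where "A = max ((I / V)\<^sup>2 / c) c * exp (1 + norm x\<^sub>0 / R)"
  have A_exp: "max ((I / V)\<^sup>2 / c) c * exp (1 + norm x\<^sub>0 / R - norm x / R) = A * exp (- (1 / R) * norm x)" for x
    by (simp add: A_def mult.assoc exp_add[symmetric])
  have "f x \<le> A * exp (- (1 / R) * norm x)" for x
  proof (cases "R \<le> norm (x - x\<^sub>0)")
    case True
    have "norm x \<le> norm (x - x\<^sub>0) + norm x\<^sub>0" using norm_triangle_ineq[of "x - x\<^sub>0" x\<^sub>0] by simp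
    then have "norm x / R \<le> (norm (x - x\<^sub>0) + norm x\<^sub>0) / R"
      using R by (intro divide_right_mono) auto
    then have "- norm (x - x\<^sub>0) / R \<le> 1 + norm x\<^sub>0 / R - norm x / R"
      by (simp add: add_divide_distrib)
    then have "c * exp (- norm (x - x\<^sub>0) / R) \<le> max ((I / V)\<^sup>2 / c) c * exp (1 + norm x\<^sub>0 / R - norm x / R)"
      using c by (intro mult_mono) auto
    then show ?thesis using decay[OF True] unfolding A_exp by linarith
  next
    case False
    have "norm x \<le> norm (x - x\<^sub>0) + norm x\<^sub>0" using norm_triangle_ineq[of "x - x\<^sub>0" x\<^sub>0] by simp
    then have "norm x / R \<le> (R + norm x\<^sub>0) / R"
      using R False by (intro divide_right_mono) auto
    then have "0 \<le> 1 + norm x\<^sub>0 / R - norm x / R"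
      using R by (simp add: add_divide_distrib)
    then have "(I / V)\<^sup>2 / c * 1 \<le> max ((I / V)\<^sup>2 / c) c * exp (1 + norm x\<^sub>0 / R - norm x / R)"
      using c by (intro mult_mono) auto
    then show ?thesis using bounded[of x] unfolding A_exp by linarith
  qed
  then show thesis using R by (intro that[of "1 / R" A]) auto
qed

section \<open>Exponential moments\<close>

lemma exp_moment_of_exponential_bound:
  fixes f :: "'a::euclidean_space \<Rightarrow> real"
  assumes [measurable]: "f \<in> borel_measurable borel" and nonneg: "\<And>x. 0 \<le> f x"
    and B: "0 < B" "\<And>x. f x \<le> A * exp (- B * norm x)"
  shows "integrable (density lborel f) (\<lambda>x. exp (B / 2 * norm x))"
proof -
  have "integrable lborel (\<lambda>x. f x * exp (B / 2 * norm x))"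
  proof (rule Bochner_Integration.integrable_bound)
    show "integrable lborel (\<lambda>x::'a. A * exp (- (B / 2) * norm x))"
      by (intro integrable_mult_right integrable_exp_norm) (use B in auto)
    show "AE x in lborel. norm (f x * exp (B / 2 * norm x)) \<le> norm (A * exp (- (B / 2) * norm x))"
    proof (rule AE_I2)
      fix x
      have "f x * exp (B / 2 * norm x) \<le> A * exp (- B * norm x) * exp (B / 2 * norm x)"
        using B by (intro mult_right_mono) auto
      also have "\<dots> = A * exp (- (B / 2) * norm x)" by (simp add: mult.assoc exp_add[symmetric])
      finally show "norm (f x * exp (B / 2 * norm x)) \<le> norm (A * exp (- (B / 2) * norm x))"
        using nonneg[of x] by (simp add: order_trans[OF _ abs_ge_self])
    qed
  qed simp
  then show ?thesis using nonneg by (subst integrable_density) auto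
qed

lemma power_le_exp:
  assumes "0 < (a::real)" "0 \<le> x"
  shows "x ^ k \<le> (1 / a) ^ k * exp (real k * a * x)"
proof -
  have "a * x \<le> exp (a * x)" using exp_ge_add_one_self[of "a * x"] by linarith
  then have "x \<le> (1 / a) * exp (a * x)" using assms by (simp add: field_simps)
  then have "x ^ k \<le> ((1 / a) * exp (a * x)) ^ k" using assms by (intro power_mono) auto
  also have "\<dots> = (1 / a) ^ k * exp (real k * a * x)"
    by (simp only: power_mult_distrib exp_of_nat_mult[symmetric] mult.assoc)
  finally show ?thesis .
qed

lemma integrable_power_times_exp:
  fixes \<mu> :: "'a::euclidean_space measure"
  assumes sets [measurable_cong]: "sets \<mu> = sets borel"
    and int: "integrable \<mu> (\<lambda>x. exp (\<delta> * norm x))" and s: "s < \<delta>"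
  shows "integrable \<mu> (\<lambda>x. norm x ^ k * exp (s * norm x))"
proof -
  \<comment> \<open>The room between \<open>s\<close> and \<open>\<delta>\<close> is shared among the \<open>k\<close> factors of the power; one further share admits \<open>k = 0\<close>.\<close>
  define a where "a = (\<delta> - s) / (k + 1)"
  have a: "0 < a" "real k * a \<le> \<delta> - s" using s by (auto simp: a_def field_simps)
  show ?thesis
  proof (rule Bochner_Integration.integrable_bound)
    show "integrable \<mu> (\<lambda>x. (1 / a) ^ k * exp (\<delta> * norm x))" using int by simp
    show "AE x in \<mu>. norm (norm x ^ k * exp (s * norm x)) \<le> norm ((1 / a) ^ k * exp (\<delta> * norm x))"
    proof (rule AE_I2)
      fix x :: 'a
      have "norm x ^ k * exp (s * norm x) \<le> (1 / a) ^ k * exp (real k * a * norm x) * exp (s * norm x)"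
        using power_le_exp[OF a(1), of "norm x" k] by (intro mult_right_mono) auto
      also have "\<dots> = (1 / a) ^ k * exp ((real k * a + s) * norm x)"
        by (simp add: mult.assoc exp_add[symmetric] distrib_right)
      also have "\<dots> \<le> (1 / a) ^ k * exp (\<delta> * norm x)"
        using a by (intro mult_left_mono) (auto intro!: mult_right_mono)
      finally show "norm (norm x ^ k * exp (s * norm x)) \<le> norm ((1 / a) ^ k * exp (\<delta> * norm x))"
        using a by simp
    qed
  qed measurable
qed

lemma exp_le_quadratic: "exp y \<le> 1 + y + y\<^sup>2 * exp \<bar>y\<bar>" for y :: real
proof -
  obtain t where t: "\<bar>t\<bar> \<le> \<bar>y\<bar>" "exp y = (\<Sum>m<2. y ^ m / fact m) + exp t / fact 2 * y ^ 2"
    using Maclaurin_exp_le[of y 2] by blast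
  have "exp t / 2 * y\<^sup>2 \<le> exp \<bar>y\<bar> * y\<^sup>2"
  proof (rule mult_right_mono)
    have "exp t \<le> exp \<bar>y\<bar>" using t(1) by simp
    then show "exp t / 2 \<le> exp \<bar>y\<bar>" using exp_gt_zero[of t] by linarith
  qed simp
  then show ?thesis using t(2) by (simp add: numeral_2_eq_2 mult.commute)
qed

text \<open>
  The mean being zero, the exponential moment has no linear term in \<open>s\<close>. The bound is used with
  \<open>s\<close> of order \<open>1 / sqrt n\<close>, where its \<open>n\<close>-th power stays bounded.
\<close>

lemma mgf_subgaussian_near_zero:
  fixes \<mu> :: "'a::euclidean_space measure"
  assumes \<mu>: "prob_space \<mu>" and sets [measurable_cong]: "sets \<mu> = sets borel"
    and int: "integrable \<mu> (\<lambda>x. exp (2 * \<delta> * norm x))" and \<delta>: "0 < \<delta>"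
    and b: "norm b = 1" and mean: "(\<integral>x. b \<bullet> x \<partial>\<mu>) = 0" and s: "\<bar>s\<bar> \<le> \<delta>"
  shows "integrable \<mu> (\<lambda>x. exp (s * (b \<bullet> x)))"
    and "(\<integral>x. exp (s * (b \<bullet> x)) \<partial>\<mu>) \<le> exp (s\<^sup>2 * (\<integral>x. (norm x)\<^sup>2 * exp (\<delta> * norm x) \<partial>\<mu>))"
proof -
  interpret prob_space \<mu> by fact
  have i2: "integrable \<mu> (\<lambda>x. (norm x)\<^sup>2 * exp (\<delta> * norm x))"
    by (rule integrable_power_times_exp[OF sets int]) (use \<delta> in simp)
  have bx: "\<bar>b \<bullet> x\<bar> \<le> norm x" for x using Cauchy_Schwarz_ineq2[of b x] b by simp
  have i1: "integrable \<mu> (\<lambda>x. b \<bullet> x)"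
  proof (rule Bochner_Integration.integrable_bound)
    show "integrable \<mu> (\<lambda>x. norm x ^ 1 * exp (0 * norm x))"
      by (rule integrable_power_times_exp[OF sets int]) (use \<delta> in simp)
  qed (use bx in auto)
  have sb: "\<bar>s * (b \<bullet> x)\<bar> \<le> \<delta> * norm x" for x
    unfolding abs_mult using bx s by (intro mult_mono) auto
  show i: "integrable \<mu> (\<lambda>x. exp (s * (b \<bullet> x)))"
  proof (rule Bochner_Integration.integrable_bound)
    show "integrable \<mu> (\<lambda>x. norm x ^ 0 * exp (\<delta> * norm x))"
      by (rule integrable_power_times_exp[OF sets int]) (use \<delta> in simp)
    show "AE x in \<mu>. norm (exp (s * (b \<bullet> x))) \<le> norm (norm x ^ 0 * exp (\<delta> * norm x))"
      using sb by (auto intro!: AE_I2 simp: abs_le_iff)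
  qed simp
  have "(\<integral>x. exp (s * (b \<bullet> x)) \<partial>\<mu>) \<le> (\<integral>x. 1 + s * (b \<bullet> x) + s\<^sup>2 * ((norm x)\<^sup>2 * exp (\<delta> * norm x)) \<partial>\<mu>)"
  proof (rule integral_mono[OF i])
    show "integrable \<mu> (\<lambda>x. 1 + s * (b \<bullet> x) + s\<^sup>2 * ((norm x)\<^sup>2 * exp (\<delta> * norm x)))"
      using i1 i2 by auto
    fix x
    have "(b \<bullet> x)\<^sup>2 \<le> (norm x)\<^sup>2" using bx[of x] by (simp add: abs_le_square_iff[symmetric])
    then have "(s * (b \<bullet> x))\<^sup>2 * exp \<bar>s * (b \<bullet> x)\<bar> \<le> s\<^sup>2 * (norm x)\<^sup>2 * exp (\<delta> * norm x)"
      using sb[of x] by (intro mult_mono) (auto simp: power_mult_distrib intro!: mult_left_mono)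
    then show "exp (s * (b \<bullet> x)) \<le> 1 + s * (b \<bullet> x) + s\<^sup>2 * ((norm x)\<^sup>2 * exp (\<delta> * norm x))"
      using exp_le_quadratic[of "s * (b \<bullet> x)"] by (simp add: mult.assoc)
  qed
  also have "\<dots> = 1 + s\<^sup>2 * (\<integral>x. (norm x)\<^sup>2 * exp (\<delta> * norm x) \<partial>\<mu>)"
    using i1 i2 mean by (simp add: prob_space)
  also have "\<dots> \<le> exp (s\<^sup>2 * (\<integral>x. (norm x)\<^sup>2 * exp (\<delta> * norm x) \<partial>\<mu>))" by simp
  finally show "(\<integral>x. exp (s * (b \<bullet> x)) \<partial>\<mu>) \<le> exp (s\<^sup>2 * (\<integral>x. (norm x)\<^sup>2 * exp (\<delta> * norm x) \<partial>\<mu>))" .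
qed

text \<open>
  The norm is at most the dimension times the largest absolute coordinate; this reduces
  exponential moments of the norm to those of coordinates.
\<close>

lemma exp_norm_le_sum_Basis:
  fixes x :: "'a::euclidean_space"
  assumes "0 \<le> \<delta>"
  shows "exp (\<delta> / DIM('a) * norm x) \<le> (\<Sum>b\<in>Basis. exp (\<delta> * (b \<bullet> x)) + exp (- \<delta> * (b \<bullet> x)))"
proof -
  define m where "m = Max ((\<lambda>b. \<bar>x \<bullet> b\<bar>) ` Basis)"
  have "m \<in> (\<lambda>b. \<bar>x \<bullet> b\<bar>) ` Basis" unfolding m_def by (intro Max_in) auto
  then obtain b where b: "b \<in> Basis" "m = \<bar>x \<bullet> b\<bar>" by auto
  have "norm x \<le> (\<Sum>b\<in>Basis. \<bar>x \<bullet> b\<bar>)" by (rule norm_le_l1)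
  also have "\<dots> \<le> (\<Sum>b\<in>(Basis::'a set). m)" unfolding m_def by (intro sum_mono Max_ge) auto
  finally have "norm x \<le> DIM('a) * m" by simp
  then have "\<delta> / DIM('a) * norm x \<le> \<delta> / DIM('a) * (DIM('a) * m)"
    using assms by (intro mult_left_mono) auto
  then have "exp (\<delta> / DIM('a) * norm x) \<le> exp (\<delta> * \<bar>b \<bullet> x\<bar>)"
    using b by (simp add: inner_commute)
  also have "\<dots> \<le> exp (\<delta> * (b \<bullet> x)) + exp (- \<delta> * (b \<bullet> x))"
    by (cases "0 \<le> b \<bullet> x") (auto simp: add_increasing add_increasing2)
  also have "\<dots> \<le> (\<Sum>b\<in>Basis. exp (\<delta> * (b \<bullet> x)) + exp (- \<delta> * (b \<bullet> x)))"
    by (rule member_le_sum[OF b(1)]) (auto intro: add_nonneg_nonneg)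
  finally show ?thesis .
qed

section \<open>Continuity of the integral of a power of the density\<close>

text \<open>
  Either \<open>y\<close> is below the threshold \<open>exp (- a * \<nu>)\<close>, or raising it to the power \<open>r - 1\<close> gains at most
  \<open>exp (a * \<nu>)\<close>. With \<open>y\<close> the value of a density at \<open>x\<close> and \<open>\<nu>\<close> the norm of \<open>x\<close>, an exponential moment
  thus controls the integral of the \<open>r\<close>-th power.
\<close>

lemma powr_le_exp_decay_plus_weighted:
  assumes "0 < r" "r < 1" "0 \<le> (y::real)" "0 \<le> a * \<nu>"
  shows "y powr r \<le> exp (- (a * r) * \<nu>) + y * exp (a * \<nu>)"
proof (cases "y \<le> exp (- (a * \<nu>))")
  case True
  then have "y powr r \<le> exp (- (a * \<nu>)) powr r" using assms by (intro powr_mono2) auto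
  also have "\<dots> = exp (- (a * r) * \<nu>)" by (simp add: powr_def mult_ac)
  finally show ?thesis using assms by (simp add: add_increasing2)
next
  case False
  then have y: "exp (- (a * \<nu>)) \<le> y" "0 < y" using exp_gt_zero[of "- (a * \<nu>)"] by linarith+
  have "y powr r = y * y powr (r - 1)" using y by (simp add: powr_mult_base)
  also have "y powr (r - 1) \<le> exp (- (a * \<nu>)) powr (r - 1)"
    using y assms by (intro powr_mono2') auto
  also have "exp (- (a * \<nu>)) powr (r - 1) = exp ((1 - r) * (a * \<nu>))" by (simp add: powr_def algebra_simps)
  also have "\<dots> \<le> exp (a * \<nu>)" using assms by (simp add: mult_left_le_one_le)
  finally have "y powr r \<le> y * exp (a * \<nu>)" using y by (simp add: mult_left_mono)
  then show ?thesis by (simp add: add_increasing)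
qed

lemma powr_diff_le_of_le:
  assumes "0 < r" "r < 1" "0 \<le> y" "y \<le> (x::real)"
  shows "x powr r - y powr r \<le> (x - y) powr r"
proof (cases "y = 0 \<or> y = x")
  case True then show ?thesis using assms by auto
next
  case False
  then have y: "0 < y" "y < x" using assms by auto
  have "x powr r = x * x powr (r - 1)"
    using powr_mult_base[of x "r - 1"] y by simp
  also have "\<dots> = y * x powr (r - 1) + (x - y) * x powr (r - 1)"
    by (simp add: algebra_simps)
  also have "\<dots> \<le> y * y powr (r - 1) + (x - y) * (x - y) powr (r - 1)"
    using y assms by (intro add_mono mult_left_mono powr_mono2') auto
  also have "\<dots> = y powr r + (x - y) powr r" using y by (simp add: powr_mult_base)
  finally show ?thesis by simp
qed

lemma abs_powr_diff_le:
  assumes "0 < r" "r < 1" "0 \<le> y" "0 \<le> (x::real)"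
  shows "\<bar>x powr r - y powr r\<bar> \<le> \<bar>x - y\<bar> powr r"
proof (cases "y \<le> x")
  case True
  then have "y powr r \<le> x powr r" using assms by (intro powr_mono2) auto
  then show ?thesis using powr_diff_le_of_le[of r y x] True assms by simp
next
  case False
  then have "x powr r \<le> y powr r" using assms by (intro powr_mono2) auto
  then show ?thesis using powr_diff_le_of_le[of r x y] False assms by (simp add: abs_minus_commute)
qed

lemma integrable_powr_of_exp_moment:
  fixes p :: "'a::euclidean_space \<Rightarrow> real"
  assumes r: "0 < r" "r < 1" and a: "0 < a"
    and [measurable]: "p \<in> borel_measurable borel" and nonneg: "\<And>x. 0 \<le> p x"
    and int: "integrable lborel (\<lambda>x. p x * exp (a * norm x))"
  shows "integrable lborel (\<lambda>x. p x powr r)"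
proof (rule Bochner_Integration.integrable_bound)
  show "integrable lborel (\<lambda>x::'a. exp (- (a * r) * norm x) + p x * exp (a * norm x))"
    using integrable_exp_norm[of "a * r"] r a by (intro Bochner_Integration.integrable_add int) auto
  show "AE x in lborel. norm (p x powr r) \<le> norm (exp (- (a * r) * norm x) + p x * exp (a * norm x))"
    using powr_le_exp_decay_plus_weighted[OF r nonneg, of a "norm x" x for x] a nonneg
    by (intro AE_I2) (auto simp: order_trans[OF _ abs_ge_self])
qed simp

text \<open>
  With \<open>D\<close> the distance of the two densities, \<open>D powr r\<close> is the square of \<open>D powr (r / 2)\<close>. One of
  these factors is small uniformly, and the other has bounded integral by the previous estimate with
  exponent \<open>r / 2\<close>. This handles the bulk and the tails at once.
\<close>

lemma powr_integral_tendsto: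
  fixes p :: "nat \<Rightarrow> 'a::euclidean_space \<Rightarrow> real" and \<phi> :: "'a \<Rightarrow> real"
  assumes r: "0 < r" "r < 1" and a: "0 < a"
    and pm [measurable]: "\<And>n. p n \<in> borel_measurable borel" and \<phi>m [measurable]: "\<phi> \<in> borel_measurable borel"
    and pn: "\<And>n x. 0 \<le> p n x" and \<phi>n: "\<And>x. 0 \<le> \<phi> x"
    and ip: "\<And>n. integrable lborel (\<lambda>x. p n x * exp (a * norm x))"
    and bp: "\<And>n. (\<integral>x. p n x * exp (a * norm x) \<partial>lborel) \<le> C"
    and i\<phi>: "integrable lborel (\<lambda>x. \<phi> x * exp (a * norm x))"
    and close: "\<And>n. AE x in lborel. \<bar>p n x - \<phi> x\<bar> \<le> \<epsilon> n" and \<epsilon>: "\<epsilon> \<longlonglongrightarrow> 0"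
  shows "(\<lambda>n. \<integral>x. p n x powr r \<partial>lborel) \<longlonglongrightarrow> (\<integral>x. \<phi> x powr r \<partial>lborel)"
proof -
  define E where "E = (\<integral>x. exp (- (a * (r / 2)) * norm (x::'a)) \<partial>lborel)"
  define F where "F = (\<integral>x. \<phi> x * exp (a * norm x) \<partial>lborel)"
  have iE: "integrable lborel (\<lambda>x::'a. exp (- (a * (r / 2)) * norm x))"
    using r a by (intro integrable_exp_norm) auto
  have i1: "integrable lborel (\<lambda>x. p n x powr r)" for n
    by (rule integrable_powr_of_exp_moment[OF r a pm pn ip])
  have i2: "integrable lborel (\<lambda>x. \<phi> x powr r)"
    by (rule integrable_powr_of_exp_moment[OF r a \<phi>m \<phi>n i\<phi>])
  let ?W = "\<lambda>n x. \<bar>\<epsilon> n\<bar> powr (r / 2) * (exp (- (a * (r / 2)) * norm x) + (p n x * exp (a * norm x) + \<phi> x * exp (a * norm x)))"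
  have iW: "integrable lborel (?W n)" for n
    using iE ip i\<phi> by (intro integrable_mult_right Bochner_Integration.integrable_add)
  have bound: "\<bar>(\<integral>x. p n x powr r \<partial>lborel) - (\<integral>x. \<phi> x powr r \<partial>lborel)\<bar> \<le> \<bar>\<epsilon> n\<bar> powr (r / 2) * (E + (C + F))" for n
  proof -
    have "\<bar>(\<integral>x. p n x powr r \<partial>lborel) - (\<integral>x. \<phi> x powr r \<partial>lborel)\<bar> =
        \<bar>\<integral>x. p n x powr r - \<phi> x powr r \<partial>lborel\<bar>"
      by (subst Bochner_Integration.integral_diff[OF i1 i2]) simp
    also have "\<dots> \<le> (\<integral>x. \<bar>p n x powr r - \<phi> x powr r\<bar> \<partial>lborel)"
      by (rule integral_abs_bound)
    also have "\<dots> \<le> (\<integral>x. ?W n x \<partial>lborel)"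
    proof (rule integral_mono_AE)
      show "integrable lborel (\<lambda>x. \<bar>p n x powr r - \<phi> x powr r\<bar>)"
        by (intro integrable_abs Bochner_Integration.integrable_diff i1 i2)
      show "AE x in lborel. \<bar>p n x powr r - \<phi> x powr r\<bar> \<le> ?W n x"
        using close[of n]
      proof eventually_elim
        case (elim x)
        define D where "D = \<bar>p n x - \<phi> x\<bar>"
        have D: "0 \<le> D" "D \<le> \<bar>\<epsilon> n\<bar>" "D \<le> p n x + \<phi> x"
          using elim pn[of n x] \<phi>n[of x] by (auto simp: D_def)
        have "\<bar>p n x powr r - \<phi> x powr r\<bar> \<le> D powr r"
          unfolding D_def by (rule abs_powr_diff_le) (use r pn \<phi>n in auto)
        also have "\<dots> = D powr (r / 2) * D powr (r / 2)" by (simp add: powr_add[symmetric])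
        also have "\<dots> \<le> \<bar>\<epsilon> n\<bar> powr (r / 2) * (exp (- (a * (r / 2)) * norm x) + D * exp (a * norm x))"
          using D r a by (intro mult_mono powr_mono2 powr_le_exp_decay_plus_weighted) auto
        also have "\<dots> \<le> ?W n x"
        proof (intro mult_left_mono add_left_mono)
          show "D * exp (a * norm x) \<le> p n x * exp (a * norm x) + \<phi> x * exp (a * norm x)"
            using D(3) by (simp add: distrib_right[symmetric])
        qed simp
        finally show ?case .
      qed
    qed (rule iW)
    also have "\<dots> = \<bar>\<epsilon> n\<bar> powr (r / 2) * (E + ((\<integral>x. p n x * exp (a * norm x) \<partial>lborel) + F))"
      unfolding E_def F_def
      by (simp only: integral_mult_right_zero Bochner_Integration.integral_add[OF iE Bochner_Integration.integrable_add[OF ip i\<phi>]]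
          Bochner_Integration.integral_add[OF ip i\<phi>])
    also have "\<dots> \<le> \<bar>\<epsilon> n\<bar> powr (r / 2) * (E + (C + F))"
      using bp[of n] by (intro mult_left_mono) auto
    finally show ?thesis .
  qed
  have "(\<lambda>n. \<bar>\<epsilon> n\<bar> powr (r / 2)) \<longlonglongrightarrow> 0"
    using tendsto_powr'[OF tendsto_rabs[OF \<epsilon>] tendsto_const[of "r / 2"]] r by simp
  then have "(\<lambda>n. \<bar>\<epsilon> n\<bar> powr (r / 2) * (E + (C + F))) \<longlonglongrightarrow> 0"
    using tendsto_mult_left_zero by blast
  then have "(\<lambda>n. (\<integral>x. p n x powr r \<partial>lborel) - (\<integral>x. \<phi> x powr r \<partial>lborel)) \<longlonglongrightarrow> 0"
    by (rule Lim_null_comparison[OF always_eventually, rule_format, rotated]) (use bound in simp)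
  then show ?thesis by (simp add: LIM_zero_iff)
qed

section \<open>Laws of normalized sums\<close>

lemma log_concave_law:
  fixes f :: "'a::euclidean_space \<Rightarrow> real"
  assumes "prob_space (density lborel f)" "f \<in> borel_measurable borel" "\<And>x. 0 \<le> f x" "log_concave f"
  shows "\<exists>A. \<forall>x. f x \<le> A"
    and "\<exists>\<delta>>0. integrable (density lborel f) (\<lambda>x. exp (\<delta> * norm x))"
proof -
  note f = integral_of_prob_density[OF assms(1-3)]
  obtain A B where B: "0 < B" "\<And>x. f x \<le> A * exp (- B * norm x)"
    using log_concave_exponential_bound[OF assms(4,2,3) f(1)] f(2) by (metis one_neq_zero)
  have A: "0 \<le> A" using B(2)[of 0] assms(3)[of 0] by simp
  have "f x \<le> A" for x
    using B(2)[of x] mult_left_mono[OF _ A, of "exp (- B * norm x)" 1] B(1) by simp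
  then show "\<exists>A. \<forall>x. f x \<le> A" by blast
  show "\<exists>\<delta>>0. integrable (density lborel f) (\<lambda>x. exp (\<delta> * norm x))"
    using exp_moment_of_exponential_bound[OF assms(2,3) B] B(1) by (intro exI[of _ "B / 2"]) auto
qed

lemma (in prob_space) indep_var_sum_euclidean:
  fixes X :: "'i \<Rightarrow> 'a \<Rightarrow> 'b::euclidean_space"
  assumes I: "finite I" "i \<notin> I" and indep: "indep_vars (\<lambda>_. borel) X (insert i I)"
  shows "indep_var borel (X i) borel (\<lambda>\<omega>. \<Sum>i\<in>I. X i \<omega>)"
proof -
  have "indep_var
    borel ((\<lambda>f. f i) \<circ> (\<lambda>\<omega>. restrict (\<lambda>i. X i \<omega>) {i}))
    borel ((\<lambda>f. \<Sum>i\<in>I. f i) \<circ> (\<lambda>\<omega>. restrict (\<lambda>i. X i \<omega>) I))"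
    using I by (intro indep_var_compose[OF indep_var_restrict[OF indep]]) auto
  also have "((\<lambda>f. f i) \<circ> (\<lambda>\<omega>. restrict (\<lambda>i. X i \<omega>) {i})) = X i"
    by auto
  also have "((\<lambda>f. \<Sum>i\<in>I. f i) \<circ> (\<lambda>\<omega>. restrict (\<lambda>i. X i \<omega>) I)) = (\<lambda>\<omega>. \<Sum>i\<in>I. X i \<omega>)"
    by (auto cong: rev_conj_cong)
  finally show ?thesis .
qed

lemma affine_vimage_null_set:
  fixes A :: "'a::euclidean_space set"
  assumes A: "A \<in> null_sets lborel" and c: "c \<noteq> 0"
  shows "(\<lambda>x. t + c *\<^sub>R x) -` A \<in> null_sets lborel"
proof -
  have [measurable]: "A \<in> sets borel" using A by auto
  have "emeasure lborel A = emeasure (density (distr lborel borel (\<lambda>x. t + c *\<^sub>R x)) (\<lambda>_. ennreal (\<bar>c\<bar> ^ DIM('a)))) A"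
    using lborel_affine[OF c, of t] by (simp add: ennreal_power)
  also have "\<dots> = (\<integral>\<^sup>+x. ennreal (\<bar>c\<bar> ^ DIM('a)) * indicator ((\<lambda>x. t + c *\<^sub>R x) -` A) x \<partial>lborel)"
    by (subst emeasure_density) (auto simp: nn_integral_distr indicator_def intro!: nn_integral_cong)
  also have "\<dots> = ennreal (\<bar>c\<bar> ^ DIM('a)) * (\<integral>\<^sup>+x. indicator ((\<lambda>x. t + c *\<^sub>R x) -` A) x \<partial>lborel)"
    by (rule nn_integral_cmult) (auto intro!: borel_measurable_indicator measurable_sets_borel[of _ lborel])
  also have "\<dots> = ennreal (\<bar>c\<bar> ^ DIM('a)) * emeasure lborel ((\<lambda>x. t + c *\<^sub>R x) -` A)"
    by (subst nn_integral_indicator) (auto intro!: measurable_sets_borel[of _ lborel])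
  finally have "emeasure lborel ((\<lambda>x. t + c *\<^sub>R x) -` A) = 0"
    using A c by (auto simp: null_sets_def)
  moreover have "(\<lambda>x. t + c *\<^sub>R x) -` A \<in> sets borel"
    by (auto intro!: measurable_sets_borel[of _ borel])
  ultimately show ?thesis by (auto simp: null_sets_def)
qed

text \<open>
  Condition on \<open>Y\<close>: the event becomes that \<open>X\<close> lies in an affine image of a null set.
\<close>

lemma (in prob_space) absolutely_continuous_scaled_indep_add:
  fixes X Y :: "'a \<Rightarrow> 'b::euclidean_space"
  assumes indep: "indep_var borel X borel Y"
    and ac: "absolutely_continuous lborel (distr M borel X)" and c: "c \<noteq> 0"
  shows "absolutely_continuous lborel (distr M borel (\<lambda>\<omega>. c *\<^sub>R (X \<omega> + Y \<omega>)))"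
  unfolding absolutely_continuous_def
proof
  fix A :: "'b set" assume A: "A \<in> null_sets lborel"
  then have [measurable]: "A \<in> sets borel" by auto
  have rv [measurable]: "random_variable borel X" "random_variable borel Y"
    and joint: "distr M borel X \<Otimes>\<^sub>M distr M borel Y = distr M (borel \<Otimes>\<^sub>M borel) (\<lambda>x. (X x, Y x))"
    using indep by (auto simp: indep_var_distribution_eq)
  interpret X: prob_space "distr M borel X" by (rule prob_space_distr) simp
  interpret Y: prob_space "distr M borel Y" by (rule prob_space_distr) simp
  interpret P: pair_sigma_finite "distr M borel X" "distr M borel Y" ..
  let ?g = "\<lambda>(x, y). indicator A (c *\<^sub>R (x + y)) :: ennreal"
  have g: "?g \<in> borel_measurable (borel \<Otimes>\<^sub>M borel)" by measurable
  have "emeasure (distr M borel (\<lambda>\<omega>. c *\<^sub>R (X \<omega> + Y \<omega>))) A = (\<integral>\<^sup>+\<omega>. ?g (X \<omega>, Y \<omega>) \<partial>M)"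
    by (subst nn_integral_indicator[symmetric], simp, subst nn_integral_distr) auto
  also have "\<dots> = (\<integral>\<^sup>+z. ?g z \<partial>distr M (borel \<Otimes>\<^sub>M borel) (\<lambda>x. (X x, Y x)))"
    by (subst nn_integral_distr) (use g in auto)
  also have "\<dots> = (\<integral>\<^sup>+y. (\<integral>\<^sup>+x. ?g (x, y) \<partial>distr M borel X) \<partial>distr M borel Y)"
    unfolding joint[symmetric] by (rule P.nn_integral_snd[symmetric]) (use g in simp)
  also have "\<dots> = (\<integral>\<^sup>+y. 0 \<partial>distr M borel Y)"
  proof (rule nn_integral_cong)
    fix y
    have "(\<lambda>x. c *\<^sub>R y + c *\<^sub>R x) -` A \<in> null_sets (distr M borel X)"
      using affine_vimage_null_set[OF A c] ac unfolding absolutely_continuous_def by blast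
    then have "AE x in distr M borel X. x \<notin> (\<lambda>x. c *\<^sub>R y + c *\<^sub>R x) -` A" by (rule AE_not_in)
    then show "(\<integral>\<^sup>+x. ?g (x, y) \<partial>distr M borel X) = 0"
      by (subst nn_integral_0_iff_AE) (auto simp: scaleR_add_right add.commute indicator_def)
  qed
  finally show "A \<in> null_sets (distr M borel (\<lambda>\<omega>. c *\<^sub>R (X \<omega> + Y \<omega>)))"
    by (simp add: null_sets_def)
qed

text \<open>
  The entropy is defined through the real-valued version of a Radon--Nikodym derivative; it is
  still a density because the derivative is finite almost everywhere.
\<close>

lemma RN_density_real:
  fixes \<mu> :: "'a::euclidean_space measure"
  assumes \<mu>: "prob_space \<mu>" and sets: "sets \<mu> = sets borel" and ac: "absolutely_continuous lborel \<mu>"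
  shows "density lborel (\<lambda>x. ennreal (enn2real (RN_deriv lborel \<mu> x))) = \<mu>"
proof -
  interpret prob_space \<mu> by fact
  have "AE x in lborel. RN_deriv lborel \<mu> x \<noteq> \<infinity>"
    by (rule sigma_finite_measure.RN_deriv_finite[OF sigma_finite_lborel _ ac])
       (simp_all add: sets sigma_finite_measure_axioms)
  then have "density lborel (\<lambda>x. ennreal (enn2real (RN_deriv lborel \<mu> x))) = density lborel (RN_deriv lborel \<mu>)"
    by (intro density_cong) (auto elim!: eventually_mono simp: less_top)
  also have "\<dots> = \<mu>"
    by (rule sigma_finite_measure.density_RN_deriv[OF sigma_finite_lborel ac]) (simp add: sets)
  finally show ?thesis .
qed

lemma (in prob_space) charf_scaled_iid_sum:
  fixes X :: "nat \<Rightarrow> 'a \<Rightarrow> 'b::euclidean_space"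
  assumes indep: "indep_vars (\<lambda>_. borel) X {1..}"
    and same: "\<And>i. 1 \<le> i \<Longrightarrow> distr M borel (X i) = \<mu>"
  shows "charf (distr M borel (\<lambda>\<omega>. c *\<^sub>R (\<Sum>i = 1..n. X i \<omega>))) t = charf \<mu> (c *\<^sub>R t) ^ n"
proof -
  have rv [measurable]: "random_variable borel (X i)" if "1 \<le> i" for i
    using indep that by (auto simp: indep_vars_def)
  have meas: "(\<lambda>\<omega>. c *\<^sub>R (\<Sum>i = 1..n. X i \<omega>)) \<in> measurable M borel"
    by (intro borel_measurable_scaleR borel_measurable_const borel_measurable_sum rv) simp
  let ?Y = "\<lambda>i \<omega>. iexp ((c *\<^sub>R t) \<bullet> X i \<omega>)"
  have indY: "indep_vars (\<lambda>_. borel) ?Y {1..n}"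
    by (rule indep_vars_compose2[OF indep_vars_subset[OF indep]]) auto
  have intY: "integrable M (?Y i)" if "i \<in> {1..n}" for i
    using rv[of i] that by (intro integrable_const_bound[where B=1]) auto
  have "charf (distr M borel (\<lambda>\<omega>. c *\<^sub>R (\<Sum>i = 1..n. X i \<omega>))) t = (CLINT \<omega>|M. iexp (t \<bullet> (c *\<^sub>R (\<Sum>i = 1..n. X i \<omega>))))"
    unfolding charf_def by (subst integral_distr[OF meas]) simp_all
  also have "\<dots> = (CLINT \<omega>|M. \<Prod>i = 1..n. ?Y i \<omega>)"
    by (simp add: inner_sum_right exp_sum[symmetric] sum_distrib_left)
  also have "\<dots> = (\<Prod>i = 1..n. CLINT \<omega>|M. ?Y i \<omega>)"
    by (rule indep_vars_lebesgue_integral[OF _ indY intY]) simp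
  also have "\<dots> = (\<Prod>i = 1..n. charf \<mu> (c *\<^sub>R t))"
  proof (rule prod.cong[OF refl])
    fix i assume "i \<in> {1..n}"
    then have i: "1 \<le> i" by simp
    show "(CLINT \<omega>|M. ?Y i \<omega>) = charf \<mu> (c *\<^sub>R t)"
      unfolding same[OF i, symmetric] charf_def using rv[OF i] by (subst integral_distr) simp_all
  qed
  finally show ?thesis by simp
qed

text \<open>
  The exponential moment of one coordinate of the normalized sum is an \<open>n\<close>-th power of the moment
  of a summand at argument \<open>\<delta> / sqrt n\<close>, hence bounded independently of \<open>n\<close>.
\<close>

lemma (in prob_space) exp_moment_normalized_sum:
  fixes X :: "nat \<Rightarrow> 'a \<Rightarrow> 'b::euclidean_space"
  assumes indep: "indep_vars (\<lambda>_. borel) X {1..}"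
    and same: "\<And>i. 1 \<le> i \<Longrightarrow> distr M borel (X i) = \<mu>"
    and int: "integrable \<mu> (\<lambda>x. exp (2 * \<delta> * norm x))" and \<delta>: "0 < \<delta>"
    and mean: "\<And>t. (\<integral>x. t \<bullet> x \<partial>\<mu>) = 0"
  defines "Z \<equiv> \<lambda>n \<omega>. (1 / sqrt (real n)) *\<^sub>R (\<Sum>i = 1..n. X i \<omega>)"
  shows "\<exists>C. \<forall>n\<ge>1. integrable M (\<lambda>\<omega>. exp (\<delta> / DIM('b) * norm (Z n \<omega>))) \<and>
      (\<integral>\<omega>. exp (\<delta> / DIM('b) * norm (Z n \<omega>)) \<partial>M) \<le> C"
proof -
  have rv [measurable]: "random_variable borel (X i)" if "1 \<le> i" for i
    using indep that by (auto simp: indep_vars_def)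
  have meas: "Z n \<in> measurable M borel" for n unfolding Z_def
    by (intro borel_measurable_scaleR borel_measurable_const borel_measurable_sum rv) simp
  have sets: "sets \<mu> = sets borel" using same[of 1] by auto
  have \<mu>: "prob_space \<mu>" unfolding same[OF order_refl, symmetric] by (rule prob_space_distr) (rule rv, simp)
  define K where "K = (\<integral>x. (norm x)\<^sup>2 * exp (\<delta> * norm x) \<partial>\<mu>)"
  have one: "integrable M (\<lambda>\<omega>. exp (s * (b \<bullet> Z n \<omega>)))" "(\<integral>\<omega>. exp (s * (b \<bullet> Z n \<omega>)) \<partial>M) \<le> exp (\<delta>\<^sup>2 * K)"
    if n: "1 \<le> n" and b: "norm b = 1" and s: "\<bar>s\<bar> = \<delta>" for n b s
  proof -
    define u where "u = s / sqrt (real n)"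
    have u: "\<bar>u\<bar> \<le> \<delta>" "u\<^sup>2 * real n = \<delta>\<^sup>2"
    proof -
      have "1 \<le> sqrt (real n)" using n by simp
      then show "\<bar>u\<bar> \<le> \<delta>" using s \<delta> by (simp add: u_def abs_divide field_simps mult_le_cancel_left1)
      have "s\<^sup>2 = \<delta>\<^sup>2" using s by (metis power2_abs)
      then show "u\<^sup>2 * real n = \<delta>\<^sup>2" using n by (simp add: u_def power_divide)
    qed
    note mgf = mgf_subgaussian_near_zero[OF \<mu> sets int \<delta> b mean u(1)]
    let ?Y = "\<lambda>i \<omega>. exp (u * (b \<bullet> X i \<omega>))"
    have indY: "indep_vars (\<lambda>_. borel) ?Y {1..n}"
      by (rule indep_vars_compose2[OF indep_vars_subset[OF indep]]) auto
    have intY: "integrable M (?Y i)" "(\<integral>\<omega>. ?Y i \<omega> \<partial>M) = (\<integral>x. exp (u * (b \<bullet> x)) \<partial>\<mu>)" if "i \<in> {1..n}" for i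
    proof -
      have i: "1 \<le> i" using that by simp
      show "integrable M (?Y i)"
        using mgf(1) unfolding same[OF i, symmetric] using rv[OF i] by (subst (asm) integrable_distr_eq) auto
      show "(\<integral>\<omega>. ?Y i \<omega> \<partial>M) = (\<integral>x. exp (u * (b \<bullet> x)) \<partial>\<mu>)"
        unfolding same[OF i, symmetric] using rv[OF i] by (subst integral_distr) auto
    qed
    have eq: "exp (s * (b \<bullet> Z n \<omega>)) = (\<Prod>i = 1..n. ?Y i \<omega>)" for \<omega>
      by (simp add: Z_def u_def inner_sum_right exp_sum[symmetric] sum_distrib_left sum_divide_distrib)
    show "integrable M (\<lambda>\<omega>. exp (s * (b \<bullet> Z n \<omega>)))"
      unfolding eq by (rule indep_vars_integrable[OF _ indY intY(1)]) simp
    have "(\<integral>\<omega>. exp (s * (b \<bullet> Z n \<omega>)) \<partial>M) = (\<Prod>i = 1..n. \<integral>\<omega>. ?Y i \<omega> \<partial>M)"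
      unfolding eq by (rule indep_vars_lebesgue_integral[OF _ indY intY(1)]) simp
    also have "\<dots> = (\<integral>x. exp (u * (b \<bullet> x)) \<partial>\<mu>) ^ n"
      using intY(2) by simp
    also have "\<dots> \<le> exp (u\<^sup>2 * K) ^ n"
      unfolding K_def by (intro power_mono mgf(2)) simp
    also have "\<dots> = exp (\<delta>\<^sup>2 * K)"
      using u(2) by (simp add: exp_of_nat_mult[symmetric] mult_ac)
    finally show "(\<integral>\<omega>. exp (s * (b \<bullet> Z n \<omega>)) \<partial>M) \<le> exp (\<delta>\<^sup>2 * K)" .
  qed
  let ?S = "\<lambda>n \<omega>. \<Sum>b\<in>Basis. exp (\<delta> * (b \<bullet> Z n \<omega>)) + exp (- \<delta> * (b \<bullet> Z n \<omega>))"
  let ?C = "real DIM('b) * (2 * exp (\<delta>\<^sup>2 * K))"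
  have "integrable M (\<lambda>\<omega>. exp (\<delta> / DIM('b) * norm (Z n \<omega>))) \<and>
      (\<integral>\<omega>. exp (\<delta> / DIM('b) * norm (Z n \<omega>)) \<partial>M) \<le> ?C" if n: "1 \<le> n" for n
  proof
    have i: "integrable M (\<lambda>\<omega>. exp (\<delta> * (b \<bullet> Z n \<omega>)))" "integrable M (\<lambda>\<omega>. exp (- \<delta> * (b \<bullet> Z n \<omega>)))"
      if "b \<in> Basis" for b
      using one(1)[OF n, of b \<delta>] one(1)[OF n, of b "- \<delta>"] \<delta> that by auto
    have iS: "integrable M (?S n)"
      using i by (intro Bochner_Integration.integrable_sum Bochner_Integration.integrable_add)
    have le: "exp (\<delta> / DIM('b) * norm (Z n \<omega>)) \<le> ?S n \<omega>" for \<omega>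
      using \<delta> by (intro exp_norm_le_sum_Basis) simp
    show "integrable M (\<lambda>\<omega>. exp (\<delta> / DIM('b) * norm (Z n \<omega>)))"
      by (rule Bochner_Integration.integrable_bound[OF iS])
         (use le meas[of n] in \<open>auto intro!: AE_I2 order_trans[OF _ abs_ge_self]\<close>)
    have "(\<integral>\<omega>. exp (\<delta> / DIM('b) * norm (Z n \<omega>)) \<partial>M) \<le> (\<integral>\<omega>. ?S n \<omega> \<partial>M)"
      by (intro integral_mono' iS le) (auto intro!: sum_nonneg add_nonneg_nonneg)
    also have "\<dots> = (\<Sum>b\<in>Basis. (\<integral>\<omega>. exp (\<delta> * (b \<bullet> Z n \<omega>)) \<partial>M) + (\<integral>\<omega>. exp (- \<delta> * (b \<bullet> Z n \<omega>)) \<partial>M))"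
      using i by (subst Bochner_Integration.integral_sum)
        (auto intro!: Bochner_Integration.integrable_add sum.cong Bochner_Integration.integral_add)
    also have "\<dots> \<le> (\<Sum>b\<in>(Basis :: 'b set). exp (\<delta>\<^sup>2 * K) + exp (\<delta>\<^sup>2 * K))"
      using one(2)[OF n, of _ \<delta>] one(2)[OF n, of _ "- \<delta>"] \<delta> by (intro sum_mono add_mono) auto
    finally show "(\<integral>\<omega>. exp (\<delta> / DIM('b) * norm (Z n \<omega>)) \<partial>M) \<le> ?C" by simp
  qed
  then show ?thesis by blast
qed

text \<open>
  The limiting characteristic function depends on the law only through these second moments, so
  equality of covariance matrices identifies the limit with the Gaussian law.
\<close>

lemma (in prob_space) second_moment_eq_covariance:
  fixes X :: "'a \<Rightarrow> real ^ 'd"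
  assumes [measurable]: "random_variable borel X" and int: "integrable M (\<lambda>\<omega>. (norm (X \<omega>))\<^sup>2)"
    and centered: "centered_vector M X"
  shows "(\<integral>\<omega>. (t \<bullet> X \<omega>)\<^sup>2 \<partial>M) = (\<Sum>i\<in>UNIV. \<Sum>j\<in>UNIV. t $ i * t $ j * covariance_matrix M X $ i $ j)"
proof -
  have iX: "integrable M X" "(\<integral>\<omega>. X \<omega> \<partial>M) = 0" using centered by (auto simp: centered_vector_def)
  have comp: "(\<integral>\<omega>. X \<omega> $ i \<partial>M) = 0" for i
  proof -
    have "(\<integral>\<omega>. X \<omega> \<bullet> axis i 1 \<partial>M) = (\<integral>\<omega>. X \<omega> \<partial>M) \<bullet> axis i 1"
      by (rule integral_inner_left) (use iX in simp)
    then show ?thesis by (simp add: iX inner_axis)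
  qed
  have comp_meas: "(\<lambda>\<omega>. X \<omega> $ i) \<in> borel_measurable M" for i
  proof -
    have "(\<lambda>\<omega>. X \<omega> \<bullet> axis i 1) \<in> borel_measurable M" by measurable
    then show ?thesis by (simp add: inner_axis)
  qed
  have int2: "integrable M (\<lambda>\<omega>. X \<omega> $ i * X \<omega> $ j)" for i j
  proof (rule Bochner_Integration.integrable_bound[OF int])
    show "(\<lambda>\<omega>. X \<omega> $ i * X \<omega> $ j) \<in> borel_measurable M"
      using comp_meas[of i] comp_meas[of j] by simp
    show "AE \<omega> in M. norm (X \<omega> $ i * X \<omega> $ j) \<le> norm ((norm (X \<omega>))\<^sup>2)"
      by (intro AE_I2) (auto simp: abs_mult power2_eq_square intro!: mult_mono component_le_norm_cart)
  qed
  have "(\<integral>\<omega>. (t \<bullet> X \<omega>)\<^sup>2 \<partial>M) = (\<integral>\<omega>. (\<Sum>i\<in>UNIV. \<Sum>j\<in>UNIV. t $ i * t $ j * (X \<omega> $ i * X \<omega> $ j)) \<partial>M)"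
    by (simp add: inner_vec_def power2_eq_square sum_product mult_ac)
  also have "\<dots> = (\<Sum>i\<in>UNIV. \<Sum>j\<in>UNIV. t $ i * t $ j * (\<integral>\<omega>. X \<omega> $ i * X \<omega> $ j \<partial>M))"
    using int2 by (simp add: Bochner_Integration.integral_sum)
  finally show ?thesis by (simp add: covariance_matrix_def comp)
qed

section \<open>Gaussian vectors\<close>

lemma quadratic_form_parallelogram:
  fixes T :: "real ^ 'd ^ 'd"
  shows "(a + b) \<bullet> (T *v (a + b)) + (a - b) \<bullet> (T *v (a - b)) = 2 * (a \<bullet> (T *v a)) + 2 * (b \<bullet> (T *v b))"
  by (simp add: matrix_vector_right_distrib matrix_vector_mult_diff_distrib inner_add_left inner_diff_left
      inner_add_right inner_diff_right)

lemma quadratic_form_scale: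
  fixes T :: "real ^ 'd ^ 'd"
  shows "(k *\<^sub>R a) \<bullet> (T *v (k *\<^sub>R a)) = k\<^sup>2 * (a \<bullet> (T *v a))"
  by (simp add: linear_scale[OF matrix_vector_mul_linear] power2_eq_square)

lemma quadratic_form_convex:
  fixes T :: "real ^ 'd ^ 'd"
  assumes nonneg: "\<And>a. 0 \<le> a \<bullet> (T *v a)" and t: "0 \<le> t" "t \<le> 1"
  shows "((1 - t) *\<^sub>R a + t *\<^sub>R b) \<bullet> (T *v ((1 - t) *\<^sub>R a + t *\<^sub>R b)) \<le> (1 - t) * (a \<bullet> (T *v a)) + t * (b \<bullet> (T *v b))"
proof -
  let ?B = "\<lambda>x y. x \<bullet> (T *v y)"
  have "?B ((1 - t) *\<^sub>R a + t *\<^sub>R b) ((1 - t) *\<^sub>R a + t *\<^sub>R b) =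
      (1 - t)\<^sup>2 * ?B a a + t\<^sup>2 * ?B b b + t * (1 - t) * (?B a b + ?B b a)"
    by (simp add: matrix_vector_right_distrib linear_scale[OF matrix_vector_mul_linear] inner_add_left
        inner_add_right power2_eq_square algebra_simps)
  also have "\<dots> = (1 - t) * ?B a a + t * ?B b b - t * (1 - t) * ?B (a - b) (a - b)"
    by (simp add: matrix_vector_mult_diff_distrib inner_diff_left inner_diff_right power2_eq_square algebra_simps)
  also have "\<dots> \<le> (1 - t) * ?B a a + t * ?B b b"
    using nonneg[of "a - b"] t by simp
  finally show ?thesis .
qed

text \<open>
  Substitute \<open>y = S *v z\<close>: positive definiteness makes \<open>S\<close> invertible, and the value becomes that of
  the form of \<open>S\<close> at \<open>z\<close>.
\<close>

lemma quadratic_form_matrix_inv_nonneg: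
  fixes S :: "real ^ 'd ^ 'd"
  assumes pos: "\<And>x. x \<noteq> 0 \<Longrightarrow> x \<bullet> (S *v x) > 0"
  shows "0 \<le> y \<bullet> (matrix_inv S *v y)"
proof -
  have "inj ((*v) S)"
    unfolding linear_injective_0[OF matrix_vector_mul_linear]
  proof (intro allI impI)
    fix x assume "S *v x = 0"
    then show "x = 0" using pos[of x] by (cases "x = 0") auto
  qed
  then have "invertible S"
    using invertible_left_inverse matrix_left_invertible_injective by blast
  then have "S ** matrix_inv S = mat 1" unfolding invertible_def matrix_inv_def by (rule someI2_ex) simp
  then have y: "S *v (matrix_inv S *v y) = y" by (simp add: matrix_vector_mul_assoc)
  define z where "z = matrix_inv S *v y"
  have "0 \<le> z \<bullet> (S *v z)" using pos[of z] by (cases "z = 0") auto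
  then show ?thesis using y by (simp add: z_def inner_commute)
qed

lemma quadratic_form_measurable [measurable]:
  fixes T :: "real ^ 'd ^ 'd"
  shows "(\<lambda>a. a \<bullet> (T *v a)) \<in> borel_measurable borel"
  by (intro borel_measurable_continuous_onI continuous_intros linear_continuous_on matrix_vector_mul_bounded_linear)

lemma log_concave_exp_convex:
  assumes c: "0 \<le> c"
    and convex: "\<And>t a b. 0 \<le> t \<Longrightarrow> t \<le> 1 \<Longrightarrow> Q ((1 - t) *\<^sub>R a + t *\<^sub>R b) \<le> (1 - t) * Q a + t * Q b"
  shows "log_concave (\<lambda>x. c * exp (- Q x / 2))"
  unfolding log_concave_def
proof (intro allI ballI impI)
  fix x y and t :: real assume t: "t \<in> {0<..<1}"
    and "0 < c * exp (- Q x / 2) * (c * exp (- Q y / 2))"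
  then have c: "0 < c" using c by (cases "c = 0") auto
  have "(c * exp (- Q x / 2)) powr (1 - t) * (c * exp (- Q y / 2)) powr t =
     exp ((1 - t) * (ln c - Q x / 2) + t * (ln c - Q y / 2))"
    using c by (simp add: powr_def ln_mult exp_add)
  also have "\<dots> = exp (ln c - ((1 - t) * Q x + t * Q y) / 2)" by (simp add: field_simps)
  also have "\<dots> \<le> exp (ln c - Q ((1 - t) *\<^sub>R x + t *\<^sub>R y) / 2)"
    using convex[of t x y] t by simp
  also have "\<dots> = c * exp (- Q ((1 - t) *\<^sub>R x + t *\<^sub>R y) / 2)"
    using c exp_add[of "ln c" "- Q ((1 - t) *\<^sub>R x + t *\<^sub>R y) / 2"] by simp
  finally show "(c * exp (- Q x / 2)) powr (1 - t) * (c * exp (- Q y / 2)) powr t \<le> c * exp (- Q ((1 - t) *\<^sub>R x + t *\<^sub>R y) / 2)" .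
qed

lemma distr_lborel_eq_borel: "distr M lborel X = distr M borel X"
  by (rule distr_cong) auto

text \<open>
  Reflection in \<open>m\<close> preserves the law and maps the mean \<open>e\<close> to \<open>2 * m - e\<close>.
\<close>

lemma mean_of_symmetric_density:
  fixes \<phi> :: "'a::euclidean_space \<Rightarrow> real"
  assumes "prob_space (density lborel \<phi>)" and [measurable]: "\<phi> \<in> borel_measurable borel" and nonneg: "\<And>x. 0 \<le> \<phi> x"
    and int: "integrable (density lborel \<phi>) (\<lambda>x. x)" and sym: "\<And>x. \<phi> (2 *\<^sub>R m - x) = \<phi> x"
  shows "(\<integral>x. x \<partial>density lborel \<phi>) = m"
proof -
  note p = integral_of_prob_density[OF assms(1-3)]
  have i: "integrable lborel (\<lambda>x. \<phi> x *\<^sub>R x)"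
    using int nonneg by (subst (asm) integrable_density) auto
  have eq: "(\<integral>x. x \<partial>density lborel \<phi>) = (\<integral>x. \<phi> x *\<^sub>R x \<partial>lborel)"
    using nonneg by (subst integral_density) auto
  also have "\<dots> = (\<integral>x. \<phi> (2 *\<^sub>R m + (-1) *\<^sub>R x) *\<^sub>R (2 *\<^sub>R m + (-1) *\<^sub>R x) \<partial>lborel)"
    by (subst lborel_affine_substitution(2)[where c="-1" and t="2 *\<^sub>R m"]) auto
  also have "\<dots> = (\<integral>x. \<phi> x *\<^sub>R (2 *\<^sub>R m) - \<phi> x *\<^sub>R x \<partial>lborel)"
    using sym by (simp add: scaleR_diff_right)
  also have "\<dots> = (\<integral>x. \<phi> x *\<^sub>R (2 *\<^sub>R m) \<partial>lborel) - (\<integral>x. \<phi> x *\<^sub>R x \<partial>lborel)"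
    by (rule Bochner_Integration.integral_diff) (use p i in auto)
  also have "(\<integral>x. \<phi> x *\<^sub>R (2 *\<^sub>R m) \<partial>lborel) = 2 *\<^sub>R m"
    using p by (simp del: scaleR_scaleR)
  finally have "2 *\<^sub>R (\<integral>x. x \<partial>density lborel \<phi>) = 2 *\<^sub>R m"
    unfolding eq by (simp only: scaleR_2 eq_diff_eq)
  then show ?thesis by simp
qed

text \<open>
  A density symmetric about \<open>m\<close> has mean \<open>m\<close>, so a centred Gaussian vector has \<open>m = 0\<close>. The
  normalizing factor \<open>c\<close> is nonnegative because a negative value would give a law of mass zero.
\<close>

lemma centered_gaussian_law:
  fixes Z :: "'b \<Rightarrow> real ^ 'd"
  assumes N: "prob_space N" and gauss: "gaussian_vector N Z" and centered: "centered_vector N Z"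
  shows "\<exists>c T. distr N borel Z = density lborel (\<lambda>x. ennreal (c * exp (- (x \<bullet> (T *v x)) / 2))) \<and>
     0 \<le> c \<and> (\<forall>x. 0 \<le> x \<bullet> (T *v x))"
proof -
  interpret prob_space N by fact
  obtain m S where S: "\<And>x. x \<noteq> 0 \<Longrightarrow> x \<bullet> (S *v x) > 0"
    and distr: "distributed N lborel Z (\<lambda>x. ennreal (gaussian_density m S x))"
    using gauss unfolding gaussian_vector_def by blast
  have law: "distr N borel Z = density lborel (\<lambda>x. ennreal (gaussian_density m S x))"
    and rv [measurable]: "random_variable borel Z"
    using distr by (auto simp: distributed_def distr_lborel_eq_borel)
  interpret \<nu>: prob_space "distr N borel Z" by (rule prob_space_distr) (rule rv)
  define T where "T = matrix_inv S"
  define c where "c = 1 / sqrt ((2 * pi) ^ CARD('d) * det S)"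
  have dens: "gaussian_density m S x = c * exp (- ((x - m) \<bullet> (T *v (x - m))) / 2)" for x
    by (simp add: gaussian_density_def c_def T_def)
  have T: "0 \<le> x \<bullet> (T *v x)" for x
    unfolding T_def by (rule quadratic_form_matrix_inv_nonneg[OF S])
  have c: "0 \<le> c"
  proof (rule ccontr)
    assume "\<not> 0 \<le> c"
    then have "ennreal (gaussian_density m S x) = 0" for x
      by (simp add: dens ennreal_eq_0_iff mult_nonpos_nonneg)
    then have "emeasure (distr N borel Z) UNIV = 0"
      unfolding law by (simp add: emeasure_density)
    then show False using \<nu>.emeasure_space_1 by simp
  qed
  have int: "integrable (distr N borel Z) (\<lambda>x. x)" "(\<integral>x. x \<partial>distr N borel Z) = 0"
    using centered by (auto simp: centered_vector_def integrable_distr_eq integral_distr)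
  have [measurable]: "gaussian_density m S \<in> borel_measurable borel"
    unfolding dens using measurable_compose[OF _ quadratic_form_measurable[of T], of "\<lambda>x. x - m" borel] by simp
  have "(\<integral>x. x \<partial>distr N borel Z) = m"
    unfolding law
  proof (rule mean_of_symmetric_density)
    show "prob_space (density lborel (\<lambda>x. ennreal (gaussian_density m S x)))"
      using \<nu>.prob_space_axioms unfolding law .
    show "integrable (density lborel (\<lambda>x. ennreal (gaussian_density m S x))) (\<lambda>x. x)"
      using int(1) unfolding law .
    show "gaussian_density m S (2 *\<^sub>R m - x) = gaussian_density m S x" for x
    proof -
      have "2 *\<^sub>R m - x - m = (- 1) *\<^sub>R (x - m)" by (simp add: scaleR_2)
      then show ?thesis unfolding dens by (simp only: quadratic_form_scale) simp
    qed
  qed (use c in \<open>auto simp: dens\<close>)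
  then have "m = 0" using int(2) by simp
  then have "distr N borel Z = density lborel (\<lambda>x. ennreal (c * exp (- (x \<bullet> (T *v x)) / 2)))"
    unfolding law dens by simp
  then show ?thesis using c T by blast
qed

section \<open>Convergence of Renyi entropies\<close>

lemma renyi_entropy_eq_law:
  "renyi_entropy r M X = ereal (1 / (1 - r)) *
     ln_ennreal (\<integral>\<^sup>+ x. ennreal (enn2real (RN_deriv lborel (distr M borel X) x) powr r) \<partial>lborel)"
  by (simp add: renyi_entropy_def distr_lborel_eq_borel)

lemma renyi_entropy_of_integrable:
  fixes M :: "'a measure" and X :: "'a \<Rightarrow> real ^ 'd"
  defines "p \<equiv> \<lambda>x. enn2real (RN_deriv lborel (distr M borel X) x)"
  assumes r: "r < 1" and int: "integrable lborel (\<lambda>x. p x powr r)"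
  shows "renyi_entropy r M X < \<infinity>"
    and "0 < (\<integral>x. p x powr r \<partial>lborel) \<Longrightarrow>
      renyi_entropy r M X = ereal (1 / (1 - r) * ln (\<integral>x. p x powr r \<partial>lborel))"
proof -
  have "(\<integral>\<^sup>+ x. ennreal (p x powr r) \<partial>lborel) = ennreal (\<integral>x. p x powr r \<partial>lborel)"
    by (rule nn_integral_eq_integral[OF int]) simp
  then have eq: "renyi_entropy r M X = ereal (1 / (1 - r)) * ln_ennreal (ennreal (\<integral>x. p x powr r \<partial>lborel))"
    unfolding renyi_entropy_eq_law p_def by simp
  have nonneg: "0 \<le> (\<integral>x. p x powr r \<partial>lborel)" by simp
  show pos: "renyi_entropy r M X = ereal (1 / (1 - r) * ln (\<integral>x. p x powr r \<partial>lborel))" if "0 < (\<integral>x. p x powr r \<partial>lborel)"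
    using that unfolding eq ln_ennreal_def by simp
  show "renyi_entropy r M X < \<infinity>"
  proof (cases "0 < (\<integral>x. p x powr r \<partial>lborel)")
    case True then show ?thesis using pos by simp
  next
    case False
    then have "(\<integral>x. p x powr r \<partial>lborel) = 0" using nonneg by linarith
    then show ?thesis using r unfolding eq ln_ennreal_def by simp
  qed
qed

theorem theorem7:
  fixes r :: real
    and M :: "'a measure" and X :: "nat \<Rightarrow> 'a \<Rightarrow> real ^ 'd"
    and N :: "'b measure" and Z :: "'b \<Rightarrow> real ^ 'd"
  assumes "0 < r" and "r < 1"
    and "prob_space M"
    and "prob_space.indep_vars M (\<lambda>_. borel) X {1..}"
    and "\<And>i. i \<ge> 1 \<Longrightarrow> distr M borel (X i) = distr M borel (X 1)"
    and "\<And>i. i \<ge> 1 \<Longrightarrow> centered_vector M (X i)"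
    and "\<And>i. i \<ge> 1 \<Longrightarrow> log_concave_vector M (X i)"
    and "prob_space N"
    and "gaussian_vector N Z"
    and "centered_vector N Z"
    and "covariance_matrix N Z = covariance_matrix M (X 1)"
  shows "(\<forall>n\<ge>1. has_lborel_density M (normalized_sum X n) \<and>
                 renyi_entropy r M (normalized_sum X n) < \<infinity>) \<and>
         (\<lambda>n. renyi_entropy r M (normalized_sum X n)) \<longlonglongrightarrow> renyi_entropy r N Z"
proof -
  interpret M: prob_space M by fact
  interpret N: prob_space N by fact
  note r = \<open>0 < r\<close> \<open>r < 1\<close>
  have indep: "M.indep_vars (\<lambda>_. borel) X {1..}" by fact
  have rv: "M.random_variable borel (X i)" if "1 \<le> i" for i
    using indep that by (auto simp: M.indep_vars_def)
  have rv1 [measurable]: "M.random_variable borel (X 1)" by (rule rv) simp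
  define \<mu> where "\<mu> = distr M borel (X 1)"
  have same: "distr M borel (X i) = \<mu>" if "1 \<le> i" for i
    unfolding \<mu>_def using assms(5) that by blast
  have \<mu>: "prob_space \<mu>" unfolding \<mu>_def by (rule M.prob_space_distr) (rule rv1)
  have sets\<mu>: "sets \<mu> = sets borel" by (simp add: \<mu>_def)
  obtain f :: "real ^ 'd \<Rightarrow> real" where f0: "\<And>x. 0 \<le> f x"
    and fd: "distributed M lborel (X 1) (\<lambda>x. ennreal (f x))" and flc: "log_concave f"
    using assms(7)[of 1] unfolding log_concave_vector_def log_concave_def by auto
  have \<mu>_eq: "\<mu> = density lborel (\<lambda>x. ennreal (f x))"
    using fd by (simp add: distributed_def \<mu>_def distr_lborel_eq_borel)
  have fm: "f \<in> borel_measurable borel"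
  proof -
    have "(\<lambda>x. enn2real (ennreal (f x))) \<in> borel_measurable borel"
      using fd by (intro borel_measurable_enn2real) (simp add: distributed_def)
    then show ?thesis using f0 by simp
  qed
  obtain A where A: "\<And>x. f x \<le> A"
    using log_concave_law(1)[OF \<mu>[unfolded \<mu>_eq] fm f0 flc] by blast
  obtain \<delta>\<^sub>0 where \<delta>\<^sub>0: "0 < \<delta>\<^sub>0" "integrable \<mu> (\<lambda>x. exp (\<delta>\<^sub>0 * norm x))"
    using log_concave_law(2)[OF \<mu>[unfolded \<mu>_eq] fm f0 flc] unfolding \<mu>_eq by blast
  define \<delta> where "\<delta> = \<delta>\<^sub>0 / 2"
  have \<delta>: "0 < \<delta>" "integrable \<mu> (\<lambda>x. exp (2 * \<delta> * norm x))" using \<delta>\<^sub>0 by (simp_all add: \<delta>_def)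
  have moments: "integrable \<mu> (\<lambda>x. norm x ^ k)" for k
    using integrable_power_times_exp[OF sets\<mu> \<delta>\<^sub>0(2), of 0 k] \<delta>\<^sub>0(1) by simp
  have mean: "(\<integral>x. t \<bullet> x \<partial>\<mu>) = 0" for t
  proof -
    have "integrable M (X 1)" "(\<integral>\<omega>. X 1 \<omega> \<partial>M) = 0"
      using assms(6)[of 1] by (auto simp: centered_vector_def)
    then have "(\<integral>\<omega>. t \<bullet> X 1 \<omega> \<partial>M) = 0" by (subst integral_inner_right) auto
    then show ?thesis
      unfolding \<mu>_def by (subst integral_distr[OF rv1]) auto
  qed
  let ?Z = "normalized_sum X"
  have Z_eq: "?Z n = (\<lambda>\<omega>. (1 / sqrt (real n)) *\<^sub>R (\<Sum>i = 1..n. X i \<omega>))" for n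
    by (simp add: normalized_sum_def fun_eq_iff)
  have rvZ: "M.random_variable borel (?Z n)" for n
    unfolding Z_eq by (intro borel_measurable_scaleR borel_measurable_const borel_measurable_sum rv) simp
  define \<mu>s where "\<mu>s n = distr M borel (?Z n)" for n
  have \<mu>s: "prob_space (\<mu>s n)" "sets (\<mu>s n) = sets borel" for n
    unfolding \<mu>s_def by (auto intro!: M.prob_space_distr rvZ)
  define p where "p n x = enn2real (RN_deriv lborel (\<mu>s n) x)" for n x
  have pm [measurable]: "p n \<in> borel_measurable borel" for n
    unfolding p_def using borel_measurable_RN_deriv[of lborel "\<mu>s n"] by simp
  have p0: "0 \<le> p n x" for n x by (simp add: p_def)
  \<comment> \<open>A single summand with a density suffices for the sum to have one.\<close>
  have ac: "absolutely_continuous lborel (\<mu>s n)" if n: "1 \<le> n" for n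
  proof -
    have "insert 1 {2..n} \<subseteq> {1..}" by auto
    then have "M.indep_vars (\<lambda>_. borel) X (insert 1 {2..n})" by (rule M.indep_vars_subset[OF indep])
    then have ind: "M.indep_var borel (X 1) borel (\<lambda>\<omega>. \<Sum>i = 2..n. X i \<omega>)"
      by (rule M.indep_var_sum_euclidean[rotated 2]) simp_all
    have ac1: "absolutely_continuous lborel (distr M borel (X 1))"
      unfolding \<mu>_def[symmetric] \<mu>_eq by (rule absolutely_continuousI_density) (use fm in simp)
    have "1 / sqrt (real n) \<noteq> 0" using n by simp
    then have "absolutely_continuous lborel (distr M borel (\<lambda>\<omega>. (1 / sqrt (real n)) *\<^sub>R (X 1 \<omega> + (\<Sum>i = 2..n. X i \<omega>))))"
      by (rule M.absolutely_continuous_scaled_indep_add[OF ind ac1])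
    moreover have "{1..n} = insert 1 {2..n}" using n by auto
    then have "(\<Sum>i = 1..n. X i \<omega>) = X 1 \<omega> + (\<Sum>i = 2..n. X i \<omega>)" for \<omega>
      by simp
    ultimately show ?thesis by (simp add: \<mu>s_def Z_eq)
  qed
  have p_law: "density lborel (\<lambda>x. ennreal (p n x)) = \<mu>s n" if "1 \<le> n" for n
    unfolding p_def by (rule RN_density_real[OF \<mu>s ac[OF that]])
  have dens: "has_lborel_density M (?Z n)" if "1 \<le> n" for n
    unfolding has_lborel_density_def
    by (intro exI[of _ "\<lambda>x. ennreal (p n x)"])
       (use p_law[OF that] rvZ[of n] in \<open>simp add: distributed_def distr_lborel_eq_borel \<mu>s_def\<close>)
  define a where "a = \<delta> / DIM(real ^ 'd)"
  have a: "0 < a" using \<delta> by (simp add: a_def)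
  obtain C where C: "\<And>n. 1 \<le> n \<Longrightarrow> integrable M (\<lambda>\<omega>. exp (a * norm (?Z n \<omega>)))"
      "\<And>n. 1 \<le> n \<Longrightarrow> (\<integral>\<omega>. exp (a * norm (?Z n \<omega>)) \<partial>M) \<le> C"
    using M.exp_moment_normalized_sum[OF indep same \<delta>(2,1) mean] unfolding a_def Z_eq by blast
  have C_law: "integrable (\<mu>s n) (\<lambda>x. exp (a * norm x))" "(\<integral>x. exp (a * norm x) \<partial>\<mu>s n) \<le> C" if "1 \<le> n" for n
    using C[OF that] rvZ[of n] by (simp_all add: \<mu>s_def integrable_distr_eq integral_distr)
  obtain c T where law: "distr N borel Z = density lborel (\<lambda>x. ennreal (c * exp (- (x \<bullet> (T *v x)) / 2)))"
    and c: "0 \<le> c" and T: "\<And>x::real ^ 'd. 0 \<le> x \<bullet> (T *v x)"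
    using centered_gaussian_law[OF assms(8-10)] by blast
  have rvN [measurable]: "N.random_variable borel Z"
    using \<open>gaussian_vector N Z\<close> by (auto simp: gaussian_vector_def distributed_def)
  define \<nu> where "\<nu> = distr N borel Z"
  have \<nu>: "prob_space \<nu>" "sets \<nu> = sets borel"
    unfolding \<nu>_def by (auto intro!: N.prob_space_distr)
  let ?g = "\<lambda>x. c * exp (- (x \<bullet> (T *v x)) / 2)"
  have \<nu>_eq: "\<nu> = density lborel (\<lambda>x. ennreal (?g x))" unfolding \<nu>_def by (rule law)
  have gm: "?g \<in> borel_measurable borel" by measurable
  have g_lc: "log_concave ?g"
    by (rule log_concave_exp_convex[OF c]) (rule quadratic_form_convex[OF T])
  obtain \<delta>\<^sub>1 where \<delta>\<^sub>1: "0 < \<delta>\<^sub>1" "integrable \<nu> (\<lambda>x. exp (\<delta>\<^sub>1 * norm x))"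
    using log_concave_law(2)[OF \<nu>(1)[unfolded \<nu>_eq] gm _ g_lc] c unfolding \<nu>_eq by auto
  have moments\<nu>: "integrable \<nu> (\<lambda>x. norm x ^ k)" for k
    using integrable_power_times_exp[OF \<nu>(2) \<delta>\<^sub>1(2), of 0 k] \<delta>\<^sub>1(1) by simp
  have mean\<nu>: "(\<integral>x. t \<bullet> x \<partial>\<nu>) = 0" for t
  proof -
    have "integrable N Z" "(\<integral>\<omega>. Z \<omega> \<partial>N) = 0"
      using \<open>centered_vector N Z\<close> by (auto simp: centered_vector_def)
    then have "(\<integral>\<omega>. t \<bullet> Z \<omega> \<partial>N) = 0" by (subst integral_inner_right) auto
    then show ?thesis
      unfolding \<nu>_def by (subst integral_distr[OF rvN]) auto
  qed
  have m2: "integrable M (\<lambda>\<omega>. (norm (X 1 \<omega>))\<^sup>2)"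
    using moments[of 2] unfolding \<mu>_def by (subst (asm) integrable_distr_eq[OF rv1]) simp_all
  have second: "(\<integral>x. (t \<bullet> x)\<^sup>2 \<partial>\<nu>) = (\<integral>x. (t \<bullet> x)\<^sup>2 \<partial>\<mu>)" for t
  proof -
    have "(\<integral>x. (t \<bullet> x)\<^sup>2 \<partial>\<nu>) = (\<integral>\<omega>. (t \<bullet> Z \<omega>)\<^sup>2 \<partial>N)"
      unfolding \<nu>_def by (subst integral_distr) auto
    also have "\<dots> = (\<Sum>i\<in>UNIV. \<Sum>j\<in>UNIV. t $ i * t $ j * covariance_matrix N Z $ i $ j)"
      using moments\<nu>[of 2] \<open>centered_vector N Z\<close>
      by (intro N.second_moment_eq_covariance) (auto simp: \<nu>_def integrable_distr_eq)
    also have "\<dots> = (\<Sum>i\<in>UNIV. \<Sum>j\<in>UNIV. t $ i * t $ j * covariance_matrix M (X 1) $ i $ j)"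
      using assms(11) by simp
    also have "\<dots> = (\<integral>\<omega>. (t \<bullet> X 1 \<omega>)\<^sup>2 \<partial>M)"
      by (rule M.second_moment_eq_covariance[OF rv1 m2 assms(6)[OF order_refl], symmetric])
    also have "\<dots> = (\<integral>x. (t \<bullet> x)\<^sup>2 \<partial>\<mu>)"
      unfolding \<mu>_def by (subst integral_distr[OF rv1]) auto
    finally show ?thesis .
  qed
  define G where "G t = exp (- of_real (\<integral>x. (t \<bullet> x)\<^sup>2 \<partial>\<mu>) / 2 :: complex)" for t
  \<comment> \<open>By equality of the second moments, \<open>G\<close> is also the characteristic function of the Gaussian law.\<close>
  have charf_\<nu>: "charf \<nu> = G"
  proof
    fix t
    show "charf \<nu> t = G t"
      unfolding G_def second[symmetric]
      by (rule charf_gaussian[OF \<nu>_eq \<nu>(1) quadratic_form_measurable c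
            quadratic_form_parallelogram quadratic_form_scale moments\<nu> mean\<nu>])
  qed
  have charf_\<mu>s: "charf (\<mu>s n) = (\<lambda>t. charf \<mu> ((1 / sqrt (real n)) *\<^sub>R t) ^ n)" for n
    unfolding \<mu>s_def Z_eq by (rule ext) (rule M.charf_scaled_iid_sum[OF indep same])
  have int_norm: "integrable \<mu> (\<lambda>x. norm x)" using moments[of 1] by simp
  obtain R where R: "0 < R" "\<And>t. R \<le> norm t \<Longrightarrow> norm (charf \<mu> t) \<le> 1 / 2"
    using charf_half_outside_ball[OF \<mu>_eq \<mu> fm f0 A int_norm] by blast
  have R8: "0 < 1 / (8 * R\<^sup>2)" using R(1) by simp
  have far: "norm (charf \<mu> t) \<le> 1 / 2" if "R \<le> norm t" for t
    using R(2)[OF that] .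
  note near = gaussian_bound_of_doubling[where \<psi>="charf \<mu>" and R=R, OF norm_charf_le_1[OF \<mu>] charf_doubling[OF \<mu> sets\<mu>] R]
  have clt: "(\<lambda>n. charf \<mu> ((1 / sqrt (real n)) *\<^sub>R t) ^ n) \<longlonglongrightarrow> G t" for t
    using charf_power_tendsto[OF \<mu> sets\<mu> moments[of 3] mean[of t]] by (simp only: G_def)
  note L1 = charf_power_L1_limit[where \<psi>="charf \<mu>" and G=G and R=R and c="1 / (8 * R\<^sup>2)",
      OF charf_measurable[OF \<mu> sets\<mu>] charf_square_integrable[OF \<mu>_eq \<mu> fm f0 A]
        norm_charf_le_1[OF \<mu>] R8 R(1) _ _ clt]
  have int_power: "integrable lborel (\<lambda>t. charf \<mu> ((1 / sqrt (real n)) *\<^sub>R t) ^ n)" if "2 \<le> n" for n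
    using L1(1)[OF near far that] by simp
  have int_G: "integrable lborel G" using L1(2)[OF near far] by simp
  have L1_lim: "(\<lambda>n. \<integral>t. norm (charf \<mu> ((1 / sqrt (real n)) *\<^sub>R t) ^ n - G t) \<partial>lborel) \<longlonglongrightarrow> 0"
    using L1(3)[OF near far] by simp
  define q where "q x = enn2real (RN_deriv lborel \<nu> x)" for x
  have qm [measurable]: "q \<in> borel_measurable borel"
    unfolding q_def using borel_measurable_RN_deriv[of lborel \<nu>] by simp
  have q0: "0 \<le> q x" for x by (simp add: q_def)
  have q_law: "density lborel (\<lambda>x. ennreal (q x)) = \<nu>"
    unfolding q_def
  proof (rule RN_density_real[OF \<nu>])
    show "absolutely_continuous lborel \<nu>"
      unfolding \<nu>_eq by (rule absolutely_continuousI_density) (use gm in simp)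
  qed
  define \<epsilon> where "\<epsilon> n = (\<integral>t. norm (charf (\<mu>s n) t - G t) \<partial>lborel) / (2 * pi) ^ DIM(real ^ 'd)" for n
  have \<epsilon>: "\<epsilon> \<longlonglongrightarrow> 0"
    unfolding \<epsilon>_def charf_\<mu>s using tendsto_divide[OF L1_lim tendsto_const[of "(2 * pi) ^ DIM(real ^ 'd)"]] by simp
  have close: "AE x in lborel. \<bar>p n x - q x\<bar> \<le> \<epsilon> n" if n: "2 \<le> n" for n
  proof -
    have n1: "1 \<le> n" using n by simp
    have "AE x in lborel. \<bar>p n x - q x\<bar> \<le>
       (\<integral>t. norm (charf (density lborel (p n)) t - charf (density lborel q) t) \<partial>lborel) / (2 * pi) ^ DIM(real ^ 'd)"
    proof (rule density_diff_le_charf_diff)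
      show "integrable lborel (charf (density lborel (p n)))" "integrable lborel (charf (density lborel q))"
        unfolding p_law[OF n1] q_law charf_\<nu> charf_\<mu>s by (rule int_power[OF n], rule int_G)
      show "prob_space (density lborel (p n))" "prob_space (density lborel q)"
        unfolding p_law[OF n1] q_law by (rule \<mu>s(1), rule \<nu>(1))
    qed (use p0 q0 in auto)
    then show ?thesis by (simp add: p_law[OF n1] q_law charf_\<nu> \<epsilon>_def)
  qed
  \<comment> \<open>A common exponential rate for the normalized sums and for the Gaussian law.\<close>
  define a' where "a' = min a \<delta>\<^sub>1"
  have a': "0 < a'" "a' \<le> a" "a' \<le> \<delta>\<^sub>1" using a \<delta>\<^sub>1 by (auto simp: a'_def)
  have weaken: "integrable \<eta> (\<lambda>x. exp (a' * norm x))"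
    if "integrable \<eta> (\<lambda>x. exp (b * norm x))" "a' \<le> b" "sets \<eta> = sets borel" for \<eta> :: "(real ^ 'd) measure" and b
  proof (rule Bochner_Integration.integrable_bound[OF that(1)])
    show "(\<lambda>x. exp (a' * norm x)) \<in> borel_measurable \<eta>"
      unfolding measurable_cong_sets[OF that(3) refl] by measurable
  qed (use that(2) in \<open>auto intro!: AE_I2 mult_right_mono\<close>)
  have ip: "integrable lborel (\<lambda>x. p n x * exp (a' * norm x))"
    and bp: "(\<integral>x. p n x * exp (a' * norm x) \<partial>lborel) \<le> C" if n: "1 \<le> n" for n
  proof -
    have i: "integrable (\<mu>s n) (\<lambda>x. exp (a' * norm x))"
      by (rule weaken[OF C_law(1)[OF n] a'(2) \<mu>s(2)])
    then show "integrable lborel (\<lambda>x. p n x * exp (a' * norm x))"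
      unfolding p_law[OF n, symmetric] using p0 by (subst (asm) integrable_density) auto
    have "(\<integral>x. p n x * exp (a' * norm x) \<partial>lborel) = (\<integral>x. exp (a' * norm x) \<partial>\<mu>s n)"
      unfolding p_law[OF n, symmetric] using p0 by (subst integral_density) auto
    also have "\<dots> \<le> (\<integral>x. exp (a * norm x) \<partial>\<mu>s n)"
      using a' by (intro integral_mono' C_law n) (auto intro!: mult_right_mono)
    finally show "(\<integral>x. p n x * exp (a' * norm x) \<partial>lborel) \<le> C" using C_law(2)[OF n] by simp
  qed
  have iq: "integrable lborel (\<lambda>x. q x * exp (a' * norm x))"
    using weaken[OF \<delta>\<^sub>1(2) a'(3) \<nu>(2)] unfolding q_law[symmetric] using q0 by (subst (asm) integrable_density) auto
  have int_p: "integrable lborel (\<lambda>x. p n x powr r)" if "1 \<le> n" for n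
    by (rule integrable_powr_of_exp_moment[OF r a'(1) pm p0 ip[OF that]])
  have int_q: "integrable lborel (\<lambda>x. q x powr r)"
    by (rule integrable_powr_of_exp_moment[OF r a'(1) qm q0 iq])
  define J where "J n = (\<integral>x. p n x powr r \<partial>lborel)" for n
  define J' where "J' = (\<integral>x. q x powr r \<partial>lborel)"
  \<comment> \<open>The uniform bound \<open>close\<close> requires \<open>n \<ge> 2\<close>, where the characteristic function is integrable.\<close>
  have "(\<lambda>n. J (n + 2)) \<longlonglongrightarrow> J'"
    unfolding J_def J'_def
    by (rule powr_integral_tendsto[OF r a'(1) pm qm p0 q0 _ _ iq _ LIMSEQ_ignore_initial_segment[OF \<epsilon>, of 2]])
       (use ip bp close in auto)
  then have J: "J \<longlonglongrightarrow> J'" by (rule LIMSEQ_offset)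
  \<comment> \<open>Positivity of the limit puts the logarithm in its continuous range.\<close>
  have J'_pos: "0 < J'"
  proof (rule ccontr)
    assume "\<not> 0 < J'"
    moreover have "0 \<le> J'" by (simp add: J'_def)
    ultimately have "J' = 0" by linarith
    then have "AE x in lborel. q x powr r = 0"
      unfolding J'_def by (subst (asm) integral_nonneg_eq_0_iff_AE[OF int_q]) auto
    then have "AE x in lborel. q x = 0" by simp
    then have "(\<integral>x. q x \<partial>lborel) = 0" by (simp add: integral_eq_zero_AE)
    then show False
      using integral_of_prob_density(2)[of q] \<nu>(1) qm q0 by (simp add: q_law)
  qed
  have fin: "renyi_entropy r M (?Z n) < \<infinity>" if "1 \<le> n" for n
    using renyi_entropy_of_integrable(1)[OF r(2), of M "?Z n"] int_p[OF that] by (simp add: p_def \<mu>s_def)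
  have ent_Z: "renyi_entropy r N Z = ereal (1 / (1 - r) * ln J')"
    using renyi_entropy_of_integrable(2)[OF r(2), of N Z] int_q J'_pos by (simp add: q_def \<nu>_def J'_def)
  have "eventually (\<lambda>n. 0 < J n) sequentially"
    using J J'_pos by (rule order_tendstoD)
  then have ev: "eventually (\<lambda>n. renyi_entropy r M (?Z n) = ereal (1 / (1 - r) * ln (J n))) sequentially"
    using eventually_ge_at_top[of 1]
  proof eventually_elim
    case (elim n)
    then show ?case
      using renyi_entropy_of_integrable(2)[OF r(2), of M "?Z n"] int_p[of n] by (simp add: p_def \<mu>s_def J_def)
  qed
  have "(\<lambda>n. ereal (1 / (1 - r) * ln (J n))) \<longlonglongrightarrow> ereal (1 / (1 - r) * ln J')"
    using J J'_pos by (intro tendsto_ereal tendsto_mult tendsto_const tendsto_ln) auto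
  then have "(\<lambda>n. renyi_entropy r M (?Z n)) \<longlonglongrightarrow> renyi_entropy r N Z"
    unfolding ent_Z tendsto_cong[OF ev] .
  then show ?thesis using dens fin by blast
qed

end
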